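(* Let $K\ge 2$ be an integer, $\varepsilon>0$, $\beta>\log K$ and $1\le p<\infty$. Let $X$ be a regular $K$-ary rooted tree with root $0$, equipped with the metric $d_X(x,y)=\int_{[x,y]}e^{-\varepsilon|z|}\,d|z|$ and the measure $d\mu(x)=e^{-\beta|x|}\,d|x|$. Then for every $\theta$ satisfying $$0<\theta\le 1-\frac{\beta-\log K}{p\varepsilon},$$ there are a constant $C>0$ and a bounded linear trace operator $\operatorname{Tr}:N^{1,p}(X)\to B^\theta_{p,p}(\partial X)$ such that for every $f\in N^{1,p}(X)$, $$\|\operatorname{Tr} f\|_{L^p(\partial X)}\le |f(0)|+C\|g_f\|_{L^p(X)}\quad\text{and}\quad \|\operatorname{Tr} f\|_{B^\theta_{p,p}(\partial X)}\le C\|g_f\|_{L^p(X)},$$ where $C$ does not depend on $f$. In particular, $\|\operatorname{Tr} f\|_{\widetilde B^\theta_{p,p}(\partial X)}\le C'\|f\|_{N^{1,p}(X)}$ with $C'$ independent of $f$. Furthermore, if $f:X\to\mathbb{R}$ is Lipschitz (with respect to $d_X$), then $\operatorname{Tr} f=f|_{\partial X}$, where the continuous extension of $f$ to the completion $\overline X=X\cup\partial X$ is also denoted by $f$.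
   Context: A rooted tree is a connected graph without cycles with a distinguished vertex $0$ (the root). Each edge is regarded as an isometric copy of the unit interval, so that $X$ consists of vertices and edge points; $[x,y]$ is the geodesic between $x$ and $y$, $|x-y|$ is its (unweighted) length, $|x|=|x-0|$, and $d|z|$ is the measure giving each edge Lebesgue measure $1$. The neighbor of a vertex $x\neq 0$ closer to the root is its parent; all other neighbors are its children. A tree is regular $K$-ary if every vertex has exactly $K$ children. Upper gradients: a Borel function $g:X\to[0,\infty]$ is an upper gradient of $u:X\to\mathbb{R}$ if $|u(z)-u(y)|\le\int_{[z,y]}g\,d_Xs$ for all $z,y\in X$, where $d_Xs=e^{-\varepsilon|x|}\,d|x|$ is arc length with respect to $d_X$. The Newtonian space $N^{1,p}(X)$ consists of the functions $u$ on $X$ with $\|u\|_{N^{1,p}(X)}:=\bigl(\int_X|u|^p\,d\mu+\inf_g\int_X g^p\,d\mu\bigr)^{1/p}<\infty$, the infimum being over all upper gradients $g$ of $u$. Each $u\in N^{1,p}(X)$ has a minimal upper gradient $g_u\in L^p(X)$, unique up to measure zero, with $g_u\le g$ a.e. for every upper gradient $g\in L^p(X)$ of $u$. $L^p(X)$ is with respect to $\mu$. Boundary: $\partial X=\overline X\setminus X$, where $\overline X$ is the completion of $X$ with respect to $d_X$; its elements are identified with the infinite geodesics starting at $0$. For distinct $\zeta,\xi\in\partial X$ whose geodesics from $0$ share exactly their first $k$ edges, $d_X(\zeta,\xi)=\frac{2}{\varepsilon}e^{-\varepsilon k}$. $B(\zeta,t)$ is the open ball in $\partial X$. $\nu$ is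 the normalized $Q$-dimensional Hausdorff measure on $\partial X$ with $Q=(\log K)/\varepsilon$; it is the probability measure assigning mass $K^{-n}$ to the set of boundary points whose geodesic passes through a given vertex at distance $n$ from $0$. Besov spaces: for $\nu$-measurable $f:\partial X\to\mathbb{R}$ and $t>0$, $$E_p(f,t)=\Bigl(\int_{\partial X}\frac{1}{\nu(B(\zeta,t))}\int_{B(\zeta,t)}|f(\zeta)-f(\xi)|^p\,d\nu(\xi)\,d\nu(\zeta)\Bigr)^{1/p},$$ and for $\theta>0$, $\|f\|_{B^\theta_{p,p}(\partial X)}=\bigl(\int_0^\infty (E_p(f,t)/t^\theta)^p\,\frac{dt}{t}\bigr)^{1/p}$ (a seminorm). $B^\theta_{p,p}(\partial X)$ consists of all $f\in L^p(\partial X)=L^p(\partial X,\nu)$ with finite seminorm, normed by $\|f\|_{\widetilde B^\theta_{p,p}(\partial X)}=\|f\|_{L^p(\partial X)}+\|f\|_{B^\theta_{p,p}(\partial X)}$. *)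

theory Defs
  imports "HOL-Analysis.Analysis"
begin

section \<open>Rooted trees\<close>

text \<open>
  A graph is given by its adjacency relation; the vertices are all the elements of the
  type \<open>'v\<close>.
\<close>

definition is_cycle :: "('v \<Rightarrow> 'v \<Rightarrow> bool) \<Rightarrow> 'v list \<Rightarrow> bool" where
  "is_cycle E c \<longleftrightarrow> 3 \<le> length c \<and> distinct c \<and>
     (\<forall>i<length c. E (c ! i) (c ! (Suc i mod length c)))"

definition is_tree :: "('v \<Rightarrow> 'v \<Rightarrow> bool) \<Rightarrow> bool" where
  "is_tree E \<longleftrightarrow> symp E \<and> irreflp E \<and> (\<forall>x y. E\<^sup>*\<^sup>* x y) \<and> (\<nexists>c. is_cycle E c)"

definition graph_dist :: "('v \<Rightarrow> 'v \<Rightarrow> bool) \<Rightarrow> 'v \<Rightarrow> 'v \<Rightarrow> nat" where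
  "graph_dist E x y = (LEAST n. (E ^^ n) x y)"

definition is_parent :: "('v \<Rightarrow> 'v \<Rightarrow> bool) \<Rightarrow> 'v \<Rightarrow> 'v \<Rightarrow> 'v \<Rightarrow> bool" where
  "is_parent E r x y \<longleftrightarrow> E x y \<and> graph_dist E r y < graph_dist E r x"

definition parent :: "('v \<Rightarrow> 'v \<Rightarrow> bool) \<Rightarrow> 'v \<Rightarrow> 'v \<Rightarrow> 'v" where
  "parent E r x = (THE y. is_parent E r x y)"

definition children :: "('v \<Rightarrow> 'v \<Rightarrow> bool) \<Rightarrow> 'v \<Rightarrow> 'v \<Rightarrow> 'v set" where
  "children E r x = {y. E x y \<and> \<not> is_parent E r x y}"

definition regular_rooted_tree :: "nat \<Rightarrow> ('v \<Rightarrow> 'v \<Rightarrow> bool) \<Rightarrow> 'v \<Rightarrow> bool" where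
  "regular_rooted_tree K E r \<longleftrightarrow>
     is_tree E \<and> (\<forall>x. finite (children E r x) \<and> card (children E r x) = K)"


section \<open>The metric tree\<close>

text \<open>
  The pair \<open>(v, t)\<close> is the point at distance \<open>t\<close> from the vertex \<open>v\<close> on the edge
  joining \<open>v\<close> to its parent. With \<open>0 \<le> t < 1\<close>, and \<open>t = 0\<close> for the root, each point of
  the tree is represented exactly once; the vertex \<open>v\<close> is \<open>(v, 0)\<close>.
\<close>

type_synonym 'v point = "'v \<times> real"

definition tree_points :: "'v \<Rightarrow> 'v point set" where
  "tree_points r = {(v, t). 0 \<le> t \<and> t < 1 \<and> (v = r \<longrightarrow> t = 0)}"

text \<open>
  The end vertices of the edge containing a point, with the distances to them
  (for a vertex, only the vertex itself).
\<close>

definition edge_ends :: "('v \<Rightarrow> 'v \<Rightarrow> bool) \<Rightarrow> 'v \<Rightarrow> 'v point \<Rightarrow> ('v \<times> real) set" where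
  "edge_ends E r x =
     insert x (if snd x = 0 then {} else {(parent E r (fst x), 1 - snd x)})"

text \<open>The unweighted distance \<open>|x - y|\<close>, i.e. the length of a shortest path.\<close>

definition tree_dist :: "('v \<Rightarrow> 'v \<Rightarrow> bool) \<Rightarrow> 'v \<Rightarrow> 'v point \<Rightarrow> 'v point \<Rightarrow> real" where
  "tree_dist E r x y =
     (if fst x = fst y then \<bar>snd x - snd y\<bar>
      else Min {a + real (graph_dist E v w) + b | v a w b.
                  (v, a) \<in> edge_ends E r x \<and> (w, b) \<in> edge_ends E r y})"

definition level :: "('v \<Rightarrow> 'v \<Rightarrow> bool) \<Rightarrow> 'v \<Rightarrow> 'v point \<Rightarrow> real" where
  "level E r x = tree_dist E r x (r, 0)"

definition geodesic :: "('v \<Rightarrow> 'v \<Rightarrow> bool) \<Rightarrow> 'v \<Rightarrow> 'v point \<Rightarrow> 'v point \<Rightarrow> 'v point set" where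
  "geodesic E r x y =
     {z \<in> tree_points r. tree_dist E r x z + tree_dist E r z y = tree_dist E r x y}"

text \<open>
  The measure \<open>d|z|\<close>: a set is measurable if its trace on each edge is a Borel set, and
  its measure is the sum over all edges of the Lebesgue measures of these traces.
  (The root contributes a subset of \<open>{0}\<close>, which is null.)
\<close>

definition length_measure :: "'v \<Rightarrow> 'v point measure" where
  "length_measure r = measure_of (tree_points r)
     {A. A \<subseteq> tree_points r \<and> (\<forall>v. {t. (v, t) \<in> A} \<in> sets borel)}
     (\<lambda>A. \<integral>\<^sup>+ v. emeasure lborel {t. (v, t) \<in> A} \<partial>count_space UNIV)"

definition d_X :: "('v \<Rightarrow> 'v \<Rightarrow> bool) \<Rightarrow> 'v \<Rightarrow> real \<Rightarrow> 'v point \<Rightarrow> 'v point \<Rightarrow> real" where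
  "d_X E r \<epsilon> x y = (LINT z:geodesic E r x y|length_measure r. exp (- \<epsilon> * level E r z))"

definition \<mu>_X :: "('v \<Rightarrow> 'v \<Rightarrow> bool) \<Rightarrow> 'v \<Rightarrow> real \<Rightarrow> 'v point measure" where
  "\<mu>_X E r \<beta> = density (length_measure r) (\<lambda>z. ennreal (exp (- \<beta> * level E r z)))"

definition metric_borel :: "'a set \<Rightarrow> ('a \<Rightarrow> 'a \<Rightarrow> real) \<Rightarrow> 'a measure" where
  "metric_borel S d = sigma S {U. openin (Metric_space.mtopology S d) U}"


section \<open>Newtonian spaces\<close>

text \<open>The power \<open>a\<^sup>q\<close> for \<open>a \<in> [0, \<infinity>]\<close> and \<open>q > 0\<close>.\<close>

definition epowr :: "ennreal \<Rightarrow> real \<Rightarrow> ennreal" where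
  "epowr a q = (if a = \<infinity> then \<infinity> else ennreal (enn2real a powr q))"

definition Lp_norm :: "'a measure \<Rightarrow> real \<Rightarrow> ('a \<Rightarrow> ennreal) \<Rightarrow> ennreal" where
  "Lp_norm M p h = epowr (\<integral>\<^sup>+ x. epowr (h x) p \<partial>M) (1 / p)"

definition upper_gradient ::
  "('v \<Rightarrow> 'v \<Rightarrow> bool) \<Rightarrow> 'v \<Rightarrow> real \<Rightarrow> ('v point \<Rightarrow> real) \<Rightarrow> ('v point \<Rightarrow> ennreal) \<Rightarrow> bool" where
  "upper_gradient E r \<epsilon> u g \<longleftrightarrow>
     g \<in> borel_measurable (metric_borel (tree_points r) (d_X E r \<epsilon>)) \<and>
     (\<forall>z\<in>tree_points r. \<forall>y\<in>tree_points r. ennreal \<bar>u z - u y\<bar> \<le>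
        (\<integral>\<^sup>+ x\<in>geodesic E r z y. g x * ennreal (exp (- \<epsilon> * level E r x)) \<partial>length_measure r))"

definition newton_norm ::
  "('v \<Rightarrow> 'v \<Rightarrow> bool) \<Rightarrow> 'v \<Rightarrow> real \<Rightarrow> real \<Rightarrow> real \<Rightarrow> ('v point \<Rightarrow> real) \<Rightarrow> ennreal" where
  "newton_norm E r \<epsilon> \<beta> p u =
     epowr ((\<integral>\<^sup>+ x. epowr (ennreal \<bar>u x\<bar>) p \<partial>\<mu>_X E r \<beta>) +
            (INF g\<in>{g. upper_gradient E r \<epsilon> u g}. \<integral>\<^sup>+ x. epowr (g x) p \<partial>\<mu>_X E r \<beta>))
           (1 / p)"

definition newton_space ::
  "('v \<Rightarrow> 'v \<Rightarrow> bool) \<Rightarrow> 'v \<Rightarrow> real \<Rightarrow> real \<Rightarrow> real \<Rightarrow> ('v point \<Rightarrow> real) set" where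
  "newton_space E r \<epsilon> \<beta> p = {u. newton_norm E r \<epsilon> \<beta> p u < \<infinity>}"

text \<open>
  A minimal upper gradient is unique only up to a null set, so this is a predicate on
  representatives; norms of \<open>g\<^sub>u\<close> do not depend on the representative.
\<close>

definition minimal_upper_gradient ::
  "('v \<Rightarrow> 'v \<Rightarrow> bool) \<Rightarrow> 'v \<Rightarrow> real \<Rightarrow> real \<Rightarrow> real \<Rightarrow> ('v point \<Rightarrow> real) \<Rightarrow>
   ('v point \<Rightarrow> ennreal) \<Rightarrow> bool" where
  "minimal_upper_gradient E r \<epsilon> \<beta> p u g \<longleftrightarrow>
     upper_gradient E r \<epsilon> u g \<and> Lp_norm (\<mu>_X E r \<beta>) p g < \<infinity> \<and>
     (\<forall>h. upper_gradient E r \<epsilon> u h \<and> Lp_norm (\<mu>_X E r \<beta>) p h < \<infinity> \<longrightarrow>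
          (AE x in \<mu>_X E r \<beta>. g x \<le> h x))"

definition lipschitz_tree ::
  "('v \<Rightarrow> 'v \<Rightarrow> bool) \<Rightarrow> 'v \<Rightarrow> real \<Rightarrow> ('v point \<Rightarrow> real) \<Rightarrow> bool" where
  "lipschitz_tree E r \<epsilon> u \<longleftrightarrow>
     (\<exists>L. \<forall>x\<in>tree_points r. \<forall>y\<in>tree_points r. \<bar>u x - u y\<bar> \<le> L * d_X E r \<epsilon> x y)"


section \<open>Completion and boundary\<close>

definition tree_boundary :: "('v \<Rightarrow> 'v \<Rightarrow> bool) \<Rightarrow> 'v \<Rightarrow> (nat \<Rightarrow> 'v) set" where
  "tree_boundary E r = {\<zeta>. \<zeta> 0 = r \<and> (\<forall>m n. m \<le> n \<longrightarrow> graph_dist E (\<zeta> m) (\<zeta> n) = n - m)}"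

text \<open>
  A point of the completion is either a point of the tree or an infinite geodesic from
  the root, which stands for the limit of its vertices; accordingly the extended metric
  is a limit of distances in the tree.
\<close>

definition tree_completion :: "('v \<Rightarrow> 'v \<Rightarrow> bool) \<Rightarrow> 'v \<Rightarrow> ('v point + (nat \<Rightarrow> 'v)) set" where
  "tree_completion E r = tree_points r <+> tree_boundary E r"

fun approx_seq :: "'v point + (nat \<Rightarrow> 'v) \<Rightarrow> nat \<Rightarrow> 'v point" where
  "approx_seq (Inl x) n = x"
| "approx_seq (Inr \<zeta>) n = (\<zeta> n, 0)"

definition d_completion ::
  "('v \<Rightarrow> 'v \<Rightarrow> bool) \<Rightarrow> 'v \<Rightarrow> real \<Rightarrow>
   'v point + (nat \<Rightarrow> 'v) \<Rightarrow> 'v point + (nat \<Rightarrow> 'v) \<Rightarrow> real" where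
  "d_completion E r \<epsilon> a b =
     (if a \<in> tree_completion E r \<and> b \<in> tree_completion E r
      then lim (\<lambda>n. d_X E r \<epsilon> (approx_seq a n) (approx_seq b n)) else 0)"

definition d_boundary ::
  "('v \<Rightarrow> 'v \<Rightarrow> bool) \<Rightarrow> 'v \<Rightarrow> real \<Rightarrow> (nat \<Rightarrow> 'v) \<Rightarrow> (nat \<Rightarrow> 'v) \<Rightarrow> real" where
  "d_boundary E r \<epsilon> \<zeta> \<xi> = d_completion E r \<epsilon> (Inr \<zeta>) (Inr \<xi>)"

definition continuous_extension ::
  "('v \<Rightarrow> 'v \<Rightarrow> bool) \<Rightarrow> 'v \<Rightarrow> real \<Rightarrow> ('v point \<Rightarrow> real) \<Rightarrow>
   ('v point + (nat \<Rightarrow> 'v) \<Rightarrow> real) \<Rightarrow> bool" where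
  "continuous_extension E r \<epsilon> u F \<longleftrightarrow>
     continuous_map (Metric_space.mtopology (tree_completion E r) (d_completion E r \<epsilon>))
       euclideanreal F \<and>
     (\<forall>x\<in>tree_points r. F (Inl x) = u x)"


section \<open>Hausdorff measure on the boundary\<close>

definition set_diam :: "('a \<Rightarrow> 'a \<Rightarrow> real) \<Rightarrow> 'a set \<Rightarrow> ennreal" where
  "set_diam d A = (SUP x\<in>A. SUP y\<in>A. ennreal (d x y))"

definition hausdorff_premeasure ::
  "'a set \<Rightarrow> ('a \<Rightarrow> 'a \<Rightarrow> real) \<Rightarrow> real \<Rightarrow> real \<Rightarrow> 'a set \<Rightarrow> ennreal" where
  "hausdorff_premeasure S d Q \<delta> A =
     (INF U\<in>{U :: nat \<Rightarrow> 'a set. A \<subseteq> (\<Union>i. U i) \<and> (\<forall>i. U i \<subseteq> S \<and> set_diam d (U i) \<le> ennreal \<delta>)}.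
        \<Sum>i. epowr (set_diam d (U i)) Q)"

definition hausdorff_measure ::
  "'a set \<Rightarrow> ('a \<Rightarrow> 'a \<Rightarrow> real) \<Rightarrow> real \<Rightarrow> 'a set \<Rightarrow> ennreal" where
  "hausdorff_measure S d Q A = (SUP \<delta>\<in>{0<..}. hausdorff_premeasure S d Q \<delta> A)"

definition \<nu>_boundary :: "nat \<Rightarrow> ('v \<Rightarrow> 'v \<Rightarrow> bool) \<Rightarrow> 'v \<Rightarrow> real \<Rightarrow> (nat \<Rightarrow> 'v) measure" where
  "\<nu>_boundary K E r \<epsilon> =
     (let S = tree_boundary E r; d = d_boundary E r \<epsilon>; H = hausdorff_measure S d (ln (real K) / \<epsilon>)
      in measure_of S (sets (metric_borel S d)) (\<lambda>A. H A / H S))"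


section \<open>Besov spaces\<close>

definition besov_E ::
  "nat \<Rightarrow> ('v \<Rightarrow> 'v \<Rightarrow> bool) \<Rightarrow> 'v \<Rightarrow> real \<Rightarrow> real \<Rightarrow> ((nat \<Rightarrow> 'v) \<Rightarrow> real) \<Rightarrow> real \<Rightarrow> ennreal" where
  "besov_E K E r \<epsilon> p f t =
     (let \<nu> = \<nu>_boundary K E r \<epsilon>;
          B = (\<lambda>\<zeta>. Metric_space.mball (tree_boundary E r) (d_boundary E r \<epsilon>) \<zeta> t)
      in epowr (\<integral>\<^sup>+ \<zeta>. (\<integral>\<^sup>+ \<xi>\<in>B \<zeta>. epowr (ennreal \<bar>f \<zeta> - f \<xi>\<bar>) p \<partial>\<nu>) / emeasure \<nu> (B \<zeta>) \<partial>\<nu>)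
               (1 / p))"

definition besov_seminorm ::
  "nat \<Rightarrow> ('v \<Rightarrow> 'v \<Rightarrow> bool) \<Rightarrow> 'v \<Rightarrow> real \<Rightarrow> real \<Rightarrow> real \<Rightarrow> ((nat \<Rightarrow> 'v) \<Rightarrow> real) \<Rightarrow> ennreal" where
  "besov_seminorm K E r \<epsilon> \<theta> p f =
     epowr (\<integral>\<^sup>+ t\<in>{0<..}. epowr (besov_E K E r \<epsilon> p f t / ennreal (t powr \<theta>)) p / ennreal t \<partial>lborel)
           (1 / p)"

definition boundary_Lp_norm ::
  "nat \<Rightarrow> ('v \<Rightarrow> 'v \<Rightarrow> bool) \<Rightarrow> 'v \<Rightarrow> real \<Rightarrow> real \<Rightarrow> ((nat \<Rightarrow> 'v) \<Rightarrow> real) \<Rightarrow> ennreal" where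
  "boundary_Lp_norm K E r \<epsilon> p f = Lp_norm (\<nu>_boundary K E r \<epsilon>) p (\<lambda>\<zeta>. ennreal \<bar>f \<zeta>\<bar>)"

definition besov_norm ::
  "nat \<Rightarrow> ('v \<Rightarrow> 'v \<Rightarrow> bool) \<Rightarrow> 'v \<Rightarrow> real \<Rightarrow> real \<Rightarrow> real \<Rightarrow> ((nat \<Rightarrow> 'v) \<Rightarrow> real) \<Rightarrow> ennreal" where
  "besov_norm K E r \<epsilon> \<theta> p f = boundary_Lp_norm K E r \<epsilon> p f + besov_seminorm K E r \<epsilon> \<theta> p f"

definition besov_space ::
  "nat \<Rightarrow> ('v \<Rightarrow> 'v \<Rightarrow> bool) \<Rightarrow> 'v \<Rightarrow> real \<Rightarrow> real \<Rightarrow> real \<Rightarrow> ((nat \<Rightarrow> 'v) \<Rightarrow> real) set" where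
  "besov_space K E r \<epsilon> \<theta> p =
     {f \<in> borel_measurable (\<nu>_boundary K E r \<epsilon>).
        boundary_Lp_norm K E r \<epsilon> p f < \<infinity> \<and> besov_seminorm K E r \<epsilon> \<theta> p f < \<infinity>}"

text \<open>
  Elements of the Besov space are classes of functions that agree almost everywhere, so
  linearity is an identity almost everywhere.
\<close>

definition linear_operator ::
  "('a \<Rightarrow> real) set \<Rightarrow> 'b measure \<Rightarrow> (('a \<Rightarrow> real) \<Rightarrow> 'b \<Rightarrow> real) \<Rightarrow> bool" where
  "linear_operator N \<nu> T \<longleftrightarrow>
     (\<forall>f\<in>N. \<forall>g\<in>N. \<forall>a b. AE \<zeta> in \<nu>. T (\<lambda>x. a * f x + b * g x) \<zeta> = a * T f \<zeta> + b * T g \<zeta>)"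

end

theory Submission
  imports Defs
begin

text \<open>
  Let \<open>g\<close> be an upper gradient of \<open>f\<close> and let \<open>\<zeta>\<close> be an infinite geodesic from the root, with
  vertices \<open>\<zeta> 0, \<zeta> 1, \<dots>\<close>. The trace is the limit of \<open>f\<close> along these vertices. Two consecutive
  values of \<open>f\<close> differ by at most the integral \<open>edge_int g v\<close> of \<open>g\<close> over the edge between them,
  so everything is controlled by the sums \<open>tail n g \<zeta>\<close> of these integrals beyond level \<open>n\<close>
  (\<open>trace_tail\<close>).

  By Jensen's inequality on the edge from a vertex of level \<open>k\<close> to its parent, the \<open>p\<close>-th power
  of the edge integral is at most a constant times \<open>exp ((\<beta> - p\<epsilon>) k)\<close> times the energy of \<open>g\<close> on that edge.
  The boundary measure gives mass \<open>1/K^k\<close> to the geodesics through a vertex of level \<open>k\<close>. The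
  hypothesis on \<open>\<theta>\<close> says precisely that \<open>exp ((\<beta> - p\<epsilon>) k) / K^k \<le> \<rho>^(pk)\<close> with
  \<open>\<rho> = exp (-\<theta>\<epsilon>) < 1\<close>. Spreading the series \<open>tail n g\<close> over geometric weights of ratio \<open>\<rho>\<close>
  and applying Jensen's inequality once more gives (\<open>tail_integral_le\<close>)

    \<open>\<integral> (tail n g)\<^sup>p d\<nu> \<le> C \<rho>^(p(n+1)) (\<Sum>j. \<rho>\<^sup>j \<Gamma>(n + 1 + j))\<close>,

  where \<open>\<Gamma>(k)\<close> is the energy of \<open>g\<close> on all edges ending at level \<open>k\<close>. For \<open>n = 0\<close> the right-hand
  side is at most the total energy; with Minkowski's inequality this is the bound in \<open>L\<^sup>p\<close>. At a
  scale \<open>t\<close> between the diameters belonging to the levels \<open>n\<close> and \<open>n - 1\<close>, the ball of radius \<open>t\<close>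
  around \<open>\<zeta>\<close> consists of the geodesics through \<open>\<zeta> n\<close>. Comparing the traces at two such geodesics with their
  common value \<open>f (\<zeta> n)\<close> bounds \<open>E\<^sub>p(Tr f, t)\<^sup>p\<close> by a multiple of the displayed integral
  (\<open>besov_E_le\<close>). The weight \<open>t^(-\<theta>p) dt/t\<close> contributes \<open>\<rho>^(-pn)\<close>, which cancels the decay of the
  prefactor, and the sum over \<open>n\<close> is a convolution with a geometric sequence, hence again bounded
  by the total energy (\<open>seminorm_le\<close>). These bounds hold for every upper gradient, so that the
  infimum over \<open>g\<close> bounds the norm of the trace by the Newtonian norm; the value at the root is
  recovered from \<open>f\<close> and \<open>g\<close> on a single edge at the root (\<open>root_value_le\<close>).

  Two geometric facts are needed first. All distances, geodesics and integrals along geodesics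
  are expressed by the level and by the Gromov product with respect to the root, that is, the
  level at which two paths from the root separate; this turns the metric into an explicit formula
  (\<open>d_X_eq\<close>) which passes to the completion. Secondly, the Hausdorff measure of the set of
  geodesics through a vertex is computed exactly (\<open>H_cyl\<close>): covering by smaller sets of the same
  kind gives an upper bound, and a mass distribution argument gives a lower bound for the whole
  boundary, which forces equality at every vertex.
\<close>

section \<open>Parents in a rooted tree\<close>

locale rooted_tree =
  fixes K :: nat and E :: "'v \<Rightarrow> 'v \<Rightarrow> bool" and r :: 'v
  assumes regular: "regular_rooted_tree K E r"
begin

lemma tree: "is_tree E"
  using regular by (simp add: regular_rooted_tree_def)

lemma E_sym: "E x y \<Longrightarrow> E y x"
  using tree by (auto simp: is_tree_def dest: sympD)

lemma E_irrefl: "\<not> E x x"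
  using tree by (auto simp: is_tree_def irreflp_def)

lemma acyclic: "\<not> is_cycle E c"
  using tree by (auto simp: is_tree_def)

lemma ex_walk: "\<exists>n. (E ^^ n) x y"
  using tree by (simp add: is_tree_def rtranclp_is_Sup_relpowp)

lemma graph_dist_walk: "(E ^^ graph_dist E x y) x y"
  unfolding graph_dist_def using ex_walk by (rule LeastI_ex)

lemma graph_dist_le: "(E ^^ n) x y \<Longrightarrow> graph_dist E x y \<le> n"
  unfolding graph_dist_def by (rule Least_le)

lemma walk_rev: "(E ^^ n) x y \<Longrightarrow> (E ^^ n) y x"
proof (induction n arbitrary: y)
  case (Suc n)
  then obtain z where "(E ^^ n) x z" "E z y" by auto
  then show ?case using Suc.IH[of z] E_sym by (meson relpowp_Suc_I2)
qed auto

lemma graph_dist_sym: "graph_dist E x y = graph_dist E y x"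
  by (meson antisym graph_dist_le graph_dist_walk walk_rev)

lemma graph_dist_self [simp]: "graph_dist E x x = 0"
  using graph_dist_le[of 0 x x] by simp

lemma graph_dist_zero: "graph_dist E x y = 0 \<longleftrightarrow> x = y"
  using graph_dist_walk[of x y] by (auto intro: ccontr)

definition depth :: "'v \<Rightarrow> nat" where
  "depth v = graph_dist E r v"

lemma depth_root [simp]: "depth r = 0"
  by (simp add: depth_def)

lemma depth_zero [simp]: "depth v = 0 \<longleftrightarrow> v = r"
  by (auto simp: depth_def graph_dist_zero)

lemma depth_adj: "E x y \<Longrightarrow> depth y \<le> Suc (depth x)"
  unfolding depth_def by (meson graph_dist_le graph_dist_walk relpowp_Suc_I)

lemma ex_closer:
  assumes "v \<noteq> r" shows "\<exists>u. E v u \<and> Suc (depth u) = depth v"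
proof -
  obtain n where n: "depth v = Suc n" using assms depth_zero by (metis not0_implies_Suc)
  then have "(E ^^ Suc n) r v" using graph_dist_walk[of r v] by (simp add: depth_def)
  then obtain u where u: "(E ^^ n) r u" "E u v" by auto
  then have "depth u \<le> n" by (simp add: depth_def graph_dist_le)
  moreover have "depth v \<le> Suc (depth u)" using u depth_adj by blast
  ultimately show ?thesis using u n E_sym by auto
qed

text \<open>
  Moving towards the root from both vertices until the two routes meet produces the path. Closing such a path by
  an edge, or by a vertex one level further out, gives the cycles that are excluded in a tree.
\<close>

lemma path_through_lower_levels:
  assumes "depth u = n" "depth w = n" "u \<noteq> w"
  shows "\<exists>ps. 3 \<le> length ps \<and> distinct ps \<and> hd ps = u \<and> last ps = w \<and> successively E ps \<and>
    (\<forall>x\<in>set ps. depth x \<le> n)"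
  using assms
proof (induction n arbitrary: u w)
  case 0
  then show ?case by auto
next
  case (Suc n)
  then have "u \<noteq> r" "w \<noteq> r" by auto
  then obtain u' w' where u': "E u u'" "Suc (depth u') = depth u"
    and w': "E w w'" "Suc (depth w') = depth w"
    using ex_closer by meson
  show ?case
  proof (cases "u' = w'")
    case True
    have "u' \<noteq> u" "u' \<noteq> w" using u' w' True by auto
    then show ?thesis using Suc.prems u' w' True E_sym[OF w'(1)]
      by (intro exI[of _ "[u, u', w]"]) auto
  next
    case False
    then obtain ps where ps: "3 \<le> length ps" "distinct ps" "hd ps = u'" "last ps = w'"
      "successively E ps" "\<forall>x\<in>set ps. depth x \<le> n"
      using Suc.IH[of u' w'] u' w' Suc.prems by auto
    have "u \<notin> set ps" "w \<notin> set ps" "ps \<noteq> []" using ps(1,6) Suc.prems by force+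
    then show ?thesis using ps Suc.prems u' E_sym[OF w'(1)]
      by (intro exI[of _ "u # ps @ [w]"])
         (auto simp: successively_Cons successively_append_iff le_SucI)
  qed
qed

lemma closed_path_cycle:
  assumes "3 \<le> length ps" "distinct ps" "successively E ps" "E (last ps) (hd ps)"
  shows "is_cycle E ps"
  unfolding is_cycle_def
proof (intro conjI allI impI)
  fix i assume i: "i < length ps"
  show "E (ps ! i) (ps ! (Suc i mod length ps))"
  proof (cases "Suc i < length ps")
    case True
    then show ?thesis using assms(3) by (simp add: successively_conv_nth)
  next
    case False
    then have "Suc i = length ps" using i by simp
    then have "i = length ps - 1" "ps \<noteq> []" by auto
    then show ?thesis using assms(4) \<open>Suc i = length ps\<close> by (simp add: last_conv_nth hd_conv_nth)
  qed
qed (use assms in auto)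

text \<open>An edge within a level would close a path through lower levels.\<close>

lemma adj_depth_neq: "E u w \<Longrightarrow> depth u \<noteq> depth w"
proof
  assume "E u w" and eq: "depth u = depth w"
  then have "u \<noteq> w" using E_irrefl by auto
  then obtain ps where "3 \<le> length ps" "distinct ps" "hd ps = u" "last ps = w" "successively E ps"
    using path_through_lower_levels[OF eq refl] by blast
  then show False using closed_path_cycle acyclic E_sym \<open>E u w\<close> by metis
qed

text \<open>
  Two such neighbours lie on the same level, and \<open>v\<close> would close a path between them that only visits
  smaller levels.
\<close>

lemma closer_unique:
  assumes "E v u" "E v w" "depth u < depth v" "depth w < depth v"
  shows "u = w"
proof (rule ccontr)
  assume "u \<noteq> w"
  have d: "depth u = depth w" "Suc (depth u) = depth v" using assms depth_adj E_sym
    by (metis Suc_leI le_antisym old.nat.inject, metis Suc_leI assms(1,3) le_antisym E_sym depth_adj)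
  then obtain ps where ps: "3 \<le> length ps" "distinct ps" "hd ps = u" "last ps = w" "successively E ps"
    "\<forall>x\<in>set ps. depth x \<le> depth w"
    using path_through_lower_levels[OF d(1) refl \<open>u \<noteq> w\<close>] by blast
  have "v \<notin> set ps" using ps d by force
  then have "is_cycle E (v # ps)" using ps assms(1) E_sym[OF assms(2)]
    by (intro closed_path_cycle) (auto simp: successively_Cons)
  then show False using acyclic by simp
qed

text \<open>The root is made its own parent, so that the parent map can be iterated freely.\<close>

definition par :: "'v \<Rightarrow> 'v" where
  "par v = (if v = r then r else parent E r v)"

lemma is_parent_unique: "is_parent E r v u \<Longrightarrow> is_parent E r v w \<Longrightarrow> u = w"
  using closer_unique by (auto simp: is_parent_def depth_def)

lemma is_parent_iff: "is_parent E r v u \<longleftrightarrow> v \<noteq> r \<and> u = par v"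
proof -
  have *: "\<exists>u. is_parent E r v u" if "v \<noteq> r"
    using ex_closer[OF that] by (auto simp: is_parent_def simp flip: depth_def)
  have "is_parent E r v (par v)" if nr: "v \<noteq> r"
  proof -
    obtain w where w: "is_parent E r v w" using *[OF nr] by blast
    from w have "is_parent E r v (THE y. is_parent E r v y)"
      by (rule theI) (rule is_parent_unique[OF _ w])
    then show ?thesis using that by (simp add: par_def parent_def)
  qed
  moreover have "\<not> is_parent E r r u" by (simp add: is_parent_def)
  ultimately show ?thesis using is_parent_unique[of v u "par v"] by auto
qed

lemma par_adj: "v \<noteq> r \<Longrightarrow> E v (par v)"
  using is_parent_iff by (auto simp: is_parent_def)

lemma depth_par: "depth (par v) = depth v - 1"
proof (cases "v = r")
  case False
  then have "is_parent E r v (par v)" by (simp add: is_parent_iff)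
  then have "E (par v) v" "depth (par v) < depth v" by (auto simp: is_parent_def depth_def E_sym)
  then show ?thesis using depth_adj[of "par v" v] by linarith
qed (simp add: par_def)

lemma par_root [simp]: "par r = r" by (simp add: par_def)

lemma adj_cases: "E x y \<Longrightarrow> (x \<noteq> r \<and> y = par x) \<or> (y \<noteq> r \<and> x = par y)"
proof -
  assume a: "E x y"
  then consider "depth y < depth x" | "depth x < depth y" using adj_depth_neq nat_neq_iff by blast
  then show ?thesis
  proof cases
    case 1 then have "is_parent E r x y" using a by (simp add: is_parent_def depth_def)
    then show ?thesis by (simp add: is_parent_iff)
  next
    case 2 then have "is_parent E r y x" using E_sym[OF a] by (simp add: is_parent_def depth_def)
    then show ?thesis by (simp add: is_parent_iff)
  qed
qed

lemma children_eq: "children E r v = {w. w \<noteq> r \<and> par w = v}"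
proof (intro set_eqI iffI)
  fix w assume "w \<in> children E r v"
  then have a: "E v w" "\<not> (v \<noteq> r \<and> w = par v)" by (auto simp: children_def is_parent_iff)
  then show "w \<in> {w. w \<noteq> r \<and> par w = v}" using adj_cases[OF a(1)] by auto
next
  fix w assume "w \<in> {w. w \<noteq> r \<and> par w = v}"
  then have w: "w \<noteq> r" "par w = v" by auto
  then have "E v w" using par_adj E_sym by metis
  moreover have "depth w \<noteq> depth v - 1 \<or> v = r" using depth_par[of w] w
    by (metis depth_zero diff_diff_eq diff_is_0_eq' le_add1 diff_le_self less_one linorder_not_less nat_less_le diff_less zero_less_one neq0_conv)
  ultimately show "w \<in> children E r v" using depth_par[of v]
    by (auto simp: children_def is_parent_iff)
qed

lemma finite_children: "finite {w. w \<noteq> r \<and> par w = v}"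
  and card_children: "card {w. w \<noteq> r \<and> par w = v} = K"
  using regular by (auto simp: regular_rooted_tree_def children_eq)

section \<open>Ancestors and the level of separation\<close>

text \<open>
  Ancestors are indexed by their level instead of the number of steps, so that ancestors of vertices on different
  levels can be compared.
\<close>

definition anc :: "'v \<Rightarrow> nat \<Rightarrow> 'v" where
  "anc v j = (par ^^ (depth v - j)) v"

lemma depth_par_pow: "depth ((par ^^ k) v) = depth v - k"
  by (induction k) (auto simp: depth_par)

lemma depth_anc: "j \<le> depth v \<Longrightarrow> depth (anc v j) = j"
  by (simp add: anc_def depth_par_pow)

lemma anc_depth [simp]: "anc v (depth v) = v"
  by (simp add: anc_def)

lemma anc_0 [simp]: "anc v 0 = r"
  using depth_anc[of 0 v] by simp

lemma anc_anc: "i \<le> j \<Longrightarrow> j \<le> depth v \<Longrightarrow> anc (anc v j) i = anc v i"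
  using funpow_add[of "j - i" "depth v - j" par, THEN fun_cong, of v]
  by (simp add: anc_def depth_par_pow)

lemma anc_par: "j \<le> depth v - 1 \<Longrightarrow> anc (par v) j = anc v j"
proof -
  assume j: "j \<le> depth v - 1"
  have "anc v (depth v - 1) = par v"
  proof (cases "v = r")
    case False
    then have "depth v - (depth v - 1) = 1" using depth_zero[of v] by linarith
    then show ?thesis by (simp add: anc_def)
  qed simp
  then show ?thesis using anc_anc[of j "depth v - 1" v] j by simp
qed

text \<open>
  The level at which the paths from the root to \<open>v\<close> and to \<open>w\<close> separate.
\<close>

definition meet :: "'v \<Rightarrow> 'v \<Rightarrow> nat" where
  "meet v w = Max {j. j \<le> depth v \<and> j \<le> depth w \<and> anc v j = anc w j}"

text \<open>
  The levels on which the two paths agree form an initial segment. All properties of \<open>meet\<close> are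
  derived from this equivalence.
\<close>

lemma le_meet_iff: "j \<le> meet v w \<longleftrightarrow> j \<le> depth v \<and> j \<le> depth w \<and> anc v j = anc w j"
proof -
  let ?S = "{j. j \<le> depth v \<and> j \<le> depth w \<and> anc v j = anc w j}"
  have fin: "finite ?S" by (rule finite_subset[of _ "{..depth v}"]) auto
  have "0 \<in> ?S" by simp
  then have m: "meet v w \<in> ?S" unfolding meet_def using fin by (intro Max_in) auto
  show ?thesis
  proof
    assume j: "j \<le> meet v w"
    have "anc v j = anc (anc v (meet v w)) j" using m j anc_anc[of j "meet v w" v] by simp
    also have "\<dots> = anc (anc w (meet v w)) j" using m by simp
    also have "\<dots> = anc w j" using m j by (intro anc_anc) auto
    finally show "j \<le> depth v \<and> j \<le> depth w \<and> anc v j = anc w j" using m j by auto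
  next
    assume "j \<le> depth v \<and> j \<le> depth w \<and> anc v j = anc w j"
    then show "j \<le> meet v w" unfolding meet_def using fin by (intro Max_ge) auto
  qed
qed

lemma meet_eqI: "(\<And>j. j \<le> m \<longleftrightarrow> j \<le> meet v w) \<Longrightarrow> meet v w = m"
  by (metis le_antisym le_refl)

lemma meet_le: "meet v w \<le> depth v" "meet v w \<le> depth w"
  using le_meet_iff[of "meet v w" v w] by auto

lemma meet_sym: "meet v w = meet w v"
  by (rule meet_eqI) (auto simp: le_meet_iff)

lemma meet_self [simp]: "meet v v = depth v"
  by (rule meet_eqI) (auto simp: le_meet_iff)

lemma meet_root [simp]: "meet v r = 0" "meet r v = 0"
  using meet_le[of v r] meet_le[of r v] by auto

text \<open>Being on a common path up to level \<open>j\<close> is a transitive relation.\<close>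

lemma meet_ultra: "min (meet u v) (meet v w) \<le> meet u w"
  by (simp add: le_meet_iff[of _ u w]) (metis le_meet_iff min.cobounded1 min.cobounded2)

lemma meet_par: "meet (par v) w = min (meet v w) (depth v - 1)"
  by (rule meet_eqI) (auto simp: le_meet_iff depth_par anc_par)

lemma meet_depth_eq: "meet v w = depth v \<Longrightarrow> depth w = depth v \<Longrightarrow> v = w"
  using le_meet_iff[of "depth v" v w] by (metis anc_depth order_refl)

lemma walk_to_anc: "j \<le> depth v \<Longrightarrow> (E ^^ (depth v - j)) v (anc v j)"
proof -
  have "(E ^^ k) v ((par ^^ k) v)" if "k \<le> depth v" for k
    using that
  proof (induction k)
    case (Suc k)
    have "(par ^^ k) v \<noteq> r" using Suc.prems depth_par_pow[of k v] by (metis depth_zero Suc_le_eq zero_less_diff less_numeral_extra(3))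
    then show ?case using Suc par_adj by (auto intro!: relcomppI)
  qed auto
  then show "j \<le> depth v \<Longrightarrow> ?thesis" by (simp add: anc_def)
qed

text \<open>
  Walking to the last common ancestor and back attains the value on the right. No walk is shorter, because this
  value grows by at most one along an edge.
\<close>

lemma graph_dist_eq: "graph_dist E v w = depth v + depth w - 2 * meet v w"
proof (rule antisym)
  let ?m = "meet v w"
  have "(E ^^ (depth v - ?m)) v (anc v ?m)" "(E ^^ (depth w - ?m)) (anc w ?m) w"
    using meet_le walk_to_anc walk_rev by blast+
  moreover have "anc v ?m = anc w ?m" using le_meet_iff[of ?m v w] by simp
  ultimately have "(E ^^ ((depth v - ?m) + (depth w - ?m))) v w"
    by (auto simp: relpowp_add)
  from graph_dist_le[OF this] show "graph_dist E v w \<le> depth v + depth w - 2 * ?m"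
    using meet_le[of v w] by linarith
next
  have "depth v + depth w \<le> n + 2 * meet v w" if "(E ^^ n) v w" for n
    using that
  proof (induction n arbitrary: w)
    case (Suc n)
    then obtain u where u: "(E ^^ n) v u" "E u w" by auto
    have IH: "depth v + depth u \<le> n + 2 * meet v u" using Suc.IH[OF u(1)] .
    from adj_cases[OF u(2)] show ?case
    proof
      assume "u \<noteq> r \<and> w = par u"
      then show ?thesis
        using IH meet_par[of u v] depth_par[of u] meet_sym[of v] depth_zero[of u] meet_le[of v u]
        by (auto simp: min_def split: if_splits)
    next
      assume "w \<noteq> r \<and> u = par w"
      then show ?thesis
        using IH meet_par[of w v] depth_par[of w] meet_sym[of v] depth_zero[of w]
        by (auto simp: min_def split: if_splits)
    qed
  qed auto
  from this[OF graph_dist_walk] show "depth v + depth w - 2 * meet v w \<le> graph_dist E v w"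
    by linarith
qed

lemma real_graph_dist: "real (graph_dist E v w) = real (depth v) + real (depth w) - 2 * real (meet v w)"
  using meet_le[of v w] by (simp add: graph_dist_eq of_nat_diff)

section \<open>Finiteness of the levels\<close>

lemma par_in_level: "depth w = Suc n \<Longrightarrow> w \<noteq> r \<and> depth (par w) = n"
  by (auto simp: depth_par)

lemma level_Suc: "{w. depth w = Suc n} = (\<Union>v\<in>{v. depth v = n}. {w. w \<noteq> r \<and> par w = v})"
  using par_in_level depth_zero by (auto simp: depth_par) (metis depth_zero Suc_pred neq0_conv)

lemma finite_level: "finite {v. depth v = n}"
proof (induction n)
  case (Suc n)
  then show ?case unfolding level_Suc using finite_children by auto
qed simp

lemma card_level: "card {v. depth v = n} = K ^ n"
proof (induction n)
  case (Suc n)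
  have "card {w. depth w = Suc n} = (\<Sum>v\<in>{v. depth v = n}. card {w. w \<noteq> r \<and> par w = v})"
    unfolding level_Suc using finite_children finite_level by (intro card_UN_disjoint) auto
  then show ?case using Suc by (simp add: card_children)
qed simp

lemma countable_vertices: "countable (UNIV :: 'v set)"
proof -
  have "(UNIV :: 'v set) = (\<Union>n. {v. depth v = n})" by auto
  moreover have "countable (\<Union>n. {v. depth v = n})"
    by (rule countable_UN[OF _ countable_finite[OF finite_level]]) simp
  ultimately show ?thesis by simp
qed

section \<open>Distances and geodesics\<close>

abbreviation T :: "'v point set" where "T \<equiv> tree_points r"

text \<open>
  The level of a point as an explicit function; \<open>level_eq\<close> identifies it with the distance from the
  root.
\<close>

definition lv :: "'v point \<Rightarrow> real" where
  "lv x = real (depth (fst x)) - snd x"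

text \<open>
  The Gromov product with respect to the root, for points of the metric tree: the level at which the paths to the
  two points separate, or the smaller of the two levels if one point lies on the path to the other.
\<close>

definition gp :: "'v point \<Rightarrow> 'v point \<Rightarrow> real" where
  "gp x y = min (min (lv x) (lv y)) (real (meet (fst x) (fst y)))"

lemma depth_pos: "v \<noteq> r \<Longrightarrow> 1 \<le> depth v"
  using depth_zero[of v] by linarith

lemma vertex_in_T [simp]: "(v, 0) \<in> T"
  by (simp add: tree_points_def)

lemma edge_in_T: "v \<noteq> r \<Longrightarrow> (v, t) \<in> T \<longleftrightarrow> 0 \<le> t \<and> t < 1"
  by (simp add: tree_points_def)

lemma T_cases: "x \<in> T \<Longrightarrow> 0 \<le> snd x \<and> snd x < 1 \<and> (snd x \<noteq> 0 \<longrightarrow> 1 \<le> depth (fst x))"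
  using depth_pos[of "fst x"] by (auto simp: tree_points_def split: prod.splits)

lemma lv_vertex [simp]: "lv (v, 0) = real (depth v)"
  by (simp add: lv_def)

lemma lv_nonneg: "x \<in> T \<Longrightarrow> 0 \<le> lv x"
  using T_cases[of x] by (cases "snd x = 0") (auto simp: lv_def)

lemma lv_bounds: "x \<in> T \<Longrightarrow> real (depth (fst x)) - 1 < lv x \<and> lv x \<le> real (depth (fst x))"
  using T_cases[of x] by (auto simp: lv_def)

lemma gp_sym: "gp x y = gp y x"
  by (simp add: gp_def meet_sym min.commute)

lemma gp_le: "gp x y \<le> lv x" "gp x y \<le> lv y"
  by (auto simp: gp_def)

lemma gp_self: "x \<in> T \<Longrightarrow> gp x x = lv x"
  using T_cases[of x] by (auto simp: gp_def lv_def)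

lemma gp_nonneg: "x \<in> T \<Longrightarrow> y \<in> T \<Longrightarrow> 0 \<le> gp x y"
  using lv_nonneg by (auto simp: gp_def)

text \<open>Hyperbolicity of the tree with constant \<open>0\<close>.\<close>

lemma gp_ultra: "min (gp x y) (gp y z) \<le> gp x z"
proof -
  have "min (real (meet (fst x) (fst y))) (real (meet (fst y) (fst z))) \<le> real (meet (fst x) (fst z))"
    using meet_ultra[of "fst x" "fst y" "fst z"] by (metis of_nat_min of_nat_le_iff)
  then show ?thesis unfolding gp_def by linarith
qed

lemma gp_eq_imp_eq:
  assumes "x \<in> T" "y \<in> T" "gp x y = lv x" "gp x y = lv y"
  shows "x = y"
proof -
  have 1: "lv x = lv y" "lv x \<le> real (meet (fst x) (fst y))" using assms by (auto simp: gp_def)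
  have "depth (fst x) \<le> meet (fst x) (fst y)" "depth (fst y) \<le> meet (fst x) (fst y)"
    using 1 lv_bounds[OF assms(1)] lv_bounds[OF assms(2)] by linarith+
  then have "meet (fst x) (fst y) = depth (fst x)" "depth (fst y) = depth (fst x)"
    using meet_le[of "fst x" "fst y"] by linarith+
  then have "fst x = fst y" by (rule meet_depth_eq)
  then show ?thesis using 1 by (simp add: lv_def prod_eq_iff)
qed

text \<open>
  The minimum over the choices of end vertices is attained as follows: from a point one first moves to the parent
  end of its edge, unless its lower vertex lies on the path to the other point. In the three cases of the proof
  \<open>v\<close> is an ancestor of \<open>w\<close>, \<open>w\<close> is one of \<open>v\<close>, or neither
  holds.
\<close>

lemma tree_dist_eq:
  assumes x: "x \<in> T" and y: "y \<in> T"
  shows "tree_dist E r x y = lv x + lv y - 2 * gp x y"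
proof (cases "fst x = fst y")
  case True
  have *: "\<bar>a - b\<bar> = d - a + (d - b) - 2 * min (min (d - a) (d - b)) d"
    if "0 \<le> a" "0 \<le> b" for a b d :: real
    using that by (cases "a \<le> b") (auto simp: min_def)
  have g: "gp x y = min (min (real (depth (fst y)) - snd x) (real (depth (fst y)) - snd y)) (real (depth (fst y)))"
    by (simp only: gp_def lv_def True meet_self)
  have l: "lv x = real (depth (fst y)) - snd x" "lv y = real (depth (fst y)) - snd y"
    by (simp_all only: lv_def True)
  have t: "tree_dist E r x y = \<bar>snd x - snd y\<bar>"
    by (simp only: tree_dist_def True refl if_True)
  show ?thesis unfolding t g l
    by (rule *) (use T_cases[OF x] T_cases[OF y] in blast)+
next
  case False
  obtain v s w t where xy: "x = (v, s)" "y = (w, t)" by (metis surj_pair)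
  have vw: "v \<noteq> w" using False xy by simp
  have s: "0 \<le> s" "s < 1" "s \<noteq> 0 \<Longrightarrow> v \<noteq> r \<and> 1 \<le> depth v"
    and t: "0 \<le> t" "t < 1" "t \<noteq> 0 \<Longrightarrow> w \<noteq> r \<and> 1 \<le> depth w"
    using x y xy depth_pos[of v] depth_pos[of w] by (auto simp: tree_points_def)
  define m where "m = meet v w"
  have m: "m \<le> depth v" "m \<le> depth w" "\<not> (m = depth v \<and> m = depth w)"
    using meet_le[of v w] meet_depth_eq[of v w] vw unfolding m_def by metis+
  have mp: "meet (par v) w = min m (depth v - 1)" "meet v (par w) = min m (depth w - 1)"
    "meet (par v) (par w) = min (min m (depth w - 1)) (depth v - 1)"
    using meet_par[of v w] meet_par[of w v] meet_par[of v "par w"]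
    by (simp_all only: m_def meet_sym[of v w] meet_sym[of v "par w"])
  define ux where "ux = (if s = 0 then x else (par v, 1 - s))"
  define uy where "uy = (if t = 0 then y else (par w, 1 - t))"
  have ex: "edge_ends E r x = {x, ux}" "edge_ends E r y = {y, uy}"
    using s(3) t(3) by (auto simp: edge_ends_def ux_def uy_def xy par_def)
  let ?c = "\<lambda>x y. snd x + real (graph_dist E (fst x) (fst y)) + snd y"
  have S: "{a + real (graph_dist E v w) + b | v a w b.
                  (v, a) \<in> edge_ends E r x \<and> (w, b) \<in> edge_ends E r y} =
     {?c x y, ?c ux y, ?c x uy, ?c ux uy}" (is "?S = ?R")
  proof -
    have *: "{a + real (graph_dist E v w) + b | v a w b. (v, a) \<in> A \<and> (w, b) \<in> B} =
      (\<lambda>(x, y). ?c x y) ` (A \<times> B)" for A B :: "('v \<times> real) set"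
    proof (intro set_eqI iffI)
      fix u assume "u \<in> {a + real (graph_dist E v w) + b | v a w b. (v, a) \<in> A \<and> (w, b) \<in> B}"
      then obtain v a w b where "u = a + real (graph_dist E v w) + b" "(v, a) \<in> A" "(w, b) \<in> B" by blast
      then show "u \<in> (\<lambda>(x, y). ?c x y) ` (A \<times> B)"
        by (intro image_eqI[of _ _ "((v, a), (w, b))"]) simp_all
    next
      fix u assume "u \<in> (\<lambda>(x, y). ?c x y) ` (A \<times> B)"
      then obtain v a w b where "u = a + real (graph_dist E v w) + b" "(v, a) \<in> A" "(w, b) \<in> B"
        by auto
      then show "u \<in> {a + real (graph_dist E v w) + b | v a w b. (v, a) \<in> A \<and> (w, b) \<in> B}"
        by blast
    qed
    show ?thesis unfolding ex * by (simp add: insert_commute)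
  qed
  define p q M where "p = real (depth v)" and "q = real (depth w)" and "M = real m"
  have D00: "real (graph_dist E v w) = p + q - 2 * M"
    by (simp add: real_graph_dist m_def p_def q_def M_def)
  have D10: "real (graph_dist E (par v) w) = p - 1 + q - 2 * min M (p - 1)" if "s \<noteq> 0"
    using s(3)[OF that] by (simp add: real_graph_dist mp p_def q_def M_def of_nat_diff of_nat_min depth_par)
  have D01: "real (graph_dist E v (par w)) = p + (q - 1) - 2 * min M (q - 1)" if "t \<noteq> 0"
    using t(3)[OF that] by (simp add: real_graph_dist mp p_def q_def M_def of_nat_diff of_nat_min depth_par)
  have D11: "real (graph_dist E (par v) (par w)) = p - 1 + (q - 1) - 2 * min (min M (q - 1)) (p - 1)"
    if "s \<noteq> 0" "t \<noteq> 0"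
    using s(3)[OF that(1)] t(3)[OF that(2)]
    by (simp add: real_graph_dist mp p_def q_def M_def of_nat_diff of_nat_min depth_par)
  have gp: "gp x y = min (min (p - s) (q - t)) M" and lvs: "lv x = p - s" "lv y = q - t"
    by (simp_all add: gp_def lv_def xy p_def q_def M_def m_def)
  have c00: "?c x y = s + (p + q - 2 * M) + t" by (simp add: xy D00)
  have c10: "?c ux y = (if s = 0 then s + (p + q - 2 * M) + t
      else 1 - s + (p - 1 + q - 2 * min M (p - 1)) + t)"
    using D10 by (auto simp: ux_def xy D00)
  have c01: "?c x uy = (if t = 0 then s + (p + q - 2 * M) + t
      else s + (p + (q - 1) - 2 * min M (q - 1)) + (1 - t))"
    using D01 by (auto simp: uy_def xy D00)
  have c11: "?c ux uy = (if s = 0 then ?c x uy else if t = 0 then ?c ux y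
      else 1 - s + (p - 1 + (q - 1) - 2 * min (min M (q - 1)) (p - 1)) + (1 - t))"
    using D11 by (auto simp: ux_def uy_def xy)
  consider "M = p" "M \<le> q - 1" | "M = q" "M \<le> p - 1" | "M \<le> p - 1" "M \<le> q - 1"
  proof -
    have "(m = depth v \<and> m < depth w) \<or> (m = depth w \<and> m < depth v) \<or> (m < depth v \<and> m < depth w)"
      using m by auto
    moreover have "M \<le> p - 1" if "m < depth v" using that unfolding M_def p_def by linarith
    moreover have "M \<le> q - 1" if "m < depth w" using that unfolding M_def q_def by linarith
    ultimately show ?thesis using that unfolding M_def p_def q_def by blast
  qed
  then have "Min {?c x y, ?c ux y, ?c x uy, ?c ux uy} = lv x + lv y - 2 * gp x y"
  proof cases
    case 1
    then have g: "gp x y = p - s" and mins: "min M (p - 1) = p - 1" "min M (q - 1) = p"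
      using s t unfolding gp by linarith+
    have "?c x uy = lv x + lv y - 2 * gp x y" unfolding c01 mins g lvs using 1 by simp
    moreover have "lv x + lv y - 2 * gp x y \<le> c" if "c \<in> {?c x y, ?c ux y, ?c x uy, ?c ux uy}" for c
      using that s t 1 unfolding c00 c10 c01 c11 g lvs mins
      by (auto split: if_splits)
    ultimately show ?thesis by (intro Min_eqI) auto
  next
    case 2
    then have g: "gp x y = q - t" and mins: "min M (p - 1) = q" "min M (q - 1) = q - 1"
      using s t unfolding gp by linarith+
    have "?c ux y = lv x + lv y - 2 * gp x y" unfolding c10 mins g lvs using 2 by simp
    moreover have "lv x + lv y - 2 * gp x y \<le> c" if "c \<in> {?c x y, ?c ux y, ?c x uy, ?c ux uy}" for c
      using that s t 2 unfolding c00 c10 c01 c11 g lvs mins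
      by (auto split: if_splits)
    ultimately show ?thesis by (intro Min_eqI) auto
  next
    case 3
    then have g: "gp x y = M" and mins: "min M (p - 1) = M" "min M (q - 1) = M"
      using s t unfolding gp by linarith+
    have "?c ux uy = lv x + lv y - 2 * gp x y" unfolding c11 c10 c01 mins g lvs using 3 by simp
    moreover have "lv x + lv y - 2 * gp x y \<le> c" if "c \<in> {?c x y, ?c ux y, ?c x uy, ?c ux uy}" for c
      using that s t 3 unfolding c00 c10 c01 c11 g lvs mins
      by (auto split: if_splits)
    ultimately show ?thesis by (intro Min_eqI) auto
  qed
  then show ?thesis using False unfolding tree_dist_def S by simp
qed

lemma level_eq: "x \<in> T \<Longrightarrow> level E r x = lv x"
  using lv_nonneg[of x] by (simp add: level_def tree_dist_eq gp_def)

text \<open>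
  The part beyond level \<open>a\<close> of the path from the root to \<open>x\<close>: a point \<open>z\<close>
  is on that path when its Gromov product with \<open>x\<close> is its own level.
\<close>

definition seg :: "real \<Rightarrow> 'v point \<Rightarrow> 'v point set" where
  "seg a x = {z \<in> T. gp x z = lv z \<and> a \<le> lv z}"

text \<open>
  In terms of Gromov products, equality in the triangle inequality says that
  \<open>gp x z + gp z y = lv z + gp x y\<close>. The two smallest of the three products coincide and
  none involving \<open>z\<close> exceeds \<open>lv z\<close>, so one of them must equal \<open>lv z\<close> and
  the other \<open>gp x y\<close>.
\<close>

lemma geodesic_eq:
  assumes x: "x \<in> T" and y: "y \<in> T"
  shows "geodesic E r x y = seg (gp x y) x \<union> seg (gp x y) y"
proof -
  have "tree_dist E r x z + tree_dist E r z y = tree_dist E r x y \<longleftrightarrow>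
     gp x y \<le> lv z \<and> (gp x z = lv z \<or> gp y z = lv z)" if z: "z \<in> T" for z
    using gp_le[of x y] gp_le[of x z] gp_le[of y z] gp_ultra[of x y z] gp_ultra[of x z y]
      gp_ultra[of y x z] gp_sym[of y x] gp_sym[of z y]
    unfolding tree_dist_eq[OF x z] tree_dist_eq[OF z y] tree_dist_eq[OF x y]
    by (auto simp: min_def split: if_splits)
  then show ?thesis by (auto simp: geodesic_def seg_def)
qed

section \<open>The length measure and the metric\<close>

lemma sets_pair_iff:
  "A \<in> sets (count_space (UNIV :: 'v set) \<Otimes>\<^sub>M (lborel :: real measure)) \<longleftrightarrow>
    (\<forall>v. {t. (v, t) \<in> A} \<in> sets borel)"
proof
  assume A: "A \<in> sets (count_space (UNIV :: 'v set) \<Otimes>\<^sub>M (lborel :: real measure))"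
  show "\<forall>v. {t. (v, t) \<in> A} \<in> sets borel"
    using sets_Pair1[OF A] by (auto simp: vimage_def)
next
  assume A: "\<forall>v. {t. (v, t) \<in> A} \<in> sets borel"
  have "A = (\<Union>v. {v} \<times> {t. (v, t) \<in> A})" by auto
  also have "\<dots> \<in> sets (count_space (UNIV :: 'v set) \<Otimes>\<^sub>M (lborel :: real measure))"
    using A by (intro sets.countable_UN'' countable_vertices pair_measureI) auto
  finally show "A \<in> sets (count_space (UNIV :: 'v set) \<Otimes>\<^sub>M (lborel :: real measure))" .
qed

lemma T_sections: "{t. (v, t) \<in> T} = (if v = r then {0} else {0..<1})"
  by (auto simp: tree_points_def)

lemma T_sets: "T \<in> sets (count_space UNIV \<Otimes>\<^sub>M lborel)"
  unfolding sets_pair_iff by (simp add: T_sections)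

text \<open>
  There are only countably many edges, so the length measure is a product measure; this makes Tonelli's theorem
  available.
\<close>

lemma length_measure_eq: "length_measure r = restrict_space (count_space UNIV \<Otimes>\<^sub>M lborel) T"
proof -
  let ?N = "count_space (UNIV :: 'v set) \<Otimes>\<^sub>M (lborel :: real measure)"
  let ?S = "{A. A \<subseteq> T \<and> (\<forall>v. {t. (v, t) \<in> A} \<in> sets borel)}"
  have sp: "space (restrict_space ?N T) = T" by (simp add: space_restrict_space space_pair_measure)
  have st: "sets (restrict_space ?N T) = ?S"
    using T_sets by (auto simp: sets_restrict_space_iff sets_pair_iff)
  have "restrict_space ?N T = measure_of T ?S (emeasure (restrict_space ?N T))"
    using measure_of_of_measure[of "restrict_space ?N T"] unfolding sp st by simp
  also have "\<dots> = length_measure r"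
    unfolding length_measure_def
  proof (rule measure_of_eq)
    fix A assume "A \<in> sigma_sets T ?S"
    then have "A \<in> ?S" using sets.sigma_sets_eq[of "restrict_space ?N T"] unfolding sp st by simp
    then show "emeasure (restrict_space ?N T) A = (\<integral>\<^sup>+ v. emeasure lborel {t. (v, t) \<in> A} \<partial>count_space UNIV)"
      using T_sets by (subst emeasure_restrict_space)
        (auto simp: lborel.emeasure_pair_measure_alt sets_pair_iff vimage_def)
  qed auto
  finally show ?thesis ..
qed

lemma space_length [simp]: "space (length_measure r) = T"
  by (simp add: length_measure_eq space_restrict_space space_pair_measure)

lemma measurable_lengthI:
  fixes f :: "'v point \<Rightarrow> ennreal"
  assumes "\<And>v. v \<noteq> r \<Longrightarrow> (\<lambda>t. f (v, t) * indicator {0..<1} t) \<in> borel_measurable lborel"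
  shows "f \<in> borel_measurable (length_measure r)"
proof -
  have "(\<lambda>t. f (v, t) * indicator T (v, t)) \<in> borel_measurable lborel" for v
  proof (cases "v = r")
    case True
    then have "(\<lambda>t. f (v, t) * indicator T (v, t)) = (\<lambda>t. f (r, 0) * indicator {0} t)"
      by (auto simp: tree_points_def indicator_def)
    then show ?thesis by simp
  next
    case False
    then have "(\<lambda>t. f (v, t) * indicator T (v, t)) = (\<lambda>t. f (v, t) * indicator {0..<1} t)"
      by (auto simp: tree_points_def indicator_def)
    then show ?thesis using assms[OF False] by simp
  qed
  then have "(\<lambda>x. f x * indicator T x) \<in> borel_measurable (count_space UNIV \<Otimes>\<^sub>M lborel)"
    by (intro measurable_pair_measure_countable1 countable_vertices) auto
  then show ?thesis
    unfolding length_measure_eq using T_sets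
    by (subst borel_measurable_restrict_space_iff_ennreal) (auto simp: space_pair_measure)
qed

lemma nn_integral_length:
  assumes f: "f \<in> borel_measurable (length_measure r)"
  shows "(\<integral>\<^sup>+ x. f x \<partial>length_measure r) =
    (\<integral>\<^sup>+ v. (if v = r then 0 else \<integral>\<^sup>+ t. f (v, t) * indicator {0..<1} t \<partial>lborel) \<partial>count_space UNIV)"
proof -
  have "(\<integral>\<^sup>+ x. f x \<partial>length_measure r) = (\<integral>\<^sup>+ x. f x * indicator T x \<partial>(count_space UNIV \<Otimes>\<^sub>M lborel))"
    unfolding length_measure_eq using T_sets
    by (subst nn_integral_restrict_space) (auto simp: space_pair_measure)
  also have "\<dots> = (\<integral>\<^sup>+ v. \<integral>\<^sup>+ t. f (v, t) * indicator T (v, t) \<partial>lborel \<partial>count_space UNIV)"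
    using f T_sets unfolding length_measure_eq
    by (subst lborel.nn_integral_fst[symmetric])
       (auto simp: borel_measurable_restrict_space_iff_ennreal space_pair_measure)
  also have "\<dots> = (\<integral>\<^sup>+ v. (if v = r then 0 else \<integral>\<^sup>+ t. f (v, t) * indicator {0..<1} t \<partial>lborel) \<partial>count_space UNIV)"
  proof (rule nn_integral_cong)
    fix v :: 'v
    have "(\<integral>\<^sup>+ t. f (r, t) * indicator {0} t \<partial>lborel) = (\<integral>\<^sup>+ t. f (r, 0) * indicator {0} (t::real) \<partial>lborel)"
      by (intro nn_integral_cong) (auto simp: indicator_def)
    then have 0: "(\<integral>\<^sup>+ t. f (r, t) * indicator {0} t \<partial>lborel) = 0"
      by (simp add: nn_integral_cmult)
    have "indicator T (v, t) = (indicator (if v = r then {0} else {0..<1}) t :: ennreal)" for t :: real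
      by (auto simp: tree_points_def indicator_def)
    then show "(\<integral>\<^sup>+ t. f (v, t) * indicator T (v, t) \<partial>lborel) =
      (if v = r then 0 else \<integral>\<^sup>+ t. f (v, t) * indicator {0..<1} t \<partial>lborel)"
      using 0 by auto
  qed
  finally show ?thesis .
qed

lemma lv_measurable_length:
  fixes \<phi> :: "real \<Rightarrow> ennreal"
  assumes [measurable]: "\<phi> \<in> borel_measurable borel"
  shows "(\<lambda>z. \<phi> (lv z)) \<in> borel_measurable (length_measure r)"
  by (rule measurable_lengthI) (simp add: lv_def)

lemma seg_section:
  assumes x: "x \<in> T" and v: "v \<noteq> r" and t: "0 \<le> t" "t < 1"
  shows "(v, t) \<in> seg a x \<longleftrightarrow>
    depth v \<le> depth (fst x) \<and> v = anc (fst x) (depth v) \<and> real (depth v) - t \<in> {a..lv x}"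
proof -
  have z: "(v, t) \<in> T" using v t by (simp add: edge_in_T)
  have "depth v \<le> meet (fst x) v \<longleftrightarrow> real (depth v) - t \<le> real (meet (fst x) v)"
    using t by linarith
  then show ?thesis using z le_meet_iff[of "depth v" "fst x" v]
    by (auto simp: seg_def gp_def lv_def)
qed

text \<open>
  The path from the root to \<open>x\<close> meets every level up to \<open>lv x\<close> exactly once: its edges,
  read through the level, are the consecutive unit intervals.
\<close>

lemma nn_integral_seg:
  fixes \<phi> :: "real \<Rightarrow> ennreal"
  assumes x: "x \<in> T" and a: "0 \<le> a" and [measurable]: "\<phi> \<in> borel_measurable borel"
  shows "(\<lambda>z. \<phi> (lv z) * indicator (seg a x) z) \<in> borel_measurable (length_measure r)" (is ?m)
    and "(\<integral>\<^sup>+ z. \<phi> (lv z) * indicator (seg a x) z \<partial>length_measure r) =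
      (\<integral>\<^sup>+ s. \<phi> s * indicator {a..lv x} s \<partial>lborel)" (is ?i)
proof -
  define w n where "w = fst x" and "n = depth w"
  let ?A = "anc w ` {1..n}"
  have ind: "indicator (seg a x) (v, t) * indicator {0..<1} t =
    indicator ?A v * (indicator {a..lv x} (real (depth v) - t) * (indicator {0..<1} t :: ennreal))"
    if "v \<noteq> r" for v t
  proof -
    have "v \<in> ?A \<longleftrightarrow> depth v \<le> n \<and> v = anc w (depth v)"
      using depth_pos[OF that] depth_anc[of _ w] by (auto simp: n_def intro!: image_eqI[of _ _ "depth v"])
    then show ?thesis using seg_section[OF x that, of t a]
      by (auto simp: indicator_def w_def n_def)
  qed
  show ?m
  proof (rule measurable_lengthI)
    fix v assume v: "v \<noteq> r"
    have "(\<lambda>t. \<phi> (lv (v, t)) * indicator (seg a x) (v, t) * indicator {0..<1} t) =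
      (\<lambda>t. \<phi> (real (depth v) - t) * (indicator ?A v * (indicator {a..lv x} (real (depth v) - t) * (indicator {0..<1} t))))"
      using ind[OF v] by (simp add: mult.assoc lv_def)
    then show "(\<lambda>t. \<phi> (lv (v, t)) * indicator (seg a x) (v, t) * indicator {0..<1} t) \<in> borel_measurable lborel"
      by simp
  qed
  let ?g = "\<lambda>v. \<integral>\<^sup>+ t. \<phi> (real (depth v) - t) * (indicator {a..lv x} (real (depth v) - t) * (indicator {0..<1} t)) \<partial>lborel"
  have Ar: "v \<noteq> r" if vA: "v \<in> ?A" for v
  proof -
    obtain j where "j \<in> {1..n}" "v = anc w j" using vA by blast
    then have "1 \<le> depth v" by (simp add: depth_anc n_def)
    then show ?thesis by auto
  qed
  have "(\<integral>\<^sup>+ z. \<phi> (lv z) * indicator (seg a x) z \<partial>length_measure r) =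
    (\<integral>\<^sup>+ v. ?g v * indicator ?A v \<partial>count_space UNIV)"
    unfolding nn_integral_length[OF \<open>?m\<close>]
  proof (rule nn_integral_cong)
    fix v
    show "(if v = r then 0 else \<integral>\<^sup>+ t. \<phi> (lv (v, t)) * indicator (seg a x) (v, t) * indicator {0..<1} t \<partial>lborel)
        = ?g v * indicator ?A v"
    proof (cases "v = r")
      case False
      have "(\<integral>\<^sup>+ t. \<phi> (lv (v, t)) * indicator (seg a x) (v, t) * indicator {0..<1} t \<partial>lborel) =
        (\<integral>\<^sup>+ t. \<phi> (real (depth v) - t) * (indicator {a..lv x} (real (depth v) - t) * (indicator {0..<1} t)) * indicator ?A v \<partial>lborel)"
      proof (rule nn_integral_cong)
        fix t
        have "\<phi> (lv (v, t)) * indicator (seg a x) (v, t) * indicator {0..<1} t =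
          \<phi> (real (depth v) - t) * (indicator (seg a x) (v, t) * indicator {0..<1} t)"
          by (simp add: mult.assoc lv_def)
        also have "\<dots> = \<phi> (real (depth v) - t) * (indicator {a..lv x} (real (depth v) - t) * (indicator {0..<1} t)) * indicator ?A v"
          unfolding ind[OF False] by (simp add: ac_simps)
        finally show "\<phi> (lv (v, t)) * indicator (seg a x) (v, t) * indicator {0..<1} t =
          \<phi> (real (depth v) - t) * (indicator {a..lv x} (real (depth v) - t) * (indicator {0..<1} t)) * indicator ?A v" .
      qed
      also have "\<dots> = ?g v * indicator ?A v" by (simp add: nn_integral_multc)
      finally show ?thesis using False by simp
    qed (use Ar in \<open>auto simp: indicator_def\<close>)
  qed
  also have "\<dots> = (\<Sum>v\<in>?A. ?g v * indicator ?A v)"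
    by (intro nn_integral_count_space') auto
  also have "\<dots> = (\<Sum>j\<in>{1..n}. ?g (anc w j))"
    using depth_anc[of _ w]
    by (subst sum.reindex) (auto simp: n_def intro!: inj_onI sum.cong dest!: arg_cong[where f=depth])
  also have "\<dots> = (\<Sum>j\<in>{1..n}. \<integral>\<^sup>+ s. \<phi> s * indicator {a..lv x} s * indicator {real j - 1<..real j} s \<partial>lborel)"
  proof (intro sum.cong refl)
    fix j assume "j \<in> {1..n}"
    then have "depth (anc w j) = j" by (simp add: depth_anc n_def)
    then show "?g (anc w j) = (\<integral>\<^sup>+ s. \<phi> s * indicator {a..lv x} s * indicator {real j - 1<..real j} s \<partial>lborel)"
      by (subst nn_integral_real_affine[where c="-1" and t="real j"])
         (auto intro!: nn_integral_cong simp: indicator_def)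
  qed
  also have "\<dots> = (\<integral>\<^sup>+ s. (\<Sum>j\<in>{1..n}. \<phi> s * indicator {a..lv x} s * indicator {real j - 1<..real j} s) \<partial>lborel)"
    by (subst nn_integral_sum) auto
  also have "\<dots> = (\<integral>\<^sup>+ s. \<phi> s * indicator {a..lv x} s \<partial>lborel)"
  proof (rule nn_integral_cong_AE)
    have "(\<Sum>j\<in>{1..n}. \<phi> s * indicator {a..lv x} s * indicator {real j - 1<..real j} s) = \<phi> s * indicator {a..lv x} s"
      if "s \<noteq> 0" for s
    proof (cases "s \<in> {a..lv x}")
      case True
      then have s: "0 < s" "s \<le> real n" using that a lv_bounds[OF x] by (auto simp: n_def w_def)
      \<comment> \<open>the only unit interval \<open>(k - 1, k]\<close> containing \<open>s\<close>\<close>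
      define k where "k = nat \<lceil>s\<rceil>"
      have k: "real j - 1 < s \<and> s \<le> real j \<longleftrightarrow> j = k" for j
        using s unfolding k_def by (auto; linarith)
      have "k \<in> {1..n}" using s unfolding k_def by (auto; linarith)
      moreover have "indicator {real j - 1<..real j} s = (if j = k then 1 else 0 :: ennreal)" for j
        using k[of j] by (auto simp: indicator_def)
      ultimately show ?thesis by (simp add: if_distrib[of "(*) _"] cong: if_cong)
    qed simp
    then show "AE s in lborel. (\<Sum>j\<in>{1..n}. \<phi> s * indicator {a..lv x} s * indicator {real j - 1<..real j} s) = \<phi> s * indicator {a..lv x} s"
      using AE_lborel_singleton[of 0] by (auto elim: eventually_mono)
  qed
  finally show ?i .
qed

text \<open>
  A level meets every edge in at most one point. This allows to neglect the branching point of a geodesic.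
\<close>

lemma AE_lv_neq: "AE z in length_measure r. lv z \<noteq> c"
proof -
  let ?f = "\<lambda>z. indicator {c} (lv z) :: ennreal"
  have m: "?f \<in> borel_measurable (length_measure r)" by (rule lv_measurable_length) simp
  have "(\<integral>\<^sup>+ z. ?f z \<partial>length_measure r) = 0"
  proof -
    have "(\<integral>\<^sup>+ t. ?f (v, t) * indicator {0..<1} t \<partial>lborel) = 0" for v
    proof -
      have "(\<integral>\<^sup>+ t. ?f (v, t) * indicator {0..<1} t \<partial>lborel) \<le> (\<integral>\<^sup>+ t. indicator {real (depth v) - c} t \<partial>lborel)"
        by (intro nn_integral_mono) (auto simp: indicator_def lv_def)
      then show ?thesis by simp
    qed
    then show ?thesis by (subst nn_integral_length[OF m]) (simp cong: if_cong)
  qed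
  then have "AE z in length_measure r. ?f z = 0" using m by (simp add: nn_integral_0_iff_AE)
  then show ?thesis by (rule eventually_mono) (auto simp: indicator_def split: if_splits)
qed

text \<open>
  The two halves of the geodesic overlap at most at the level of the branching point, and on each half the density
  depends on the level only.
\<close>

lemma d_X_eq:
  assumes x: "x \<in> T" and y: "y \<in> T" and \<epsilon>: "0 < \<epsilon>"
  shows "d_X E r \<epsilon> x y = (2 * exp (- \<epsilon> * gp x y) - exp (- \<epsilon> * lv x) - exp (- \<epsilon> * lv y)) / \<epsilon>"
proof -
  let ?m = "gp x y" and ?\<phi> = "\<lambda>s. ennreal (exp (- \<epsilon> * s))"
  have sub: "seg ?m x \<subseteq> T" "seg ?m y \<subseteq> T" by (auto simp: seg_def)
  have m0: "0 \<le> ?m" using gp_nonneg x y by simp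
  have mx [measurable]: "(\<lambda>z. ?\<phi> (lv z) * indicator (seg ?m x) z) \<in> borel_measurable (length_measure r)"
    and my [measurable]: "(\<lambda>z. ?\<phi> (lv z) * indicator (seg ?m y) z) \<in> borel_measurable (length_measure r)"
    by (rule nn_integral_seg(1)[OF x m0], simp) (rule nn_integral_seg(1)[OF y m0], simp)
  have geo: "AE z in length_measure r. ennreal (exp (- \<epsilon> * level E r z)) * indicator (geodesic E r x y) z =
     ?\<phi> (lv z) * indicator (seg ?m x) z + ?\<phi> (lv z) * indicator (seg ?m y) z"
    using AE_lv_neq[of ?m] AE_space
  proof eventually_elim
    case (elim z)
    have "\<not> (z \<in> seg ?m x \<and> z \<in> seg ?m y)"
      using elim gp_ultra[of x z y] gp_sym[of z y] by (auto simp: seg_def)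
    then show ?case using elim by (auto simp: geodesic_eq[OF x y] level_eq indicator_def)
  qed
  have FTC: "(\<integral>\<^sup>+ s. ?\<phi> s * indicator {a..b} s \<partial>lborel) = ennreal ((exp (- \<epsilon> * a) - exp (- \<epsilon> * b)) / \<epsilon>)"
    if "a \<le> b" for a b
  proof -
    have "(\<integral>\<^sup>+ s. ?\<phi> s * indicator {a..b} s \<partial>lborel) = ennreal (- exp (- \<epsilon> * b) / \<epsilon> - (- exp (- \<epsilon> * a) / \<epsilon>))"
      using \<epsilon> that by (intro nn_integral_FTC_Icc) (auto intro!: derivative_eq_intros)
    then show ?thesis by (simp add: diff_divide_distrib)
  qed
  have pos: "exp (- \<epsilon> * lv x) \<le> exp (- \<epsilon> * ?m)" "exp (- \<epsilon> * lv y) \<le> exp (- \<epsilon> * ?m)"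
    using \<epsilon> gp_le[of x y] by auto
  have "(\<integral>\<^sup>+ z. ennreal (exp (- \<epsilon> * level E r z)) * indicator (geodesic E r x y) z \<partial>length_measure r) =
    (\<integral>\<^sup>+ z. ?\<phi> (lv z) * indicator (seg ?m x) z + ?\<phi> (lv z) * indicator (seg ?m y) z \<partial>length_measure r)"
    by (rule nn_integral_cong_AE[OF geo])
  also have "\<dots> = ennreal ((exp (- \<epsilon> * ?m) - exp (- \<epsilon> * lv x)) / \<epsilon>) + ennreal ((exp (- \<epsilon> * ?m) - exp (- \<epsilon> * lv y)) / \<epsilon>)"
    unfolding nn_integral_add[OF mx my] FTC[OF gp_le(1)[of x y], symmetric] FTC[OF gp_le(2)[of x y], symmetric]
    using nn_integral_seg(2)[OF _ m0, of _ ?\<phi>] x y by simp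
  also have "\<dots> = ennreal ((2 * exp (- \<epsilon> * ?m) - exp (- \<epsilon> * lv x) - exp (- \<epsilon> * lv y)) / \<epsilon>)"
  proof -
    have "2 * a - b - c = (a - b) + (a - c)" for a b c :: real by simp
    then show ?thesis using pos \<epsilon>
      by (simp only: add_divide_distrib) (rule ennreal_plus[symmetric]; simp)
  qed
  finally have nn: "(\<integral>\<^sup>+ z. ennreal (exp (- \<epsilon> * level E r z)) * indicator (geodesic E r x y) z \<partial>length_measure r) = \<dots>" .
  have "(\<lambda>z. enn2real (ennreal (exp (- \<epsilon> * lv z)) * indicator (seg ?m x \<union> seg ?m y) z)) \<in> borel_measurable (length_measure r)"
  proof -
    have "(\<lambda>z. ennreal (exp (- \<epsilon> * lv z)) * indicator (seg ?m x \<union> seg ?m y) z) =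
      (\<lambda>z. max (?\<phi> (lv z) * indicator (seg ?m x) z) (?\<phi> (lv z) * indicator (seg ?m y) z))"
      by (auto simp: indicator_def fun_eq_iff)
    moreover have "(\<lambda>z. max (?\<phi> (lv z) * indicator (seg ?m x) z) (?\<phi> (lv z) * indicator (seg ?m y) z))
      \<in> borel_measurable (length_measure r)" by measurable
    ultimately have "(\<lambda>z. ennreal (exp (- \<epsilon> * lv z)) * indicator (seg ?m x \<union> seg ?m y) z)
      \<in> borel_measurable (length_measure r)" by (simp only:)
    then show ?thesis by measurable
  qed
  also have "?this \<longleftrightarrow> (\<lambda>z. indicator (geodesic E r x y) z *\<^sub>R exp (- \<epsilon> * level E r z)) \<in> borel_measurable (length_measure r)"
    by (intro measurable_cong) (auto simp: level_eq geodesic_eq[OF x y] indicator_def)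
  finally have meas: "(\<lambda>z. indicator (geodesic E r x y) z *\<^sub>R exp (- \<epsilon> * level E r z)) \<in> borel_measurable (length_measure r)" .
  have "d_X E r \<epsilon> x y = enn2real (\<integral>\<^sup>+ z. ennreal (indicator (geodesic E r x y) z *\<^sub>R exp (- \<epsilon> * level E r z)) \<partial>length_measure r)"
    unfolding d_X_def set_lebesgue_integral_def using meas by (intro integral_eq_nn_integral) auto
  also have "(\<lambda>z. ennreal (indicator (geodesic E r x y) z *\<^sub>R exp (- \<epsilon> * level E r z))) =
     (\<lambda>z. ennreal (exp (- \<epsilon> * level E r z)) * indicator (geodesic E r x y) z)"
    by (auto simp: indicator_def)
  finally have "d_X E r \<epsilon> x y = enn2real (ennreal ((2 * exp (- \<epsilon> * ?m) - exp (- \<epsilon> * lv x) - exp (- \<epsilon> * lv y)) / \<epsilon>))"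
    unfolding nn .
  moreover have "0 \<le> (2 * exp (- \<epsilon> * ?m) - exp (- \<epsilon> * lv x) - exp (- \<epsilon> * lv y)) / \<epsilon>"
    using pos \<epsilon> by (intro divide_nonneg_pos) linarith+
  ultimately show ?thesis by (simp only: enn2real_ennreal)
qed

end

section \<open>Metrics given by Gromov products\<close>

text \<open>
  For the tree, \<open>q x y\<close> is \<open>exp (- \<epsilon> * gp x y)\<close>. The triangle
  inequality reduces to \<open>q x z + q y y \<le> q x y + q y z\<close>: the larger summand on the
  right dominates \<open>q x z\<close>, the smaller one \<open>q y y\<close>.
\<close>

lemma Metric_space_of_gromov_product:
  fixes q :: "'a \<Rightarrow> 'a \<Rightarrow> real"
  assumes "\<And>x y. 0 \<le> d x y" and "\<And>x y. d x y = d y x" and "0 < \<epsilon>"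
    and d: "\<And>x y. x \<in> M \<Longrightarrow> y \<in> M \<Longrightarrow> d x y = (2 * q x y - q x x - q y y) / \<epsilon>"
    and q: "\<And>x y. x \<in> M \<Longrightarrow> y \<in> M \<Longrightarrow> q x x \<le> q x y \<and> q y y \<le> q x y"
    and ultra: "\<And>x y z. x \<in> M \<Longrightarrow> y \<in> M \<Longrightarrow> z \<in> M \<Longrightarrow> q x z \<le> max (q x y) (q y z)"
    and eq: "\<And>x y. x \<in> M \<Longrightarrow> y \<in> M \<Longrightarrow> q x y = q x x \<Longrightarrow> q x y = q y y \<Longrightarrow> x = y"
  shows "Metric_space M d"
proof
  fix x y assume xy: "x \<in> M" "y \<in> M"
  show "d x y = 0 \<longleftrightarrow> x = y"
  proof
    assume "d x y = 0"
    then have "2 * q x y - q x x - q y y = 0" using d[OF xy] \<open>0 < \<epsilon>\<close> by simp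
    then have "q x y = q x x" "q x y = q y y" using q[OF xy] by linarith+
    then show "x = y" using eq[OF xy] by simp
  qed (use d xy in simp)
next
  fix x y z assume xyz: "x \<in> M" "y \<in> M" "z \<in> M"
  have "2 * q x z - q x x - q z z \<le> (2 * q x y - q x x - q y y) + (2 * q y z - q y y - q z z)"
    using ultra[OF xyz] q[OF xyz(1,2)] q[OF xyz(2,3)] by linarith
  then show "d x z \<le> d x y + d y z"
    using \<open>0 < \<epsilon>\<close> xyz by (simp add: d divide_right_mono flip: add_divide_distrib)
qed (use assms in auto)

context rooted_tree begin

lemma tree_dist_commute: "tree_dist E r x y = tree_dist E r y x"
proof -
  let ?S = "\<lambda>x y. {a + real (graph_dist E v w) + b | v a w b.
                  (v, a) \<in> edge_ends E r x \<and> (w, b) \<in> edge_ends E r y}"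
  have sub: "?S x y \<subseteq> ?S y x" for x y
  proof
    fix u assume "u \<in> ?S x y"
    then obtain v a w b where u: "u = a + real (graph_dist E v w) + b"
      "(v, a) \<in> edge_ends E r x" "(w, b) \<in> edge_ends E r y" by blast
    then have "u = b + real (graph_dist E w v) + a" by (simp add: graph_dist_sym[of v w])
    then show "u \<in> ?S y x" using u(2,3) by blast
  qed
  have "?S x y = ?S y x" using sub by (rule equalityI[OF _ sub])
  then show ?thesis by (auto simp: tree_dist_def abs_minus_commute)
qed

lemma geodesic_commute: "geodesic E r x y = geodesic E r y x"
proof -
  have "tree_dist E r x z + tree_dist E r z y = tree_dist E r x y \<longleftrightarrow>
    tree_dist E r y z + tree_dist E r z x = tree_dist E r y x" for z
    unfolding tree_dist_commute[of x z] tree_dist_commute[of z y] tree_dist_commute[of x y]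
    by (simp only: add.commute)
  then show ?thesis unfolding geodesic_def by blast
qed

lemma d_X_commute: "d_X E r \<epsilon> x y = d_X E r \<epsilon> y x"
  unfolding d_X_def by (simp only: geodesic_commute[of x y])

lemma d_X_nonneg: "0 \<le> d_X E r \<epsilon> x y"
  unfolding d_X_def set_lebesgue_integral_def by (intro integral_nonneg_AE) auto

section \<open>Boundary geodesics\<close>

abbreviation B :: "(nat \<Rightarrow> 'v) set" where "B \<equiv> tree_boundary E r"

lemma boundary_depth: "\<zeta> \<in> B \<Longrightarrow> depth (\<zeta> n) = n"
  by (auto simp: tree_boundary_def depth_def)

lemma boundary_0: "\<zeta> \<in> B \<Longrightarrow> \<zeta> 0 = r"
  by (auto simp: tree_boundary_def)

text \<open>
  The distance from \<open>\<zeta> j\<close> to \<open>\<zeta> n\<close> is \<open>n - j\<close>, which leaves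
  no room for the paths to separate before level \<open>j\<close>.
\<close>

lemma boundary_anc:
  assumes z: "\<zeta> \<in> B" and j: "j \<le> n" shows "anc (\<zeta> n) j = \<zeta> j"
proof -
  have "graph_dist E (\<zeta> j) (\<zeta> n) = n - j" using z j by (simp add: tree_boundary_def)
  then have "j + n - 2 * meet (\<zeta> j) (\<zeta> n) = n - j"
    by (simp add: graph_dist_eq boundary_depth[OF z])
  moreover have "meet (\<zeta> j) (\<zeta> n) \<le> j" using meet_le(1)[of "\<zeta> j" "\<zeta> n"] boundary_depth[OF z] by simp
  ultimately have "j \<le> meet (\<zeta> j) (\<zeta> n)" using j by linarith
  then have "anc (\<zeta> j) j = anc (\<zeta> n) j" unfolding le_meet_iff by simp
  then show ?thesis using anc_depth[of "\<zeta> j"] boundary_depth[OF z, of j] by simp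
qed

lemma anc_pred: "anc v (depth v - 1) = par v"
proof (cases "v = r")
  case False
  then have "depth v - (depth v - 1) = 1" using depth_pos by simp
  then show ?thesis by (simp add: anc_def)
qed simp

lemma boundary_par: "\<zeta> \<in> B \<Longrightarrow> par (\<zeta> (Suc n)) = \<zeta> n"
  using anc_pred[of "\<zeta> (Suc n)"] boundary_anc[of \<zeta> n "Suc n"] by (simp add: boundary_depth)

lemma boundary_neq_root: "\<zeta> \<in> B \<Longrightarrow> \<zeta> (Suc n) \<noteq> r"
  using boundary_depth[of \<zeta> "Suc n"] depth_root by (metis nat.distinct(1))

lemma boundaryI:
  assumes "\<zeta> 0 = r" "\<And>n. \<zeta> (Suc n) \<noteq> r" "\<And>n. par (\<zeta> (Suc n)) = \<zeta> n"
  shows "\<zeta> \<in> B"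
proof -
  have d: "depth (\<zeta> n) = n" for n
  proof (induction n)
    case (Suc n)
    then show ?case using depth_par[of "\<zeta> (Suc n)"] depth_pos[OF assms(2)[of n]] assms(3)[of n] by simp
  qed (simp add: assms)
  have a: "anc (\<zeta> n) j = \<zeta> j" if "j \<le> n" for j n
    using that
  proof (induction n)
    case (Suc n)
    show ?case
    proof (cases "j = Suc n")
      case True
      then show ?thesis using anc_depth[of "\<zeta> (Suc n)"] d by simp
    next
      case False
      then show ?thesis using Suc anc_par[of j "\<zeta> (Suc n)"] d assms(3)[of n] by simp
    qed
  qed (simp add: assms)
  have "meet (\<zeta> m) (\<zeta> n) = m" if "m \<le> n" for m n
    using that d a by (intro meet_eqI) (auto simp: le_meet_iff)
  then show ?thesis using assms(1) d by (auto simp: tree_boundary_def graph_dist_eq)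
qed

lemma le_meet_boundary:
  assumes "\<zeta> \<in> B" "\<xi> \<in> B" "n \<le> k"
  shows "n \<le> meet (\<zeta> k) (\<xi> k) \<longleftrightarrow> \<zeta> n = \<xi> n"
  using assms by (simp add: le_meet_iff boundary_depth boundary_anc)

end

section \<open>Completion\<close>

locale uniformized_tree = rooted_tree K E r
  for K :: nat and E :: "'v \<Rightarrow> 'v \<Rightarrow> bool" and r :: 'v +
  fixes \<epsilon> :: real
  assumes eps: "0 < \<epsilon>" and K2: "2 \<le> K"
begin

abbreviation C :: "('v point + (nat \<Rightarrow> 'v)) set" where "C \<equiv> tree_completion E r"

lemma approx_in_T: "a \<in> C \<Longrightarrow> approx_seq a n \<in> T"
  by (auto simp: tree_completion_def)

lemma approx_anc:
  assumes "a \<in> C" "m \<le> n"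
  shows "depth (fst (approx_seq a m)) \<le> depth (fst (approx_seq a n)) \<and>
    fst (approx_seq a m) = anc (fst (approx_seq a n)) (depth (fst (approx_seq a m)))"
  using assms by (auto simp: tree_completion_def boundary_depth boundary_anc)

lemma approx_lv_mono: "a \<in> C \<Longrightarrow> m \<le> n \<Longrightarrow> lv (approx_seq a m) \<le> lv (approx_seq a n)"
  by (auto simp: tree_completion_def boundary_depth)

text \<open>Paths continue to agree where they agreed before they were extended.\<close>

lemma meet_mono:
  assumes "depth v \<le> depth v'" "v = anc v' (depth v)" "depth w \<le> depth w'" "w = anc w' (depth w)"
  shows "meet v w \<le> meet v' w'"
proof -
  have "anc v (meet v w) = anc w (meet v w)" using le_meet_iff[of "meet v w" v w] by simp
  then have "anc v' (meet v w) = anc w' (meet v w)"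
    using anc_anc[OF meet_le(1)[of v w] assms(1)] anc_anc[OF meet_le(2)[of v w] assms(3)] assms(2,4) by simp
  then show ?thesis using meet_le[of v w] assms(1,3) unfolding le_meet_iff by simp
qed

lemma approx_gp_mono:
  assumes a: "a \<in> C" and b: "b \<in> C" and mn: "m \<le> n"
  shows "gp (approx_seq a m) (approx_seq b m) \<le> gp (approx_seq a n) (approx_seq b n)"
proof -
  have "meet (fst (approx_seq a m)) (fst (approx_seq b m)) \<le> meet (fst (approx_seq a n)) (fst (approx_seq b n))"
    using approx_anc[OF a mn] approx_anc[OF b mn] by (intro meet_mono) blast+
  then have "real (meet (fst (approx_seq a m)) (fst (approx_seq b m))) \<le> real (meet (fst (approx_seq a n)) (fst (approx_seq b n)))"
    by simp
  then show ?thesis using approx_lv_mono[OF a mn] approx_lv_mono[OF b mn] unfolding gp_def by linarith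
qed

text \<open>
  The exponential of the Gromov product, extended to the completion as a limit. It exists because the products
  increase along the approximating sequences; for a boundary point the level is infinite and \<open>q\<close>
  vanishes on the diagonal.
\<close>

definition q :: "'v point + (nat \<Rightarrow> 'v) \<Rightarrow> 'v point + (nat \<Rightarrow> 'v) \<Rightarrow> real" where
  "q a b = lim (\<lambda>n. exp (- \<epsilon> * gp (approx_seq a n) (approx_seq b n)))"

lemma q_tendsto:
  assumes a: "a \<in> C" and b: "b \<in> C"
  shows "(\<lambda>n. exp (- \<epsilon> * gp (approx_seq a n) (approx_seq b n))) \<longlonglongrightarrow> q a b"
proof -
  have "decseq (\<lambda>n. exp (- \<epsilon> * gp (approx_seq a n) (approx_seq b n)))"
    unfolding decseq_def using eps approx_gp_mono[OF a b] by simp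
  then obtain L where "(\<lambda>n. exp (- \<epsilon> * gp (approx_seq a n) (approx_seq b n))) \<longlonglongrightarrow> L"
    by (rule decseq_convergent[of _ 0]) auto
  then show ?thesis unfolding q_def using limI[of "\<lambda>n. exp (- \<epsilon> * gp (approx_seq a n) (approx_seq b n))" L] by (simp only:)
qed

lemma q_diag_tendsto: "a \<in> C \<Longrightarrow> (\<lambda>n. exp (- \<epsilon> * lv (approx_seq a n))) \<longlonglongrightarrow> q a a"
  using q_tendsto[of a a] by (simp add: gp_self approx_in_T)

lemma q_ge: assumes "a \<in> C" "b \<in> C" shows "q a a \<le> q a b" "q b b \<le> q a b"
proof -
  show "q a a \<le> q a b" using eps gp_le
    by (intro LIMSEQ_le[OF q_diag_tendsto q_tendsto] assms) auto
  show "q b b \<le> q a b" using eps gp_le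
    by (intro LIMSEQ_le[OF q_diag_tendsto q_tendsto] assms) auto
qed

lemma q_ultra:
  assumes a: "a \<in> C" and b: "b \<in> C" and c: "c \<in> C"
  shows "q a c \<le> max (q a b) (q b c)"
proof (rule LIMSEQ_le[OF q_tendsto[OF a c] tendsto_max[OF q_tendsto[OF a b] q_tendsto[OF b c]]])
  have "exp (- \<epsilon> * gp x z) \<le> max (exp (- \<epsilon> * gp x y)) (exp (- \<epsilon> * gp y z))" for x y z
    using gp_ultra[of x y z] eps by (auto simp: min_def le_max_iff_disj split: if_splits)
  then show "\<exists>N. \<forall>n\<ge>N. exp (- \<epsilon> * gp (approx_seq a n) (approx_seq c n)) \<le>
     max (exp (- \<epsilon> * gp (approx_seq a n) (approx_seq b n))) (exp (- \<epsilon> * gp (approx_seq b n) (approx_seq c n)))"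
    by blast
qed

lemma d_completion_eq:
  assumes a: "a \<in> C" and b: "b \<in> C"
  shows "d_completion E r \<epsilon> a b = (2 * q a b - q a a - q b b) / \<epsilon>"
    and "(\<lambda>n. d_X E r \<epsilon> (approx_seq a n) (approx_seq b n)) \<longlonglongrightarrow> d_completion E r \<epsilon> a b"
proof -
  have "(\<lambda>n. (2 * exp (- \<epsilon> * gp (approx_seq a n) (approx_seq b n)) - exp (- \<epsilon> * lv (approx_seq a n))
      - exp (- \<epsilon> * lv (approx_seq b n))) / \<epsilon>) \<longlonglongrightarrow> (2 * q a b - q a a - q b b) / \<epsilon>"
    using eps by (intro tendsto_intros q_tendsto[OF a b] q_diag_tendsto[OF a] q_diag_tendsto[OF b]) auto
  then have *: "(\<lambda>n. d_X E r \<epsilon> (approx_seq a n) (approx_seq b n)) \<longlonglongrightarrow> (2 * q a b - q a a - q b b) / \<epsilon>"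
    by (simp only: d_X_eq[OF approx_in_T[OF a] approx_in_T[OF b] eps])
  then show "d_completion E r \<epsilon> a b = (2 * q a b - q a a - q b b) / \<epsilon>"
    using a b by (simp add: d_completion_def limI)
  then show "(\<lambda>n. d_X E r \<epsilon> (approx_seq a n) (approx_seq b n)) \<longlonglongrightarrow> d_completion E r \<epsilon> a b"
    using * by simp
qed

lemma d_completion_nonneg: "0 \<le> d_completion E r \<epsilon> a b"
proof (cases "a \<in> C \<and> b \<in> C")
  case True
  then show ?thesis by (intro LIMSEQ_le_const[OF d_completion_eq(2)]) (auto intro: d_X_nonneg)
qed (auto simp: d_completion_def)

lemma d_completion_commute: "d_completion E r \<epsilon> a b = d_completion E r \<epsilon> b a"
  unfolding d_completion_def by (simp only: d_X_commute[of \<epsilon> "approx_seq a _"] conj_commute)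

lemma q_Inl: "q (Inl x) (Inl y) = exp (- \<epsilon> * gp x y)"
  by (simp add: q_def)

lemma Inr_in_C [simp]: "Inr \<zeta> \<in> C \<longleftrightarrow> \<zeta> \<in> B"
  and Inl_in_C [simp]: "Inl x \<in> C \<longleftrightarrow> x \<in> T"
  by (auto simp: tree_completion_def)

lemma exp_neg_tendsto: "(\<lambda>n. exp (- \<epsilon> * real n)) \<longlonglongrightarrow> 0"
proof -
  have "(\<lambda>n. exp (- \<epsilon>) ^ n) \<longlonglongrightarrow> 0" using eps by (intro LIMSEQ_power_zero) simp
  then show ?thesis by (simp add: exp_of_nat_mult[symmetric] mult.commute)
qed

lemma q_Inr: assumes "\<zeta> \<in> B" shows "q (Inr \<zeta>) (Inr \<zeta>) = 0"
proof -
  have "(\<lambda>n. exp (- \<epsilon> * real n)) \<longlonglongrightarrow> q (Inr \<zeta>) (Inr \<zeta>)"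
    using q_diag_tendsto[of "Inr \<zeta>"] assms by (simp add: boundary_depth)
  then show ?thesis using exp_neg_tendsto LIMSEQ_unique by blast
qed

lemma q_boundary_le:
  assumes z: "\<zeta> \<in> B" and x: "\<xi> \<in> B" and eq: "\<zeta> n = \<xi> n"
  shows "q (Inr \<zeta>) (Inr \<xi>) \<le> exp (- \<epsilon> * real n)"
proof (rule LIMSEQ_le_const2[OF q_tendsto])
  have "exp (- \<epsilon> * gp (\<zeta> k, 0) (\<xi> k, 0)) \<le> exp (- \<epsilon> * real n)" if k: "n \<le> k" for k
  proof -
    have "n \<le> meet (\<zeta> k) (\<xi> k)" using le_meet_boundary[OF z x k] eq by simp
    then have "real n \<le> gp (\<zeta> k, 0) (\<xi> k, 0)" using k by (simp add: gp_def boundary_depth z x)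
    then show ?thesis using eps by simp
  qed
  then show "\<exists>N. \<forall>k\<ge>N. exp (- \<epsilon> * gp (approx_seq (Inr \<zeta>) k) (approx_seq (Inr \<xi>) k)) \<le> exp (- \<epsilon> * real n)"
    by auto
qed (use z x in auto)

lemma q_boundary_ge:
  assumes z: "\<zeta> \<in> B" and x: "\<xi> \<in> B" and neq: "\<zeta> (Suc n) \<noteq> \<xi> (Suc n)"
  shows "exp (- \<epsilon> * real n) \<le> q (Inr \<zeta>) (Inr \<xi>)"
proof (rule LIMSEQ_le_const[OF q_tendsto])
  have "exp (- \<epsilon> * real n) \<le> exp (- \<epsilon> * gp (\<zeta> k, 0) (\<xi> k, 0))" if k: "Suc n \<le> k" for k
  proof -
    have "\<not> Suc n \<le> meet (\<zeta> k) (\<xi> k)" using le_meet_boundary[OF z x k] neq by simp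
    then have "gp (\<zeta> k, 0) (\<xi> k, 0) \<le> real n" by (simp add: gp_def min_le_iff_disj)
    then show ?thesis using eps by simp
  qed
  then show "\<exists>N. \<forall>k\<ge>N. exp (- \<epsilon> * real n) \<le> exp (- \<epsilon> * gp (approx_seq (Inr \<zeta>) k) (approx_seq (Inr \<xi>) k))"
    by auto
qed (use z x in auto)

lemma boundary_ext:
  assumes z: "\<zeta> \<in> B" and x: "\<xi> \<in> B" and "\<And>n. \<zeta> (Suc n) = \<xi> (Suc n)"
  shows "\<zeta> = \<xi>"
proof
  fix n show "\<zeta> n = \<xi> n" using assms boundary_0[OF z] boundary_0[OF x] by (cases n) simp_all
qed

lemma q_diag_Inl_pos: "0 < q (Inl x) (Inl x)"
  by (simp add: q_Inl)

lemma q_eq_imp_eq: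
  assumes a: "a \<in> C" and b: "b \<in> C" and 1: "q a b = q a a" and 2: "q a b = q b b"
  shows "a = b"
proof (cases a; cases b)
  fix x y assume ab: "a = Inl x" "b = Inl y"
  then have T: "x \<in> T" "y \<in> T" using a b by auto
  have "gp x y = lv x" "gp x y = lv y"
    using 1 2 ab eps gp_self T by (simp_all add: q_Inl)
  then show ?thesis using gp_eq_imp_eq[OF T] ab by simp
next
  fix x \<xi> assume "a = Inl x" "b = Inr \<xi>"
  then show ?thesis using 1 2 q_diag_Inl_pos[of x] q_Inr[of \<xi>] b by simp
next
  fix \<zeta> y assume "a = Inr \<zeta>" "b = Inl y"
  then show ?thesis using 1 2 q_diag_Inl_pos[of y] q_Inr[of \<zeta>] a by simp
next
  fix \<zeta> \<xi> assume ab: "a = Inr \<zeta>" "b = Inr \<xi>"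
  then have B: "\<zeta> \<in> B" "\<xi> \<in> B" using a b by auto
  have "q (Inr \<zeta>) (Inr \<xi>) = 0" using 1 ab q_Inr B by simp
  then have "\<zeta> (Suc n) = \<xi> (Suc n)" for n
    using q_boundary_ge[OF B, of n] by (metis exp_gt_zero not_le)
  then show ?thesis using boundary_ext[OF B] ab by simp
qed

lemma Metric_space_completion: "Metric_space C (d_completion E r \<epsilon>)"
  using d_completion_nonneg d_completion_commute eps d_completion_eq(1) q_ge q_ultra q_eq_imp_eq
  by (intro Metric_space_of_gromov_product[where q = q and \<epsilon> = \<epsilon>]) blast+

lemma d_completion_Inl: "x \<in> T \<Longrightarrow> y \<in> T \<Longrightarrow> d_completion E r \<epsilon> (Inl x) (Inl y) = d_X E r \<epsilon> x y"
  by (simp add: d_completion_def)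

lemma Metric_space_tree: "Metric_space T (d_X E r \<epsilon>)"
proof -
  interpret Metric_space C "d_completion E r \<epsilon>" by (rule Metric_space_completion)
  show ?thesis
  proof
    fix x y assume xy: "x \<in> T" "y \<in> T"
    show "d_X E r \<epsilon> x y = 0 \<longleftrightarrow> x = y"
      using zero[of "Inl x" "Inl y"] xy by (simp add: d_completion_Inl)
  next
    fix x y z assume xyz: "x \<in> T" "y \<in> T" "z \<in> T"
    show "d_X E r \<epsilon> x z \<le> d_X E r \<epsilon> x y + d_X E r \<epsilon> y z"
      using triangle[of "Inl x" "Inl y" "Inl z"] xyz by (simp add: d_completion_Inl)
  qed (rule d_X_nonneg d_X_commute)+
qed

lemma Metric_space_boundary: "Metric_space B (d_boundary E r \<epsilon>)"
proof -
  interpret Metric_space C "d_completion E r \<epsilon>" by (rule Metric_space_completion)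
  show ?thesis unfolding d_boundary_def
  proof
    show "d_completion E r \<epsilon> (Inr x) (Inr y) = d_completion E r \<epsilon> (Inr y) (Inr x)" for x y
      by (rule commute)
  qed (use zero triangle in auto)
qed

section \<open>Balls in the boundary\<close>

text \<open>
  The diameter of the set of boundary geodesics through a vertex of level \<open>n\<close>.
\<close>

definition \<tau> :: "nat \<Rightarrow> real" where
  "\<tau> n = 2 / \<epsilon> * exp (- \<epsilon> * real n)"

lemma \<tau>_pos: "0 < \<tau> n" using eps by (simp add: \<tau>_def)

lemma \<tau>_tendsto: "\<tau> \<longlonglongrightarrow> 0"
  unfolding \<tau>_def using tendsto_mult_left[OF exp_neg_tendsto, of "2 / \<epsilon>"] by simp

lemma d_boundary_eq: "\<zeta> \<in> B \<Longrightarrow> \<xi> \<in> B \<Longrightarrow> d_boundary E r \<epsilon> \<zeta> \<xi> = 2 / \<epsilon> * q (Inr \<zeta>) (Inr \<xi>)"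
  by (simp add: d_boundary_def d_completion_eq q_Inr)

lemma d_boundary_le: "\<zeta> \<in> B \<Longrightarrow> \<xi> \<in> B \<Longrightarrow> \<zeta> n = \<xi> n \<Longrightarrow> d_boundary E r \<epsilon> \<zeta> \<xi> \<le> \<tau> n"
  unfolding d_boundary_eq \<tau>_def using q_boundary_le[of \<zeta> \<xi> n] eps by (intro mult_left_mono) auto

lemma d_boundary_ge: "\<zeta> \<in> B \<Longrightarrow> \<xi> \<in> B \<Longrightarrow> \<zeta> (Suc n) \<noteq> \<xi> (Suc n) \<Longrightarrow> \<tau> n \<le> d_boundary E r \<epsilon> \<zeta> \<xi>"
  unfolding d_boundary_eq \<tau>_def using q_boundary_ge[of \<zeta> \<xi> n] eps by (intro mult_left_mono) auto

text \<open>
  The boundary geodesics through \<open>v\<close>; the set is empty unless \<open>v\<close> has level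
  \<open>n\<close>.
\<close>

definition cyl :: "nat \<Rightarrow> 'v \<Rightarrow> (nat \<Rightarrow> 'v) set" where
  "cyl n v = {\<xi> \<in> B. \<xi> n = v}"

text \<open>
  Distances in the boundary take only the values \<open>0\<close> and \<open>\<tau> n\<close>, so a ball is
  determined by the first level with \<open>\<tau> n < t\<close>. This level does not depend on the centre.
\<close>

lemma ball_eq_cyl:
  assumes "0 < t"
  shows "\<exists>n. \<tau> n < t \<and> (\<forall>\<zeta>\<in>B. Metric_space.mball B (d_boundary E r \<epsilon>) \<zeta> t = cyl n (\<zeta> n))"
proof -
  interpret M: Metric_space B "d_boundary E r \<epsilon>" by (rule Metric_space_boundary)
  have "\<exists>n. \<tau> n < t" using order_tendstoD(2)[OF \<tau>_tendsto assms] by (auto simp: eventually_sequentially)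
  define n where "n = (LEAST n. \<tau> n < t)"
  have n: "\<tau> n < t" unfolding n_def using \<open>\<exists>n. \<tau> n < t\<close> by (rule LeastI_ex)
  have "d_boundary E r \<epsilon> \<zeta> \<xi> < t \<longleftrightarrow> \<xi> n = \<zeta> n" if zx: "\<zeta> \<in> B" "\<xi> \<in> B" for \<zeta> \<xi>
  proof
    assume "\<xi> n = \<zeta> n"
    then show "d_boundary E r \<epsilon> \<zeta> \<xi> < t" using d_boundary_le[OF zx, of n] n by simp
  next
    assume d: "d_boundary E r \<epsilon> \<zeta> \<xi> < t"
    show "\<xi> n = \<zeta> n"
    proof (cases n)
      case 0
      then show ?thesis using zx[THEN boundary_0] by simp
    next
      case (Suc k)
      then have "\<not> \<tau> k < t" using not_less_Least[of k "\<lambda>n. \<tau> n < t"] by (simp add: n_def)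
      then show ?thesis using d_boundary_ge[OF zx, of k] d Suc by force
    qed
  qed
  then have "\<forall>\<zeta>\<in>B. M.mball \<zeta> t = cyl n (\<zeta> n)" by (auto simp: cyl_def)
  then show ?thesis using n by blast
qed

section \<open>Continuous extension of Lipschitz functions\<close>

text \<open>
  Along an approximating sequence the distance is the difference of the values of
  \<open>exp (- \<epsilon> * lv _) / \<epsilon>\<close>, which converge; hence the values of a Lipschitz
  function are a Cauchy sequence, and the Lipschitz bound survives in the limit.
\<close>

lemma lipschitz_extension:
  assumes "lipschitz_tree E r \<epsilon> f"
  shows "\<exists>F. continuous_extension E r \<epsilon> f F \<and> (\<forall>\<zeta>\<in>B. lim (\<lambda>n. f (\<zeta> n, 0)) = F (Inr \<zeta>))"
proof -
  obtain L0 where L0: "\<And>x y. x \<in> T \<Longrightarrow> y \<in> T \<Longrightarrow> \<bar>f x - f y\<bar> \<le> L0 * d_X E r \<epsilon> x y"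
    using assms by (auto simp: lipschitz_tree_def)
  define L where "L = max L0 1"
  have L: "0 < L" by (simp add: L_def)
  have lip: "\<bar>f x - f y\<bar> \<le> L * d_X E r \<epsilon> x y" if "x \<in> T" "y \<in> T" for x y
    using L0[OF that] mult_right_mono[of L0 L "d_X E r \<epsilon> x y"] d_X_nonneg[of \<epsilon> x y] by (simp add: L_def)
  define F where "F a = lim (\<lambda>n. f (approx_seq a n))" for a
  have dd: "d_X E r \<epsilon> (approx_seq a m) (approx_seq a n) =
      \<bar>exp (- \<epsilon> * lv (approx_seq a m)) - exp (- \<epsilon> * lv (approx_seq a n))\<bar> / \<epsilon>" if a: "a \<in> C" for a m n
  proof -
    have g: "gp (approx_seq a m) (approx_seq a n) = lv (approx_seq a m)" if "m \<le> n" for m n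
    proof -
      have "depth (fst (approx_seq a m)) \<le> meet (fst (approx_seq a m)) (fst (approx_seq a n))"
        using approx_anc[OF a that] by (simp add: le_meet_iff)
      then show ?thesis using approx_lv_mono[OF a that] lv_bounds[OF approx_in_T[OF a, of m]]
        unfolding gp_def by linarith
    qed
    have *: "d_X E r \<epsilon> (approx_seq a m) (approx_seq a n) =
      \<bar>exp (- \<epsilon> * lv (approx_seq a m)) - exp (- \<epsilon> * lv (approx_seq a n))\<bar> / \<epsilon>" if mn: "m \<le> n" for m n
    proof -
      have "exp (- \<epsilon> * lv (approx_seq a n)) \<le> exp (- \<epsilon> * lv (approx_seq a m))"
        using approx_lv_mono[OF a mn] eps by simp
      then show ?thesis unfolding d_X_eq[OF approx_in_T[OF a] approx_in_T[OF a] eps] g[OF mn] by simp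
    qed
    show ?thesis
    proof (cases "m \<le> n")
      case True then show ?thesis by (rule *)
    next
      case False
      then show ?thesis using *[of n m] by (simp add: d_X_commute[of \<epsilon> "approx_seq a m"] abs_minus_commute)
    qed
  qed
  have conv: "(\<lambda>n. f (approx_seq a n)) \<longlonglongrightarrow> F a" if a: "a \<in> C" for a
  proof -
    let ?e = "\<lambda>n. exp (- \<epsilon> * lv (approx_seq a n))"
    have "Cauchy ?e" using q_diag_tendsto[OF a] by (rule LIMSEQ_imp_Cauchy)
    have "Cauchy (\<lambda>n. f (approx_seq a n))"
    proof (rule metric_CauchyI)
      fix e :: real assume "0 < e"
      then have "0 < e * \<epsilon> / L" using L eps by simp
      then obtain N where N: "\<And>m n. N \<le> m \<Longrightarrow> N \<le> n \<Longrightarrow> dist (?e m) (?e n) < e * \<epsilon> / L"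
        using metric_CauchyD[OF \<open>Cauchy ?e\<close>] by blast
      have "dist (f (approx_seq a m)) (f (approx_seq a n)) < e" if "N \<le> m" "N \<le> n" for m n
      proof -
        have "\<bar>f (approx_seq a m) - f (approx_seq a n)\<bar> \<le> L * (\<bar>?e m - ?e n\<bar> / \<epsilon>)"
          using lip[OF approx_in_T[OF a] approx_in_T[OF a]] dd[OF a] by metis
        also have "\<dots> < e" using N[OF that] L eps by (simp add: dist_real_def field_simps)
        finally show ?thesis by (simp add: dist_real_def)
      qed
      then show "\<exists>M. \<forall>m\<ge>M. \<forall>n\<ge>M. dist (f (approx_seq a m)) (f (approx_seq a n)) < e" by blast
    qed
    then show ?thesis unfolding F_def by (simp add: Cauchy_convergent_iff convergent_LIMSEQ_iff)
  qed
  have FL: "\<bar>F a - F b\<bar> \<le> L * d_completion E r \<epsilon> a b" if a: "a \<in> C" and b: "b \<in> C" for a b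
    using lip[OF approx_in_T[OF a] approx_in_T[OF b]]
    by (intro LIMSEQ_le[OF tendsto_rabs[OF tendsto_diff[OF conv[OF a] conv[OF b]]]
          tendsto_mult_left[OF d_completion_eq(2)[OF a b]]]) blast
  interpret M: Metric_space C "d_completion E r \<epsilon>" by (rule Metric_space_completion)
  have "continuous_map M.mtopology euclideanreal F"
    unfolding continuous_map_def
  proof (intro conjI allI impI)
    fix U :: "real set" assume "openin euclidean U"
    then have U: "open U" by (simp only: open_openin)
    show "openin M.mtopology {x \<in> topspace M.mtopology. F x \<in> U}"
      unfolding M.openin_mtopology
    proof (intro conjI allI impI)
      fix a assume "a \<in> {x \<in> topspace M.mtopology. F x \<in> U}"
      then have a: "a \<in> C" "F a \<in> U" by auto
      then obtain e where e: "0 < e" "\<And>y. dist y (F a) < e \<Longrightarrow> y \<in> U" using U by (auto simp: open_dist)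
      have "F b \<in> U" if "b \<in> M.mball a (e / L)" for b
      proof -
        have b: "b \<in> C" "d_completion E r \<epsilon> a b < e / L" using that by auto
        then have "L * d_completion E r \<epsilon> a b < e" using L by (simp add: field_simps)
        then show ?thesis using FL[OF a(1) b(1)] by (intro e(2)) (simp add: dist_real_def abs_minus_commute)
      qed
      then show "\<exists>s>0. M.mball a s \<subseteq> {x \<in> topspace M.mtopology. F x \<in> U}"
        using e L by (intro exI[of _ "e / L"]) auto
    qed auto
  qed auto
  moreover have "F (Inl x) = f x" for x by (simp add: F_def)
  ultimately have "continuous_extension E r \<epsilon> f F" by (simp add: continuous_extension_def)
  then show ?thesis by (intro exI[of _ F]) (simp add: F_def)
qed

end

section \<open>Powers in the extended half line\<close>

lemma epowr_ennreal: "0 \<le> x \<Longrightarrow> epowr (ennreal x) q = ennreal (x powr q)"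
  by (simp add: epowr_def)

lemma epowr_top [simp]: "epowr top q = top"
  by (simp add: epowr_def)

lemma epowr_0 [simp]: "epowr 0 q = 0"
  by (simp add: epowr_def)

lemma epowr_1 [simp]: "epowr a 1 = a"
  by (cases a rule: ennreal_cases) (simp_all add: epowr_ennreal)

lemma epowr_eq_top: "epowr a q = top \<longleftrightarrow> a = top"
  by (simp add: epowr_def)

lemma epowr_mono: "a \<le> b \<Longrightarrow> 0 \<le> q \<Longrightarrow> epowr a q \<le> epowr b q"
proof (cases b rule: ennreal_cases)
  case (real y)
  assume "a \<le> b" and q: "0 \<le> q"
  then obtain x where x: "a = ennreal x" "0 \<le> x" "x \<le> y"
    using real by (cases a rule: ennreal_cases) (auto simp: top_unique)
  then show ?thesis using real q by (simp add: epowr_ennreal powr_mono2)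
qed simp

lemma epowr_mult:
  assumes q: "0 < q" shows "epowr (a * b) q = epowr a q * epowr b q"
proof (cases a rule: ennreal_cases; cases b rule: ennreal_cases)
  fix x y assume "a = ennreal x" "0 \<le> x" "b = ennreal y" "0 \<le> y"
  then show ?thesis by (simp add: epowr_ennreal powr_mult flip: ennreal_mult)
next
  fix x assume x: "a = ennreal x" "0 \<le> x" "b = top"
  then show ?thesis by (cases "x = 0") (simp_all add: epowr_ennreal ennreal_mult_top)
next
  fix y assume y: "a = top" "b = ennreal y" "0 \<le> y"
  then show ?thesis by (cases "y = 0") (simp_all add: epowr_ennreal ennreal_top_mult)
qed simp

lemma epowr_epowr: "epowr (epowr a p) q = epowr a (p * q)"
  by (cases a rule: ennreal_cases) (simp_all add: epowr_ennreal powr_powr)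

lemma epowr_measurable [measurable (raw)]:
  assumes [measurable]: "f \<in> borel_measurable M"
  shows "(\<lambda>x. epowr (f x) q) \<in> borel_measurable M"
  unfolding epowr_def by measurable

section \<open>Hausdorff measure\<close>

lemma hausdorff_premeasure_mono:
  "A \<subseteq> A' \<Longrightarrow> hausdorff_premeasure S d Q \<delta> A \<le> hausdorff_premeasure S d Q \<delta> A'"
  unfolding hausdorff_premeasure_def by (intro INF_superset_mono) auto

lemma hausdorff_premeasure_antimono:
  "\<delta> \<le> \<delta>' \<Longrightarrow> hausdorff_premeasure S d Q \<delta>' A \<le> hausdorff_premeasure S d Q \<delta> A"
  unfolding hausdorff_premeasure_def
  by (intro INF_superset_mono) (auto intro: order_trans ennreal_leI)

lemma hausdorff_premeasure_le:
  assumes "A \<subseteq> (\<Union>i. U i)" "\<And>i. U i \<subseteq> S" "\<And>i. set_diam d (U i) \<le> ennreal \<delta>"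
  shows "hausdorff_premeasure S d Q \<delta> A \<le> (\<Sum>i. epowr (set_diam d (U i)) Q)"
  unfolding hausdorff_premeasure_def by (intro INF_lower) (use assms in auto)

lemma set_diam_empty [simp]: "set_diam d {} = 0"
  by (simp add: set_diam_def bot_ennreal)

lemma set_diam_mono: "A \<subseteq> A' \<Longrightarrow> set_diam d A \<le> set_diam d A'"
  unfolding set_diam_def by (intro SUP_subset_mono order_refl) auto

lemma hausdorff_premeasure_empty: "hausdorff_premeasure S d Q \<delta> {} = 0"
proof -
  have "hausdorff_premeasure S d Q \<delta> {} \<le> (\<Sum>i::nat. epowr (set_diam d {}) Q)"
    by (intro hausdorff_premeasure_le) auto
  then show ?thesis by simp
qed

lemma hausdorff_premeasure_subset_le:
  assumes "A \<subseteq> S" "set_diam d A \<le> ennreal \<delta>"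
  shows "hausdorff_premeasure S d Q \<delta> A \<le> epowr (set_diam d A) Q"
proof -
  let ?U = "\<lambda>i::nat. if i = 0 then A else {}"
  have "hausdorff_premeasure S d Q \<delta> A \<le> (\<Sum>i. epowr (set_diam d (?U i)) Q)"
    using assms by (intro hausdorff_premeasure_le) auto
  also have "(\<lambda>i. epowr (set_diam d (?U i)) Q) = (\<lambda>i. if i = 0 then epowr (set_diam d A) Q else 0)"
    by auto
  also have "(\<Sum>i::nat. if i = 0 then epowr (set_diam d A) Q else 0) = epowr (set_diam d A) Q"
    by (subst suminf_finite[of "{0}"]) auto
  finally show ?thesis .
qed

text \<open>
  Nearly optimal covers of the \<open>A i\<close>, with errors \<open>e / 2^(i+1)\<close>, are put into one
  sequence.
\<close>

lemma hausdorff_premeasure_countably_subadditive: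
  "hausdorff_premeasure S d Q \<delta> (\<Union>i::nat. A i) \<le> (\<Sum>i. hausdorff_premeasure S d Q \<delta> (A i))"
proof (rule ennreal_le_epsilon)
  fix e :: real assume fin: "(\<Sum>i. hausdorff_premeasure S d Q \<delta> (A i)) < top" and e: "0 < e"
  let ?h = "hausdorff_premeasure S d Q \<delta>"
  have "\<exists>U. A i \<subseteq> (\<Union>j. U j) \<and> (\<forall>j. U j \<subseteq> S \<and> set_diam d (U j) \<le> ennreal \<delta>) \<and>
      (\<Sum>j::nat. epowr (set_diam d (U j)) Q) < ?h (A i) + ennreal (e * (1/2) ^ Suc i)" for i
  proof -
    have "?h (A i) \<noteq> \<infinity>" using ennreal_suminf_lessD[OF fin, of i] by simp
    from INF_approx_ennreal[OF _ hausdorff_premeasure_def this, of "e * (1/2) ^ Suc i"]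
    show ?thesis using e by auto
  qed
  then have "\<exists>U. \<forall>i. A i \<subseteq> (\<Union>j. U i j) \<and> (\<forall>j. U i j \<subseteq> S \<and> set_diam d (U i j) \<le> ennreal \<delta>) \<and>
      (\<Sum>j::nat. epowr (set_diam d (U i j)) Q) < ?h (A i) + ennreal (e * (1/2) ^ Suc i)"
    by (intro choice allI)
  then obtain U where U: "\<forall>i. A i \<subseteq> (\<Union>j. U i j) \<and> (\<forall>j. U i j \<subseteq> S \<and> set_diam d (U i j) \<le> ennreal \<delta>) \<and>
      (\<Sum>j::nat. epowr (set_diam d (U i j)) Q) < ?h (A i) + ennreal (e * (1/2) ^ Suc i)" ..
  note cover = U[THEN spec, THEN conjunct1]
    and small = U[THEN spec, THEN conjunct2, THEN conjunct1, THEN spec]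
    and near = U[THEN spec, THEN conjunct2, THEN conjunct2]
  have cov: "(\<Union>i. A i) \<subseteq> (\<Union>k. case_prod U (prod_decode k))"
  proof
    fix x assume "x \<in> (\<Union>i. A i)"
    then obtain i where "x \<in> A i" by blast
    then obtain j where "x \<in> U i j" using cover[of i] by blast
    then have "x \<in> case_prod U (prod_decode (prod_encode (i, j)))" by simp
    then show "x \<in> (\<Union>k. case_prod U (prod_decode k))" by (rule UN_I[OF UNIV_I])
  qed
  have "?h (\<Union>i. A i) \<le> (\<Sum>k. epowr (set_diam d (case_prod U (prod_decode k))) Q)"
    by (intro hausdorff_premeasure_le[OF cov]) (simp_all add: small split: prod.split)
  also have "\<dots> = (\<Sum>i. \<Sum>j. epowr (set_diam d (U i j)) Q)"
    using suminf_ennreal_2dimen[of _ "\<lambda>ij. epowr (set_diam d (case_prod U ij)) Q", OF refl] by simp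
  also have "\<dots> \<le> (\<Sum>i. ?h (A i) + ennreal (e * (1/2) ^ Suc i))"
    by (intro suminf_le less_imp_le[OF near] summableI)
  also have "\<dots> = (\<Sum>i. ?h (A i)) + (\<Sum>i. ennreal (e * (1/2) ^ Suc i))"
    by (intro suminf_add[symmetric]) auto
  also have "(\<Sum>i. ennreal (e * (1/2) ^ Suc i)) = ennreal e"
    using e sums_mult[OF power_half_series, of e] by (intro suminf_ennreal_eq) auto
  finally show "?h (\<Union>i. A i) \<le> (\<Sum>i. ?h (A i)) + ennreal e" .
qed

lemma hausdorff_premeasure_le_measure:
  "0 < \<delta> \<Longrightarrow> hausdorff_premeasure S d Q \<delta> A \<le> hausdorff_measure S d Q A"
  unfolding hausdorff_measure_def by (rule SUP_upper) simp

lemma hausdorff_measure_mono: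
  "A \<subseteq> A' \<Longrightarrow> hausdorff_measure S d Q A \<le> hausdorff_measure S d Q A'"
  unfolding hausdorff_measure_def by (intro SUP_mono') (rule hausdorff_premeasure_mono)

lemma hausdorff_measure_empty [simp]: "hausdorff_measure S d Q {} = 0"
  by (simp add: hausdorff_measure_def hausdorff_premeasure_empty)

lemma hausdorff_measure_countably_subadditive:
  "hausdorff_measure S d Q (\<Union>i::nat. A i) \<le> (\<Sum>i. hausdorff_measure S d Q (A i))"
proof -
  have "hausdorff_premeasure S d Q \<delta> (\<Union>i::nat. A i) \<le> (\<Sum>i. hausdorff_measure S d Q (A i))"
    if "0 < \<delta>" for \<delta>
    using hausdorff_premeasure_countably_subadditive
    by (rule order_trans) (intro suminf_le hausdorff_premeasure_le_measure that summableI)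
  then show ?thesis unfolding hausdorff_measure_def[of _ _ _ "\<Union> _"] by (intro SUP_least) simp
qed

lemma outer_measure_space_hausdorff: "outer_measure_space (Pow S) (hausdorff_measure S d Q)"
  by (auto simp: outer_measure_space_def positive_def increasing_def countably_subadditive_def
    intro: hausdorff_measure_mono hausdorff_measure_countably_subadditive)

lemma finite_subadditive_of_countably:
  fixes F :: "'a set \<Rightarrow> ennreal"
  assumes "finite I" and F: "F {} = 0" "\<And>A. F (\<Union>i::nat. A i) \<le> (\<Sum>i. F (A i))"
  shows "F (\<Union>i\<in>I. A i) \<le> (\<Sum>i\<in>I. F (A i))"
proof -
  obtain n and f :: "nat \<Rightarrow> _" where f: "bij_betw f {..<n} I"
    using ex_bij_betw_nat_finite[OF assms(1)] by (auto simp: atLeast0LessThan)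
  let ?A = "\<lambda>k. if k < n then A (f k) else {}"
  have "(\<Union>i\<in>I. A i) = (\<Union>k. ?A k)"
    using bij_betw_imp_surj_on[OF f, symmetric] by (auto split: if_splits)
  then have "F (\<Union>i\<in>I. A i) \<le> (\<Sum>k. F (?A k))"
    by (simp only: F(2))
  also have "\<dots> = (\<Sum>k<n. F (A (f k)))"
    by (subst suminf_finite[of "{..<n}"]) (auto simp: F)
  also have "\<dots> = (\<Sum>i\<in>I. F (A i))"
    by (rule sum.reindex_bij_betw[OF f])
  finally show ?thesis .
qed

lemma hausdorff_measure_finite_subadditive:
  "finite I \<Longrightarrow> hausdorff_measure S d Q (\<Union>i\<in>I. A i) \<le> (\<Sum>i\<in>I. hausdorff_measure S d Q (A i))"
  by (intro finite_subadditive_of_countably[where F = "hausdorff_measure S d Q"]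
      hausdorff_measure_empty hausdorff_measure_countably_subadditive)

lemma hausdorff_premeasure_finite_subadditive:
  "finite I \<Longrightarrow> hausdorff_premeasure S d Q \<delta> (\<Union>i\<in>I. A i) \<le> (\<Sum>i\<in>I. hausdorff_premeasure S d Q \<delta> (A i))"
  by (intro finite_subadditive_of_countably[where F = "hausdorff_premeasure S d Q \<delta>"]
      hausdorff_premeasure_empty hausdorff_premeasure_countably_subadditive)

text \<open>
  A set of diameter at most \<open>\<delta>\<close> cannot meet both \<open>C\<close> and its complement, so every
  admissible cover splits into a cover of either part.
\<close>

lemma separated_premeasure_add:
  assumes sep: "\<And>x y. x \<in> C \<Longrightarrow> y \<in> S - C \<Longrightarrow> \<delta> < d x y" and \<delta>: "0 < \<delta>" and Q: "0 < Q"
  shows "hausdorff_premeasure S d Q \<delta> (A \<inter> C) + hausdorff_premeasure S d Q \<delta> (A - C)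
    \<le> hausdorff_premeasure S d Q \<delta> A"
  unfolding hausdorff_premeasure_def[of S d Q \<delta> A]
proof (rule INF_greatest, safe)
  fix U :: "nat \<Rightarrow> 'a set"
  assume U: "A \<subseteq> (\<Union>i. U i)" "\<forall>i. U i \<subseteq> S \<and> set_diam d (U i) \<le> ennreal \<delta>"
  have split: "U i \<subseteq> C \<or> U i \<inter> C = {}" for i
  proof (rule ccontr)
    assume "\<not> (U i \<subseteq> C \<or> U i \<inter> C = {})"
    then obtain x y where xy: "x \<in> U i" "x \<in> C" "y \<in> U i" "y \<notin> C" by blast
    then have "\<delta> < d x y" using sep U(2) by blast
    moreover have "ennreal (d x y) \<le> set_diam d (U i)"
      unfolding set_diam_def using xy by (auto intro: SUP_upper2)
    ultimately have "ennreal \<delta> < ennreal \<delta>"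
      using U(2) \<delta> by (metis ennreal_lessI less_le_trans order.strict_trans1 less_trans)
    then show False by simp
  qed
  have "hausdorff_premeasure S d Q \<delta> (A \<inter> C) \<le> (\<Sum>i. epowr (set_diam d (U i \<inter> C)) Q)"
    using U by (intro hausdorff_premeasure_le) (auto intro: order_trans[OF set_diam_mono])
  moreover have "hausdorff_premeasure S d Q \<delta> (A - C) \<le> (\<Sum>i. epowr (set_diam d (U i - C)) Q)"
    using U by (intro hausdorff_premeasure_le) (auto intro: order_trans[OF set_diam_mono])
  ultimately have "hausdorff_premeasure S d Q \<delta> (A \<inter> C) + hausdorff_premeasure S d Q \<delta> (A - C)
    \<le> (\<Sum>i. epowr (set_diam d (U i \<inter> C)) Q) + (\<Sum>i. epowr (set_diam d (U i - C)) Q)"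
    by (rule add_mono)
  also have "\<dots> = (\<Sum>i. epowr (set_diam d (U i \<inter> C)) Q + epowr (set_diam d (U i - C)) Q)"
    by (intro suminf_add) auto
  also have "(\<lambda>i. epowr (set_diam d (U i \<inter> C)) Q + epowr (set_diam d (U i - C)) Q) = (\<lambda>i. epowr (set_diam d (U i)) Q)"
  proof
    fix i show "epowr (set_diam d (U i \<inter> C)) Q + epowr (set_diam d (U i - C)) Q = epowr (set_diam d (U i)) Q"
      using split[of i]
    proof
      assume "U i \<subseteq> C"
      then have "U i \<inter> C = U i" "U i - C = {}" by auto
      then show ?thesis by (simp only: set_diam_empty epowr_0 add_0_right)
    next
      assume "U i \<inter> C = {}"
      then have "U i \<inter> C = {}" "U i - C = U i" by auto
      then show ?thesis by (simp only: set_diam_empty epowr_0 add_0_left)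
    qed
  qed
  finally show "hausdorff_premeasure S d Q \<delta> (A \<inter> C) + hausdorff_premeasure S d Q \<delta> (A - C)
    \<le> (\<Sum>i. epowr (set_diam d (U i)) Q)" .
qed

text \<open>Caratheodory's criterion for a set at positive distance from its complement.\<close>

lemma separated_in_lambda_system:
  assumes C: "C \<subseteq> S" and sep: "\<And>x y. x \<in> C \<Longrightarrow> y \<in> S - C \<Longrightarrow> \<eta> \<le> d x y" and \<eta>: "0 < \<eta>" and Q: "0 < Q"
  shows "C \<in> lambda_system S (Pow S) (hausdorff_measure S d Q)"
proof -
  interpret algebra S "Pow S" by (rule algebra_Pow)
  let ?h = "hausdorff_premeasure S d Q" and ?H = "hausdorff_measure S d Q"
  have "?H (A \<inter> C) + ?H (A - C) = ?H A" for A
  proof (rule antisym)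
    have "?h \<delta> (A \<inter> C) + ?h \<delta>' (A - C) \<le> ?H A" if "0 < \<delta>" "0 < \<delta>'" for \<delta> \<delta>'
    proof -
      define \<delta>0 where "\<delta>0 = min (\<eta> / 2) (min \<delta> \<delta>')"
      have \<delta>0: "0 < \<delta>0" "\<delta>0 < \<eta>" "\<delta>0 \<le> \<delta>" "\<delta>0 \<le> \<delta>'" using that \<eta> by (auto simp: \<delta>0_def)
      have "?h \<delta> (A \<inter> C) + ?h \<delta>' (A - C) \<le> ?h \<delta>0 (A \<inter> C) + ?h \<delta>0 (A - C)"
        using \<delta>0 by (intro add_mono hausdorff_premeasure_antimono) auto
      also have "\<dots> \<le> ?h \<delta>0 A"
        using sep \<delta>0 Q by (intro separated_premeasure_add) (auto intro: less_le_trans)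
      also have "\<dots> \<le> ?H A" using \<delta>0 by (intro hausdorff_premeasure_le_measure)
      finally show ?thesis .
    qed
    then have "?h \<delta> (A \<inter> C) + ?H (A - C) \<le> ?H A" if "0 < \<delta>" for \<delta>
      using that unfolding hausdorff_measure_def[of S d Q "A - C"]
      by (subst ennreal_SUP_add_right) (auto intro: SUP_least)
    then show "?H (A \<inter> C) + ?H (A - C) \<le> ?H A"
      unfolding hausdorff_measure_def[of S d Q "A \<inter> C"]
      by (subst ennreal_SUP_add_left[symmetric]) (auto intro: SUP_least)
  next
    have A: "A = (\<Union>b\<in>UNIV. if b then A \<inter> C else A - C)" by auto
    have "?H A \<le> (\<Sum>b\<in>UNIV. ?H (if b then A \<inter> C else A - C))"
      by (subst A, rule hausdorff_measure_finite_subadditive) simp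
    then show "?H A \<le> ?H (A \<inter> C) + ?H (A - C)" by (simp add: UNIV_bool add.commute)
  qed
  then show ?thesis unfolding lambda_system_eq using C by auto
qed

context uniformized_tree begin

section \<open>Hausdorff measure of the boundary of a tree\<close>

abbreviation d :: "(nat \<Rightarrow> 'v) \<Rightarrow> (nat \<Rightarrow> 'v) \<Rightarrow> real" where "d \<equiv> d_boundary E r \<epsilon>"

abbreviation Q :: real where "Q \<equiv> ln (real K) / \<epsilon>"

text \<open>The total Hausdorff measure of the boundary; see \<open>H_B\<close>.\<close>

definition mass :: real where "mass = (2 / \<epsilon>) powr Q"

lemma K_pos: "0 < real K" using K2 by simp

lemma Q_pos: "0 < Q" using eps K2 by simp

lemma mass_pos: "0 < mass" using eps by (simp add: mass_def)

text \<open>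
  The dimension \<open>Q\<close> is chosen such that the contribution of a vertex to the Hausdorff measure is the
  sum of those of its \<open>K\<close> children.
\<close>

lemma \<tau>_powr: "\<tau> n powr Q = mass / real K ^ n"
proof -
  have "\<tau> n powr Q = mass * exp (- \<epsilon> * real n) powr Q"
    unfolding \<tau>_def mass_def using eps by (subst powr_mult) auto
  also have "exp (- \<epsilon> * real n) powr Q = exp (- \<epsilon> * real n * Q)" by (simp add: powr_def)
  also have "- \<epsilon> * real n * Q = - (real n * ln (real K))" using eps by simp
  also have "exp (- (real n * ln (real K))) = 1 / real K ^ n"
    using K_pos by (simp only: exp_minus exp_of_nat_mult exp_ln) (simp add: field_simps)
  finally show ?thesis by simp
qed

lemma \<tau>_mono: "m \<le> n \<Longrightarrow> \<tau> n \<le> \<tau> m"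
  unfolding \<tau>_def using eps by (intro mult_left_mono) auto

lemma cyl_subset: "cyl n v \<subseteq> B"
  by (auto simp: cyl_def)

lemma cyl_0: "cyl 0 r = B"
  by (auto simp: cyl_def boundary_0)

lemma cyl_diam: "set_diam d (cyl n v) \<le> ennreal (\<tau> n)"
  unfolding set_diam_def using d_boundary_le[of _ _ n]
  by (intro SUP_least ennreal_leI) (auto simp: cyl_def)

lemma cyl_split: "cyl n v = (\<Union>w\<in>{w. w \<noteq> r \<and> par w = v}. cyl (Suc n) w)"
  by (auto simp: cyl_def boundary_par boundary_neq_root)

lemma cyl_separated:
  assumes "x \<in> cyl n v" "y \<in> B - cyl n v"
  shows "\<tau> n \<le> d x y"
proof (cases n)
  case 0
  then show ?thesis using assms boundary_0[of x] boundary_0[of y] by (simp add: cyl_def)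
next
  case (Suc k)
  then have "\<tau> k \<le> d x y" using assms by (intro d_boundary_ge) (auto simp: cyl_def)
  then show ?thesis using \<tau>_mono[of k n] Suc by simp
qed

lemma B_levels: "B = (\<Union>v\<in>{v. depth v = n}. cyl n v)"
  by (auto simp: cyl_def boundary_depth)

abbreviation H :: "(nat \<Rightarrow> 'v) set \<Rightarrow> ennreal" where
  "H \<equiv> hausdorff_measure B d Q"

lemma card_times_ennreal: "(\<Sum>w\<in>I. ennreal x) = ennreal (real (card I) * x)"
  by (simp only: sum_constant ennreal_of_nat_eq_real_of_nat ennreal_mult'[OF of_nat_0_le_iff])

lemma sum_children_mass: "(\<Sum>w\<in>{w. w \<noteq> r \<and> par w = v}. ennreal (mass / real K ^ Suc n)) = ennreal (mass / real K ^ n)"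
proof -
  have "(\<Sum>w\<in>{w. w \<noteq> r \<and> par w = v}. ennreal (mass / real K ^ Suc n)) = ennreal (real K * (mass / real K ^ Suc n))"
    by (simp only: card_times_ennreal card_children)
  also have "real K * (mass / real K ^ Suc n) = mass / real K ^ n" using K_pos by simp
  finally show ?thesis .
qed

text \<open>
  Far out the set itself is an admissible cover. The bound is then carried back towards the root, one level at a
  time, since the bounds for the children add up to that for the parent.
\<close>

lemma premeasure_cyl_le:
  assumes "0 < \<delta>" shows "hausdorff_premeasure B d Q \<delta> (cyl n v) \<le> ennreal (mass / real K ^ n)"
proof -
  obtain m where m: "\<tau> m < \<delta>"
    using order_tendstoD(2)[OF \<tau>_tendsto assms] by (auto simp: eventually_sequentially)
  have small: "hausdorff_premeasure B d Q \<delta> (cyl n v) \<le> ennreal (mass / real K ^ n)" if "m \<le> n" for n v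
  proof -
    have "set_diam d (cyl n v) \<le> ennreal \<delta>"
      using cyl_diam[of n v] \<tau>_mono[OF that] m by (meson ennreal_leI less_imp_le order_trans)
    then have "hausdorff_premeasure B d Q \<delta> (cyl n v) \<le> epowr (set_diam d (cyl n v)) Q"
      by (intro hausdorff_premeasure_subset_le cyl_subset)
    also have "\<dots> \<le> epowr (ennreal (\<tau> n)) Q"
      using Q_pos by (intro epowr_mono cyl_diam) simp
    also have "\<dots> = ennreal (mass / real K ^ n)"
      using \<tau>_pos[of n] by (simp add: epowr_ennreal \<tau>_powr less_imp_le)
    finally show ?thesis .
  qed
  have "hausdorff_premeasure B d Q \<delta> (cyl n v) \<le> ennreal (mass / real K ^ n)" if "m \<le> n + k" for k n v
    using that
  proof (induction k arbitrary: n v)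
    case 0 then show ?case using small by simp
  next
    case (Suc k)
    have "hausdorff_premeasure B d Q \<delta> (cyl n v) \<le>
      (\<Sum>w\<in>{w. w \<noteq> r \<and> par w = v}. hausdorff_premeasure B d Q \<delta> (cyl (Suc n) w))"
      unfolding cyl_split[of n v] by (rule hausdorff_premeasure_finite_subadditive) (rule finite_children)
    also have "\<dots> \<le> (\<Sum>w\<in>{w. w \<noteq> r \<and> par w = v}. ennreal (mass / real K ^ Suc n))"
      using Suc.prems by (intro sum_mono Suc.IH) simp
    finally show ?case unfolding sum_children_mass .
  qed
  from this[of n m] show ?thesis by simp
qed

lemma H_cyl_le: "H (cyl n v) \<le> ennreal (mass / real K ^ n)"
  unfolding hausdorff_measure_def using premeasure_cyl_le by (intro SUP_least) auto

text \<open>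
  The mass distribution principle. Call a vertex \<open>bad\<close> if no covering set contains all geodesics
  through it and the covering sets inside have too little mass. If the cover had total mass below
  \<open>mass\<close>, then the root would be bad, and a bad vertex has a bad child because masses add up over the
  children. The resulting infinite geodesic of bad vertices lies in no covering set.
\<close>

lemma cyl_cover_mass:
  assumes cov: "B \<subseteq> (\<Union>i::nat. cyl (n i) (v i))" and dv: "\<And>i. depth (v i) = n i"
  shows "ennreal mass \<le> (\<Sum>i. ennreal (mass / real K ^ n i))"
proof (rule ccontr)
  assume "\<not> ?thesis"
  then have less: "(\<Sum>i. ennreal (mass / real K ^ n i)) < ennreal mass" by simp
  define \<phi> where "\<phi> u = (\<Sum>i. if depth u \<le> n i \<and> anc (v i) (depth u) = u then ennreal (mass / real K ^ n i) else 0)" for u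
  define bad where "bad u \<longleftrightarrow> \<phi> u < ennreal (mass / real K ^ depth u) \<and> (\<forall>i. \<not> (n i \<le> depth u \<and> anc u (n i) = v i))" for u
  have "bad r"
  proof -
    have "\<phi> r = (\<Sum>i. ennreal (mass / real K ^ n i))" by (simp add: \<phi>_def)
    moreover have "n i \<noteq> 0" for i
    proof
      assume "n i = 0"
      then show False using ennreal_suminf_lessD[OF less, of i] by simp
    qed
    ultimately show ?thesis using less by (simp add: bad_def)
  qed
  have step: "\<exists>w. w \<noteq> r \<and> par w = u \<and> bad w" if bad: "bad u" for u
  proof (rule ccontr)
    assume nb: "\<not> ?thesis"
    let ?Ch = "{w. w \<noteq> r \<and> par w = u}" and ?d = "depth u"
    have dw: "depth w = Suc ?d" if "w \<in> ?Ch" for w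
      using that depth_par[of w] depth_pos[of w] by auto
    have ge: "ennreal (mass / real K ^ Suc ?d) \<le> \<phi> w" if w: "w \<in> ?Ch" for w
    proof (rule ccontr)
      assume "\<not> ?thesis"
      then have "\<phi> w < ennreal (mass / real K ^ depth w)" by (simp add: dw[OF w])
      moreover have "\<not> bad w" using nb w by blast
      ultimately obtain i where i: "n i \<le> depth w" "anc w (n i) = v i" unfolding bad_def by blast
      have "\<not> n i \<le> ?d"
      proof
        assume le: "n i \<le> ?d"
        then have "anc u (n i) = anc w (n i)" using anc_par[of "n i" w] w dw[OF w] by auto
        then show False using bad le i unfolding bad_def by auto
      qed
      then have "n i = depth w" using i dw[OF w] by simp
      then have "v i = w" using i by simp
      have "(if depth w \<le> n i \<and> anc (v i) (depth w) = w then ennreal (mass / real K ^ n i) else 0) < ennreal (mass / real K ^ depth w)"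
        using \<open>\<phi> w < _\<close> unfolding \<phi>_def by (rule ennreal_suminf_lessD)
      then show False using \<open>n i = depth w\<close> \<open>v i = w\<close> by simp
    qed
    have "ennreal (mass / real K ^ ?d) = (\<Sum>w\<in>?Ch. ennreal (mass / real K ^ Suc ?d))"
      by (rule sum_children_mass[symmetric])
    also have "\<dots> \<le> (\<Sum>w\<in>?Ch. \<phi> w)" using ge by (rule sum_mono)
    also have "\<dots> = (\<Sum>i. \<Sum>w\<in>?Ch. if depth w \<le> n i \<and> anc (v i) (depth w) = w then ennreal (mass / real K ^ n i) else 0)"
      unfolding \<phi>_def by (rule suminf_sum[symmetric]) simp
    also have "\<dots> \<le> \<phi> u"
      unfolding \<phi>_def
    proof (intro suminf_le summableI)
      fix i
      let ?t = "ennreal (mass / real K ^ n i)" and ?w = "anc (v i) (Suc ?d)"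
      have "(\<Sum>w\<in>?Ch. if depth w \<le> n i \<and> anc (v i) (depth w) = w then ?t else 0) =
        (\<Sum>w\<in>?Ch. if w = ?w then (if Suc ?d \<le> n i then ?t else 0) else 0)"
        by (intro sum.cong refl) (auto simp: dw)
      also have "\<dots> = (if ?w \<in> ?Ch then (if Suc ?d \<le> n i then ?t else 0) else 0)"
        using finite_children by (rule sum.delta)
      also have "\<dots> \<le> (if ?d \<le> n i \<and> anc (v i) ?d = u then ?t else 0)"
      proof (cases "?w \<in> ?Ch \<and> Suc ?d \<le> n i")
        case True
        then have "anc (v i) ?d = par ?w"
          using anc_anc[of ?d "Suc ?d" "v i"] anc_pred[of ?w] dv[of i] depth_anc[of "Suc ?d" "v i"] by simp
        then show ?thesis using True by simp
      qed auto
      finally show "(\<Sum>w\<in>?Ch. if depth w \<le> n i \<and> anc (v i) (depth w) = w then ?t else 0) \<le>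
        (if ?d \<le> n i \<and> anc (v i) ?d = u then ?t else 0)" .
    qed
    also have "\<dots> < ennreal (mass / real K ^ ?d)" using bad by (simp add: bad_def)
    finally show False by simp
  qed
  have "\<exists>\<zeta>. \<forall>k. (bad (\<zeta> k) \<and> (k = 0 \<longrightarrow> \<zeta> k = r)) \<and> (\<zeta> (Suc k) \<noteq> r \<and> par (\<zeta> (Suc k)) = \<zeta> k)"
    using \<open>bad r\<close> step by (intro dependent_nat_choice) auto
  then obtain \<zeta> where \<zeta>: "\<And>k. bad (\<zeta> k)" "\<zeta> 0 = r" "\<And>k. \<zeta> (Suc k) \<noteq> r" "\<And>k. par (\<zeta> (Suc k)) = \<zeta> k"
    by auto
  have zB: "\<zeta> \<in> B" using \<zeta>(2-4) by (rule boundaryI)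
  then obtain i where "\<zeta> \<in> cyl (n i) (v i)" using cov by blast
  then have "\<zeta> (n i) = v i" by (simp add: cyl_def)
  moreover have "depth (\<zeta> (n i)) = n i" using zB by (rule boundary_depth)
  ultimately have "n i \<le> depth (\<zeta> (n i)) \<and> anc (\<zeta> (n i)) (n i) = v i"
    using anc_depth[of "\<zeta> (n i)"] by simp
  then show False using \<zeta>(1)[of "n i"] unfolding bad_def by blast
qed

lemma mass_tendsto: "(\<lambda>n. mass / real K ^ n) \<longlonglongrightarrow> 0"
proof -
  have "(\<lambda>n. mass * (1 / real K) ^ n) \<longlonglongrightarrow> mass * 0"
    using K2 by (intro tendsto_mult_left LIMSEQ_power_zero) auto
  then show ?thesis by (simp add: power_one_over)
qed

text \<open>
  If the geodesics in \<open>U\<close> separate before a level \<open>m\<close> whose cylinders have mass below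
  \<open>s\<close>, then the last vertex common to all of them works, because \<open>U\<close> has the same
  diameter as its cylinder. If they do not separate before, a cylinder of level \<open>m\<close> works; the slack
  \<open>s\<close> is there for sets with at most one point, which have diameter \<open>0\<close>.
\<close>

lemma subset_in_cyl:
  assumes U: "U \<subseteq> B" and s: "0 < s"
  shows "\<exists>v. U \<subseteq> cyl (depth v) v \<and> ennreal (mass / real K ^ depth v) \<le> epowr (set_diam d U) Q + ennreal s"
proof -
  obtain m where m: "mass / real K ^ m < s"
    using order_tendstoD(2)[OF mass_tendsto s] by (auto simp: eventually_sequentially)
  show ?thesis
  proof (cases "\<exists>v. depth v = m \<and> U \<subseteq> cyl m v")
    case True
    then obtain v where v: "depth v = m" "U \<subseteq> cyl m v" by blast
    have "ennreal (mass / real K ^ m) \<le> epowr (set_diam d U) Q + ennreal s"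
      using m by (intro add_increasing ennreal_leI) auto
    then show ?thesis using v by (intro exI[of _ v]) simp
  next
    case False
    let ?P = "\<lambda>n. \<not> (\<exists>v. depth v = n \<and> U \<subseteq> cyl n v)"
    define n where "n = (LEAST n. ?P n)"
    have Pn: "?P n" unfolding n_def using False by (rule LeastI)
    have "\<not> ?P 0" using U cyl_0 by auto
    then obtain k where k: "n = Suc k" using Pn by (cases n) auto
    then have "\<not> ?P k" using not_less_Least[of k ?P] by (simp add: n_def)
    then obtain v where v: "depth v = k" "U \<subseteq> cyl k v" by blast
    have "U \<noteq> {}"
    proof
      assume "U = {}"
      have "{v. depth v = n} \<noteq> {}" using card_level[of n] K2 by (metis card.empty power_eq_0_iff not_numeral_le_zero)
      then show False using Pn \<open>U = {}\<close> by auto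
    qed
    then obtain x where x: "x \<in> U" by blast
    then have "\<not> U \<subseteq> cyl n (x n)" using Pn U boundary_depth[of x n] by blast
    then obtain y where y: "y \<in> U" "y n \<noteq> x n" using U by (auto simp: cyl_def)
    have "\<tau> k \<le> d x y" using x y U k by (intro d_boundary_ge) auto
    then have "ennreal (\<tau> k) \<le> ennreal (d x y)" by (rule ennreal_leI)
    also have "\<dots> \<le> set_diam d U" unfolding set_diam_def using x y by (auto intro: SUP_upper2)
    finally have "epowr (ennreal (\<tau> k)) Q \<le> epowr (set_diam d U) Q" using Q_pos by (intro epowr_mono) auto
    then have "ennreal (mass / real K ^ k) \<le> epowr (set_diam d U) Q"
      using \<tau>_pos[of k] by (simp add: epowr_ennreal \<tau>_powr less_imp_le)
    then have "ennreal (mass / real K ^ k) \<le> epowr (set_diam d U) Q + ennreal s"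
      by (rule order_trans) simp
    then show ?thesis using v by (intro exI[of _ v]) simp
  qed
qed

lemma H_B_ge: "ennreal mass \<le> H B"
proof -
  have "ennreal mass \<le> hausdorff_premeasure B d Q 1 B"
    unfolding hausdorff_premeasure_def
  proof (rule INF_greatest, clarify)
    fix U :: "nat \<Rightarrow> (nat \<Rightarrow> 'v) set"
    assume U: "B \<subseteq> (\<Union>i. U i)" "\<forall>i. U i \<subseteq> B \<and> set_diam d (U i) \<le> ennreal 1"
    show "ennreal mass \<le> (\<Sum>i. epowr (set_diam d (U i)) Q)"
    proof (rule ennreal_le_epsilon)
      fix s :: real assume s: "0 < s"
      have "\<forall>i. \<exists>v. U i \<subseteq> cyl (depth v) v \<and>
         ennreal (mass / real K ^ depth v) \<le> epowr (set_diam d (U i)) Q + ennreal (s * (1/2) ^ Suc i)"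
        using U(2) s by (intro allI subset_in_cyl) auto
      from choice[OF this] obtain v where v: "\<forall>i. U i \<subseteq> cyl (depth (v i)) (v i) \<and>
         ennreal (mass / real K ^ depth (v i)) \<le> epowr (set_diam d (U i)) Q + ennreal (s * (1/2) ^ Suc i)" ..
      have "B \<subseteq> (\<Union>i. cyl (depth (v i)) (v i))" using U(1) v by blast
      then have "ennreal mass \<le> (\<Sum>i. ennreal (mass / real K ^ depth (v i)))" by (rule cyl_cover_mass) simp
      also have "\<dots> \<le> (\<Sum>i. epowr (set_diam d (U i)) Q + ennreal (s * (1/2) ^ Suc i))"
        using v by (intro suminf_le summableI) blast
      also have "\<dots> = (\<Sum>i. epowr (set_diam d (U i)) Q) + (\<Sum>i. ennreal (s * (1/2) ^ Suc i))"
        by (intro suminf_add[symmetric] summableI)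
      also have "(\<Sum>i. ennreal (s * (1/2) ^ Suc i)) = ennreal s"
        using s sums_mult[OF power_half_series, of s] by (intro suminf_ennreal_eq) auto
      finally show "ennreal mass \<le> (\<Sum>i. epowr (set_diam d (U i)) Q) + ennreal s" .
    qed
  qed
  also have "\<dots> \<le> H B" by (rule hausdorff_premeasure_le_measure) simp
  finally show ?thesis .
qed

lemma H_B: "H B = ennreal mass"
  using H_B_ge H_cyl_le[of 0 r] cyl_0 by (simp add: antisym)

text \<open>
  The upper bounds of the \<open>K ^ n\<close> cylinders of level \<open>n\<close> add up to
  \<open>H B\<close>, hence none of them can be strict.
\<close>

lemma H_cyl: assumes v: "depth v = n" shows "H (cyl n v) = ennreal (mass / real K ^ n)"
proof (rule antisym[OF H_cyl_le])
  let ?L = "{v. depth v = n}"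
  have fin: "finite ?L" by (rule finite_level)
  have "H B = H (\<Union>w\<in>?L. cyl n w)" using arg_cong[OF B_levels[of n], of H] .
  also have "\<dots> \<le> (\<Sum>w\<in>?L. H (cyl n w))"
    by (rule hausdorff_measure_finite_subadditive[OF fin])
  finally have "H B \<le> (\<Sum>w\<in>?L. H (cyl n w))" .
  also have "\<dots> = H (cyl n v) + (\<Sum>w\<in>?L - {v}. H (cyl n w))"
    using fin v by (intro sum.remove) auto
  also have "\<dots> \<le> H (cyl n v) + (\<Sum>w\<in>?L - {v}. ennreal (mass / real K ^ n))"
    by (intro add_left_mono sum_mono H_cyl_le)
  also have "(\<Sum>w\<in>?L - {v}. ennreal (mass / real K ^ n)) = ennreal (real (K ^ n - 1) * (mass / real K ^ n))"
    using v by (simp only: card_times_ennreal card_Diff_singleton[of v ?L] card_level mem_Collect_eq)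
  also have "real (K ^ n - 1) * (mass / real K ^ n) = mass - mass / real K ^ n"
    using K2 by (simp add: of_nat_diff field_simps)
  finally have le: "ennreal mass \<le> H (cyl n v) + ennreal (mass - mass / real K ^ n)" by (simp add: H_B)
  have nn: "0 \<le> mass - mass / real K ^ n"
    using mass_pos K2 by (simp add: field_simps)
  show "ennreal (mass / real K ^ n) \<le> H (cyl n v)"
  proof (cases "H (cyl n v)" rule: ennreal_cases)
    case (real x)
    then have "ennreal mass \<le> ennreal (x + (mass - mass / real K ^ n))" using le nn by (simp only: ennreal_plus)
    then have "mass \<le> x + (mass - mass / real K ^ n)"
      by (rule ennreal_le_iff[THEN iffD1, rotated]) (use real nn in linarith)
    then show ?thesis using real by (auto intro: ennreal_leI)
  qed simp
qed

section \<open>The normalized Hausdorff measure\<close>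

abbreviation \<nu> :: "(nat \<Rightarrow> 'v) measure" where "\<nu> \<equiv> \<nu>_boundary K E r \<epsilon>"

lemma cyl_open: "openin (Metric_space.mtopology B d) (cyl n v)"
proof -
  interpret M: Metric_space B d by (rule Metric_space_boundary)
  show ?thesis unfolding M.openin_mtopology
  proof (intro conjI allI impI cyl_subset)
    fix x assume x: "x \<in> cyl n v"
    have "M.mball x (\<tau> n) \<subseteq> cyl n v" using cyl_separated[OF x] by force
    then show "\<exists>s>0. M.mball x s \<subseteq> cyl n v" using \<tau>_pos by blast
  qed
qed

lemma openin_subset_Pow: "{U. openin (Metric_space.mtopology B d) U} \<subseteq> Pow B"
  using Metric_space.openin_mtopology[OF Metric_space_boundary] by auto

lemma space_metric_borel: "space (metric_borel B d) = B"
  using openin_subset_Pow by (simp add: metric_borel_def space_measure_of)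

lemma cyl_sets: "cyl n v \<in> sets (metric_borel B d)"
  unfolding metric_borel_def using openin_subset_Pow cyl_open by (simp add: sigma_sets.Basic)

text \<open>Balls are cylinders, and there are only countably many cylinders.\<close>

lemma open_Union_cyl:
  assumes U: "openin (Metric_space.mtopology B d) U"
  shows "U = (\<Union>(n, v)\<in>{(n, v). cyl n v \<subseteq> U}. cyl n v)"
proof (intro equalityI subsetI)
  interpret M: Metric_space B d by (rule Metric_space_boundary)
  fix x assume x: "x \<in> U"
  then obtain s where s: "0 < s" "M.mball x s \<subseteq> U" "x \<in> B" using U unfolding M.openin_mtopology by blast
  obtain n where n: "M.mball x s = cyl n (x n)" using ball_eq_cyl[OF s(1)] s(3) by blast
  then have "(n, x n) \<in> {(n, v). cyl n v \<subseteq> U}" "x \<in> cyl n (x n)" using s by (auto simp: cyl_def)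
  then show "x \<in> (\<Union>(n, v)\<in>{(n, v). cyl n v \<subseteq> U}. cyl n v)" by blast
qed auto

text \<open>
  Cylinders are separated from their complements, so they satisfy Caratheodory's criterion; they generate the
  Borel sets.
\<close>

lemma measure_space_H: "measure_space B (sets (metric_borel B d)) H"
proof -
  let ?L = "lambda_system B (Pow B) H"
  have ms: "measure_space B ?L H"
    using sigma_algebra.caratheodory_lemma[OF sigma_algebra_Pow outer_measure_space_hausdorff] .
  then interpret L: sigma_algebra B ?L by (simp add: measure_space_def)
  have cylL: "cyl n v \<in> ?L" for n v
    using cyl_subset cyl_separated \<tau>_pos Q_pos by (rule separated_in_lambda_system)
  have "U \<in> ?L" if "openin (Metric_space.mtopology B d) U" for U
  proof -
    have "countable {(n :: nat, v :: 'v). cyl n v \<subseteq> U}"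
    proof (rule countable_subset)
      show "countable ((UNIV :: nat set) \<times> (UNIV :: 'v set))"
        by (intro countable_SIGMA countable_vertices) simp
    qed simp
    then have "(\<Union>(n, v)\<in>{(n, v). cyl n v \<subseteq> U}. cyl n v) \<in> ?L"
      using cylL by (intro L.countable_UN') auto
    then show ?thesis using open_Union_cyl[OF that] by simp
  qed
  then have "sets (metric_borel B d) \<subseteq> ?L"
    unfolding metric_borel_def using openin_subset_Pow
    by (simp only: sets_measure_of) (intro L.sigma_sets_subset, blast)
  moreover have "sigma_algebra B (sets (metric_borel B d))"
    using sets.sigma_algebra_axioms[of "metric_borel B d"] by (simp add: space_metric_borel)
  ultimately show ?thesis by (intro measure_down[OF ms])
qed

lemma measure_space_\<nu>: "measure_space B (sets (metric_borel B d)) (\<lambda>A. H A / H B)"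
proof -
  have sa: "sigma_algebra B (sets (metric_borel B d))" and pos: "H {} = 0"
    and ca: "countably_additive (sets (metric_borel B d)) H"
    using measure_space_H by (auto simp: measure_space_def)
  then show ?thesis
    unfolding measure_space_def positive_def countably_additive_def by simp
qed

lemma space_\<nu> [simp]: "space \<nu> = B"
  unfolding \<nu>_boundary_def Let_def
  using sets.space_closed[of "metric_borel B d"] by (simp add: space_measure_of space_metric_borel)

lemma sets_\<nu>: "sets \<nu> = sets (metric_borel B d)"
  unfolding \<nu>_boundary_def Let_def
  using sets.space_closed[of "metric_borel B d"] sets.sigma_sets_eq[of "metric_borel B d"]
  by (simp add: sets_measure_of space_metric_borel)

lemma emeasure_\<nu>: "A \<in> sets \<nu> \<Longrightarrow> emeasure \<nu> A = H A / H B"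
  unfolding sets_\<nu>
  unfolding \<nu>_boundary_def Let_def
  using measure_space_\<nu> by (intro emeasure_measure_of_sigma) (auto simp: measure_space_def)

lemma cyl_sets_\<nu> [measurable, simp]: "cyl n v \<in> sets \<nu>"
  by (simp add: sets_\<nu> cyl_sets)

lemma emeasure_cyl: "depth v = n \<Longrightarrow> emeasure \<nu> (cyl n v) = ennreal (1 / real K ^ n)"
  using mass_pos K_pos by (simp add: emeasure_\<nu> H_cyl H_B divide_ennreal)

lemma emeasure_B: "emeasure \<nu> B = 1"
  using emeasure_cyl[of r 0] cyl_0 by simp

section \<open>Integrals of functions of one vertex\<close>

lemma cylinder_function_eq:
  fixes h :: "'v \<Rightarrow> ennreal"
  assumes "\<zeta> \<in> B" shows "h (\<zeta> n) = (\<Sum>v\<in>{v. depth v = n}. h v * indicator (cyl n v) \<zeta>)"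
proof -
  have "(\<Sum>v\<in>{v. depth v = n}. h v * indicator (cyl n v) \<zeta>) = (\<Sum>v\<in>{v. depth v = n}. if v = \<zeta> n then h v else 0)"
    using assms by (intro sum.cong) (auto simp: cyl_def indicator_def)
  then show ?thesis using finite_level boundary_depth[OF assms, of n] by (simp add: sum.delta')
qed

lemma cylinder_measurable: "(\<lambda>\<zeta>. \<zeta> n) \<in> measurable \<nu> (count_space UNIV)"
proof (rule measurable_count_space_eq_countable[THEN iffD2])
  show "countable (UNIV :: 'v set)" by (rule countable_vertices)
  show "(\<lambda>\<zeta>. \<zeta> n) \<in> space \<nu> \<rightarrow> UNIV \<and> (\<forall>a\<in>UNIV. (\<lambda>\<zeta>. \<zeta> n) -` {a} \<inter> space \<nu> \<in> sets \<nu>)"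
  proof (intro conjI ballI)
    fix a
    have "(\<lambda>\<zeta>. \<zeta> n) -` {a} \<inter> space \<nu> = cyl n a" by (auto simp: cyl_def)
    then show "(\<lambda>\<zeta>. \<zeta> n) -` {a} \<inter> space \<nu> \<in> sets \<nu>" by simp
  qed simp
qed

lemma step_measurable [measurable]: "(\<lambda>\<zeta>. h (\<zeta> n)) \<in> measurable \<nu> borel"
  using measurable_compose[OF cylinder_measurable, of h borel n] by simp

lemma nn_integral_cylinder:
  fixes h :: "'v \<Rightarrow> ennreal"
  assumes [measurable]: "f \<in> borel_measurable \<nu>"
  shows "(\<integral>\<^sup>+ \<zeta>. h (\<zeta> n) * f \<zeta> \<partial>\<nu>) = (\<Sum>v\<in>{v. depth v = n}. h v * (\<integral>\<^sup>+ \<zeta>. f \<zeta> * indicator (cyl n v) \<zeta> \<partial>\<nu>))"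
proof -
  have "(\<integral>\<^sup>+ \<zeta>. h (\<zeta> n) * f \<zeta> \<partial>\<nu>) =
    (\<integral>\<^sup>+ \<zeta>. (\<Sum>v\<in>{v. depth v = n}. h v * (f \<zeta> * indicator (cyl n v) \<zeta>)) \<partial>\<nu>)"
    by (intro nn_integral_cong) (simp add: cylinder_function_eq sum_distrib_left ac_simps)
  also have "\<dots> = (\<Sum>v\<in>{v. depth v = n}. h v * (\<integral>\<^sup>+ \<zeta>. f \<zeta> * indicator (cyl n v) \<zeta> \<partial>\<nu>))"
    by (subst nn_integral_sum) (auto simp: nn_integral_cmult)
  finally show ?thesis .
qed

lemma nn_integral_step:
  fixes h :: "'v \<Rightarrow> ennreal"
  shows "(\<integral>\<^sup>+ \<zeta>. h (\<zeta> n) \<partial>\<nu>) = (\<Sum>v\<in>{v. depth v = n}. h v) * ennreal (1 / real K ^ n)"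
  using nn_integral_cylinder[of "\<lambda>_. 1" h n] by (simp add: emeasure_cyl sum_distrib_right)

end

section \<open>Integral inequalities\<close>

text \<open>
  The graph of the \<open>p\<close>-th power lies above its tangent at \<open>c\<close>; this is Young's
  inequality for \<open>a powr p\<close> and \<open>c powr p\<close>.
\<close>

lemma tangent_powr:
  fixes a c p :: real
  assumes "0 \<le> a" "0 < c" "1 \<le> p"
  shows "p * c powr (p - 1) * a \<le> a powr p + (p - 1) * c powr p"
proof (cases "a = 0")
  case False
  then have "(a powr p) powr (1 / p) * (c powr p) powr (1 - 1 / p) \<le> 1 / p * a powr p + (1 - 1 / p) * c powr p"
    using assms by (intro Youngs_inequality_0) auto
  moreover have "(a powr p) powr (1 / p) = a" using assms by (simp add: powr_powr)
  moreover have "p * (1 - 1 / p) = p - 1" using assms by (simp add: field_simps)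
  then have "(c powr p) powr (1 - 1 / p) = c powr (p - 1)" by (simp add: powr_powr)
  ultimately have "a * c powr (p - 1) \<le> 1 / p * a powr p + (1 - 1 / p) * c powr p" by simp
  then have "p * (a * c powr (p - 1)) \<le> p * (1 / p * a powr p + (1 - 1 / p) * c powr p)"
    using assms by (intro mult_left_mono) auto
  then show ?thesis using assms by (simp add: algebra_simps)
qed (use assms in simp)

lemma tangent_epowr:
  assumes c: "0 < c" and p: "1 \<le> p"
  shows "ennreal (p * c powr (p - 1)) * h \<le> epowr h p + ennreal ((p - 1) * c powr p)"
proof (cases h rule: ennreal_cases)
  case (real a)
  have "ennreal (p * c powr (p - 1)) * h = ennreal (p * c powr (p - 1) * a)"
    using real p by (simp add: ennreal_mult)
  also have "\<dots> \<le> ennreal (a powr p + (p - 1) * c powr p)"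
    using real c p by (intro ennreal_leI tangent_powr)
  also have "\<dots> = epowr h p + ennreal ((p - 1) * c powr p)"
    using real p by (simp add: epowr_ennreal)
  finally show ?thesis .
qed simp

text \<open>The tangent inequality at the mean value \<open>c\<close> is integrated.\<close>

lemma jensen_epowr:
  fixes w h :: "'a \<Rightarrow> ennreal"
  assumes [measurable]: "w \<in> borel_measurable M" "h \<in> borel_measurable M"
    and w1: "(\<integral>\<^sup>+ x. w x \<partial>M) = 1" and p: "1 \<le> p"
  shows "epowr (\<integral>\<^sup>+ x. w x * h x \<partial>M) p \<le> (\<integral>\<^sup>+ x. w x * epowr (h x) p \<partial>M)"
proof -
  let ?I = "\<integral>\<^sup>+ x. w x * epowr (h x) p \<partial>M"
  have tangent: "ennreal (p * c powr (p - 1)) * (\<integral>\<^sup>+ x. w x * h x \<partial>M) \<le> ?I + ennreal ((p - 1) * c powr p)"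
    if c: "0 < c" for c
  proof -
    have "ennreal (p * c powr (p - 1)) * (\<integral>\<^sup>+ x. w x * h x \<partial>M) =
      (\<integral>\<^sup>+ x. w x * (ennreal (p * c powr (p - 1)) * h x) \<partial>M)"
      by (subst nn_integral_cmult[symmetric]) (auto simp: ac_simps)
    also have "\<dots> \<le> (\<integral>\<^sup>+ x. w x * epowr (h x) p + ennreal ((p - 1) * c powr p) * w x \<partial>M)"
    proof (rule nn_integral_mono)
      fix x
      have "w x * (ennreal (p * c powr (p - 1)) * h x) \<le> w x * (epowr (h x) p + ennreal ((p - 1) * c powr p))"
        using tangent_epowr[OF c p] by (intro mult_left_mono) auto
      then show "w x * (ennreal (p * c powr (p - 1)) * h x) \<le> w x * epowr (h x) p + ennreal ((p - 1) * c powr p) * w x"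
        by (simp add: distrib_left ac_simps)
    qed
    also have "\<dots> = ?I + ennreal ((p - 1) * c powr p)"
      by (subst nn_integral_add) (auto simp: nn_integral_cmult w1)
    finally show ?thesis .
  qed
  show ?thesis
  proof (cases "\<integral>\<^sup>+ x. w x * h x \<partial>M" rule: ennreal_cases)
    case (real c)
    show ?thesis
    proof (cases "c = 0")
      case False
      then have c: "0 < c" using real by simp
      have "c powr (p - 1) * c = c powr p" using c powr_add[of c "p - 1" 1] by simp
      then have pc: "p * c powr (p - 1) * c = c powr p + (p - 1) * c powr p" by (simp add: algebra_simps)
      have "ennreal (c powr p) + ennreal ((p - 1) * c powr p) = ennreal (c powr p + (p - 1) * c powr p)"
        by (rule ennreal_plus[symmetric]) (use p in auto)
      also have "\<dots> = ennreal (p * c powr (p - 1)) * ennreal c"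
        unfolding pc[symmetric] by (rule ennreal_mult) (use p c in auto)
      also have "\<dots> \<le> ?I + ennreal ((p - 1) * c powr p)" using tangent[OF c] real by simp
      finally have "ennreal (c powr p) \<le> ?I"
        by (simp add: ennreal_add_left_cancel_le add.commute)
      then show ?thesis using real by (simp add: epowr_ennreal)
    qed (use real in simp)
  next
    case top
    \<comment> \<open>any tangent will do when the mean is infinite\<close>
    then have "top \<le> ?I + ennreal (p - 1)" using tangent[of 1] p by (simp add: ennreal_mult_top)
    then show ?thesis by (simp add: top_unique)
  qed
qed

text \<open>
  Jensen's inequality for the probability weights \<open>w j = (1 - q) * q ^ j\<close>, applied to
  \<open>x j / w j\<close>.
\<close>

lemma sum_powr_le:
  fixes x :: "nat \<Rightarrow> ennreal"
  assumes q: "0 < q" "q < 1" and p: "1 \<le> p"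
  shows "epowr (\<Sum>j. x j) p \<le> ennreal ((1 - q) powr (1 - p)) * (\<Sum>j. ennreal ((q ^ j) powr (1 - p)) * epowr (x j) p)"
proof -
  define w where "w j = (1 - q) * q ^ j" for j :: nat
  have w: "0 < w j" for j using q by (simp add: w_def)
  have "(\<lambda>j. (1 - q) * q ^ j) sums ((1 - q) * (1 / (1 - q)))"
    using q by (intro sums_mult geometric_sums) simp
  then have "(\<Sum>j. ennreal (w j)) = 1"
    using q w unfolding w_def[symmetric] by (subst suminf_ennreal_eq[where x = 1]) (auto intro: less_imp_le)
  then have "epowr (\<integral>\<^sup>+ j. ennreal (w j) * (ennreal (1 / w j) * x j) \<partial>count_space UNIV) p
    \<le> (\<integral>\<^sup>+ j. ennreal (w j) * epowr (ennreal (1 / w j) * x j) p \<partial>count_space UNIV)"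
    using p by (intro jensen_epowr) (auto simp: nn_integral_count_space_nat)
  moreover have "ennreal (w j) * (ennreal (1 / w j) * x j) = x j" for j
    using w[of j] by (simp add: mult.assoc[symmetric] flip: ennreal_mult)
  moreover have "ennreal (w j) * epowr (ennreal (1 / w j) * x j) p =
    ennreal ((1 - q) powr (1 - p)) * (ennreal ((q ^ j) powr (1 - p)) * epowr (x j) p)" for j
  proof -
    have "ennreal (w j) * epowr (ennreal (1 / w j) * x j) p = ennreal (w j * (1 / w j) powr p) * epowr (x j) p"
      using p w[of j] by (simp add: epowr_mult epowr_ennreal mult.assoc[symmetric] ennreal_mult)
    also have "w j * (1 / w j) powr p = w j powr (1 - p)"
      using w[of j] by (simp add: powr_diff powr_divide)
    also have "\<dots> = (1 - q) powr (1 - p) * (q ^ j) powr (1 - p)"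
      using q by (simp add: w_def powr_mult)
    finally show ?thesis by (simp add: ennreal_mult mult.assoc)
  qed
  ultimately show ?thesis by (simp add: nn_integral_count_space_nat)
qed

lemma epowr_add_le:
  assumes p: "1 \<le> p" shows "epowr (a + b) p \<le> ennreal (2 powr p) * (epowr a p + epowr b p)"
proof -
  have "a + b \<le> ennreal 2 * max a b"
    by (cases a b rule: linorder_cases) (auto simp: mult_2 add_mono)
  then have "epowr (a + b) p \<le> epowr (ennreal 2 * max a b) p"
    using p by (intro epowr_mono) auto
  also have "\<dots> = ennreal (2 powr p) * epowr (max a b) p"
    using p by (simp only: epowr_mult epowr_ennreal)
  also have "\<dots> \<le> ennreal (2 powr p) * (epowr a p + epowr b p)"
    by (intro mult_left_mono) (auto simp: max_def add_increasing add_increasing2)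
  finally show ?thesis .
qed

text \<open>
  Jensen's inequality for the two weights \<open>A / (A + B)\<close> and \<open>B / (A + B)\<close>. With
  \<open>A\<close> and \<open>B\<close> the norms of \<open>u\<close> and \<open>h\<close> it integrates to
  Minkowski's inequality.
\<close>

lemma epowr_add_weighted:
  assumes A: "0 < A" and B: "0 < B" and p: "1 \<le> p"
  shows "epowr (u + h) p \<le> ennreal ((A + B) powr p) *
    (ennreal (A / (A + B) * A powr - p) * epowr u p + ennreal (B / (A + B) * B powr - p) * epowr h p)"
proof -
  define w where "w b = (if b then A / (A + B) else B / (A + B))" for b
  define y where "y b = (if b then ennreal (1 / A) * u else ennreal (1 / B) * h)" for b
  have w1: "(\<integral>\<^sup>+ b. ennreal (w b) \<partial>count_space UNIV) = 1"
    using A B by (simp add: nn_integral_count_space_finite UNIV_bool w_def flip: ennreal_plus add_divide_distrib)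
  have J: "epowr (\<Sum>b\<in>UNIV. ennreal (w b) * y b) p \<le> (\<Sum>b\<in>UNIV. ennreal (w b) * epowr (y b) p)"
    using jensen_epowr[of "\<lambda>b. ennreal (w b)" "count_space UNIV" y p] w1 p
    by (simp add: nn_integral_count_space_finite)
  have *: "ennreal s * (ennreal a * (ennreal a' * u) + ennreal b * (ennreal b' * h)) =
      ennreal (s * a * a') * u + ennreal (s * b * b') * h"
    if "0 \<le> s" "0 \<le> a" "0 \<le> a'" "0 \<le> b" "0 \<le> b'" for s a a' b b'
    using that by (simp add: ennreal_mult distrib_left mult.assoc)
  have "(\<Sum>b\<in>UNIV. ennreal (w b) * y b) =
      ennreal (A / (A + B)) * (ennreal (1 / A) * u) + ennreal (B / (A + B)) * (ennreal (1 / B) * h)"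
    by (simp add: UNIV_bool w_def y_def add.commute)
  then have "ennreal (A + B) * (\<Sum>b\<in>UNIV. ennreal (w b) * y b) =
    ennreal ((A + B) * (A / (A + B)) * (1 / A)) * u + ennreal ((A + B) * (B / (A + B)) * (1 / B)) * h"
    using A B by (simp only:) (intro *, auto)
  also have "\<dots> = u + h" using A B by simp
  finally have "epowr (u + h) p = epowr (ennreal (A + B) * (\<Sum>b\<in>UNIV. ennreal (w b) * y b)) p" by simp
  also have "\<dots> = ennreal ((A + B) powr p) * epowr (\<Sum>b\<in>UNIV. ennreal (w b) * y b) p"
  proof -
    have "epowr (ennreal (A + B)) p = ennreal ((A + B) powr p)"
      by (rule epowr_ennreal) (use A B in simp)
    then show ?thesis using p by (simp only: epowr_mult)
  qed
  also have "\<dots> \<le> ennreal ((A + B) powr p) * (\<Sum>b\<in>UNIV. ennreal (w b) * epowr (y b) p)"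
    using J by (rule mult_left_mono) simp
  also have "(\<Sum>b\<in>UNIV. ennreal (w b) * epowr (y b) p) =
    ennreal (A / (A + B) * A powr - p) * epowr u p + ennreal (B / (A + B) * B powr - p) * epowr h p"
    using A B p by (simp add: UNIV_bool w_def y_def epowr_mult epowr_ennreal powr_divide powr_minus_divide
        ennreal_mult mult.assoc[symmetric] add.commute flip: ennreal_mult)
  finally show ?thesis .
qed

lemma minkowski_epowr:
  fixes u h :: "'a \<Rightarrow> ennreal"
  assumes [measurable]: "u \<in> borel_measurable M" "h \<in> borel_measurable M"
    and A: "0 < A" and B: "0 < B" and p: "1 \<le> p"
    and u: "(\<integral>\<^sup>+ x. epowr (u x) p \<partial>M) \<le> ennreal (A powr p)"
    and h: "(\<integral>\<^sup>+ x. epowr (h x) p \<partial>M) \<le> ennreal (B powr p)"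
  shows "(\<integral>\<^sup>+ x. epowr (u x + h x) p \<partial>M) \<le> ennreal ((A + B) powr p)"
proof -
  let ?a = "A / (A + B) * A powr - p" and ?b = "B / (A + B) * B powr - p"
  have "(\<integral>\<^sup>+ x. epowr (u x + h x) p \<partial>M) \<le>
    (\<integral>\<^sup>+ x. ennreal ((A + B) powr p) * (ennreal ?a * epowr (u x) p + ennreal ?b * epowr (h x) p) \<partial>M)"
    by (intro nn_integral_mono epowr_add_weighted A B p)
  also have "\<dots> = ennreal ((A + B) powr p) *
     (ennreal ?a * (\<integral>\<^sup>+ x. epowr (u x) p \<partial>M) + ennreal ?b * (\<integral>\<^sup>+ x. epowr (h x) p \<partial>M))"
    by (simp add: nn_integral_cmult nn_integral_add)
  also have "\<dots> \<le> ennreal ((A + B) powr p) * (ennreal ?a * ennreal (A powr p) + ennreal ?b * ennreal (B powr p))"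
    by (intro mult_left_mono add_mono u h) auto
  also have "\<dots> = ennreal ((A + B) powr p * (?a * A powr p + ?b * B powr p))"
  proof -
    have *: "ennreal s * (ennreal a * ennreal a' + ennreal b * ennreal b') = ennreal (s * (a * a' + b * b'))"
      if "0 \<le> s" "0 \<le> a" "0 \<le> a'" "0 \<le> b" "0 \<le> b'" for s a a' b b'
      using that by (simp add: ennreal_mult)
    show ?thesis using A B by (intro *) auto
  qed
  also have "?a * A powr p + ?b * B powr p = 1"
  proof -
    have "A powr - p * A powr p = 1" "B powr - p * B powr p = 1"
      using A B by (simp_all add: powr_minus)
    then have "?a * A powr p + ?b * B powr p = A / (A + B) + B / (A + B)"
      by (simp only: mult.assoc mult_1_right)
    then show ?thesis using A B by (simp add: add_divide_distrib[symmetric])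
  qed
  finally show ?thesis by simp
qed

lemma Lp_norm_powr: "0 < p \<Longrightarrow> epowr (Lp_norm M p h) p = (\<integral>\<^sup>+ x. epowr (h x) p \<partial>M)"
  by (simp add: Lp_norm_def epowr_epowr)

lemma epowr_inverse_le_iff: "0 < p \<Longrightarrow> epowr a (1 / p) \<le> b \<longleftrightarrow> a \<le> epowr b p"
proof
  assume p: "0 < p"
  show "a \<le> epowr b p" if "epowr a (1 / p) \<le> b"
    using epowr_mono[OF that, of p] p by (simp add: epowr_epowr)
  show "epowr a (1 / p) \<le> b" if "a \<le> epowr b p"
    using epowr_mono[OF that, of "1 / p"] p by (simp add: epowr_epowr)
qed

text \<open>
  The norms are increased by \<open>e / 2\<close> to make them positive, as the weights require.
\<close>

lemma minkowski_Lp_norm: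
  fixes u h :: "'a \<Rightarrow> ennreal"
  assumes [measurable]: "u \<in> borel_measurable M" "h \<in> borel_measurable M" and p: "1 \<le> p"
  shows "Lp_norm M p (\<lambda>x. u x + h x) \<le> Lp_norm M p u + Lp_norm M p h"
proof (rule ennreal_le_epsilon)
  fix e :: real assume fin: "Lp_norm M p u + Lp_norm M p h < top" and e: "0 < e"
  then obtain A B where A: "Lp_norm M p u = ennreal A" "0 \<le> A" and B: "Lp_norm M p h = ennreal B" "0 \<le> B"
    by (cases "Lp_norm M p u" rule: ennreal_cases; cases "Lp_norm M p h" rule: ennreal_cases) auto
  have "(\<integral>\<^sup>+ x. epowr (u x) p \<partial>M) \<le> ennreal ((A + e / 2) powr p)"
    using Lp_norm_powr[of p M u] p A e by (simp add: epowr_ennreal powr_mono2 flip: Lp_norm_powr)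
  moreover have "(\<integral>\<^sup>+ x. epowr (h x) p \<partial>M) \<le> ennreal ((B + e / 2) powr p)"
    using Lp_norm_powr[of p M h] p B e by (simp add: epowr_ennreal powr_mono2 flip: Lp_norm_powr)
  ultimately have "(\<integral>\<^sup>+ x. epowr (u x + h x) p \<partial>M) \<le> ennreal ((A + e / 2 + (B + e / 2)) powr p)"
    using A B e p by (intro minkowski_epowr) auto
  also have "A + e / 2 + (B + e / 2) = A + B + e" by simp
  finally have "(\<integral>\<^sup>+ x. epowr (u x + h x) p \<partial>M) \<le> ennreal ((A + B + e) powr p)" .
  then have "Lp_norm M p (\<lambda>x. u x + h x) \<le> ennreal (A + B + e)"
  proof -
    have "ennreal ((A + B + e) powr p) = epowr (ennreal (A + B + e)) p"
      by (rule epowr_ennreal[symmetric]) (use A B e in linarith)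
    moreover have "0 < p" using p by simp
    ultimately show ?thesis
      using \<open>_ \<le> ennreal ((A + B + e) powr p)\<close> unfolding Lp_norm_def by (simp only: epowr_inverse_le_iff)
  qed
  then show "Lp_norm M p (\<lambda>x. u x + h x) \<le> Lp_norm M p u + Lp_norm M p h + ennreal e"
    using A B e by (simp add: ennreal_plus)
qed

section \<open>Upper gradients on edges\<close>

context uniformized_tree begin

lemma d_X_edge_le:
  assumes v: "v \<noteq> r" and s: "0 \<le> s" "s < 1" and t: "0 \<le> t" "t < 1"
  shows "d_X E r \<epsilon> (v, s) (v, t) \<le> \<bar>s - t\<bar>"
proof -
  have *: "d_X E r \<epsilon> (v, s) (v, t) \<le> t - s" if s: "0 \<le> s" "s < 1" and t: "0 \<le> t" "t < 1" and st: "s \<le> t" for s t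
  proof -
    have T: "(v, s) \<in> T" "(v, t) \<in> T" using v s t by (auto simp: edge_in_T)
    let ?L = "real (depth v) - t"
    have L: "0 \<le> ?L" using depth_pos[OF v] t by linarith
    have g: "gp (v, s) (v, t) = ?L" using st s t by (simp add: gp_def lv_def)
    have "d_X E r \<epsilon> (v, s) (v, t) = (exp (- \<epsilon> * ?L) - exp (- \<epsilon> * (real (depth v) - s))) / \<epsilon>"
      unfolding d_X_eq[OF T eps] g by (simp add: lv_def)
    also have "exp (- \<epsilon> * (real (depth v) - s)) = exp (- \<epsilon> * ?L) * exp (- \<epsilon> * (t - s))"
      by (simp add: exp_add[symmetric] algebra_simps)
    also have "exp (- \<epsilon> * ?L) - exp (- \<epsilon> * ?L) * exp (- \<epsilon> * (t - s)) =
       exp (- \<epsilon> * ?L) * (1 - exp (- \<epsilon> * (t - s)))" by (simp add: algebra_simps)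
    also have "\<dots> \<le> 1 * (\<epsilon> * (t - s))"
    proof (rule mult_mono)
      show "exp (- \<epsilon> * ?L) \<le> 1" using L eps by simp
      show "1 - exp (- \<epsilon> * (t - s)) \<le> \<epsilon> * (t - s)" using exp_ge_add_one_self[of "- \<epsilon> * (t - s)"] by linarith
      show "0 \<le> 1 - exp (- \<epsilon> * (t - s))" using st eps by simp
    qed simp
    finally show ?thesis using eps by (simp add: divide_right_mono)
  qed
  show ?thesis
  proof (cases "s \<le> t")
    case True then show ?thesis using *[OF s t] by simp
  next
    case False then show ?thesis using *[OF t s] d_X_commute[of \<epsilon> "(v, s)"] by simp
  qed
qed

text \<open>
  By \<open>d_X_edge_le\<close> the inclusion of an edge is continuous, so Borel functions for \<open>d_X\<close>
  restrict to Borel functions on the edges. This makes upper gradients measurable for the length measure.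
\<close>

lemma edge_measurable:
  assumes v: "v \<noteq> r"
  shows "Pair v \<in> measurable (restrict_space borel {0..<1}) (metric_borel T (d_X E r \<epsilon>))"
proof -
  interpret M: Metric_space T "d_X E r \<epsilon>" by (rule Metric_space_tree)
  have sub: "{U. openin M.mtopology U} \<subseteq> Pow T" by (auto simp: M.openin_mtopology)
  show ?thesis unfolding metric_borel_def
  proof (rule measurable_measure_of[OF sub])
    show "Pair v \<in> space (restrict_space borel {0..<1}) \<rightarrow> T"
      using v by (auto simp: space_restrict_space edge_in_T)
    fix U assume "U \<in> {U. openin M.mtopology U}"
    then have U: "U \<subseteq> T" "\<And>x. x \<in> U \<Longrightarrow> \<exists>s>0. M.mball x s \<subseteq> U" unfolding M.openin_mtopology by blast+
    let ?W = "{t \<in> {0..<1}. (v, t) \<in> U}"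
    have "openin (top_of_set {0..<1}) ?W"
      unfolding openin_euclidean_subtopology_iff
    proof (intro conjI ballI)
      fix t assume t: "t \<in> ?W"
      then obtain s where s: "0 < s" "M.mball (v, t) s \<subseteq> U" using U by blast
      have "t' \<in> ?W" if t': "t' \<in> {0..<1}" "dist t' t < s" for t'
      proof -
        have "d_X E r \<epsilon> (v, t) (v, t') < s"
          using d_X_edge_le[OF v, of t t'] t t' by (simp add: dist_real_def abs_minus_commute)
        then have "(v, t') \<in> M.mball (v, t) s" using t t' v by (simp add: edge_in_T)
        then show ?thesis using s t' by blast
      qed
      then show "\<exists>e>0. \<forall>x'\<in>{0..<1}. dist x' t < e \<longrightarrow> x' \<in> ?W" using s by blast
    qed auto
    then obtain V where V: "open V" "?W = {0..<1} \<inter> V" by (auto simp: openin_open)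
    have "Pair v -` U \<inter> space (restrict_space borel {0..<1}) = {0..<1} \<inter> V"
      unfolding V(2)[symmetric] by (auto simp: space_restrict_space)
    then show "Pair v -` U \<inter> space (restrict_space borel {0..<1}) \<in> sets (restrict_space borel {0..<1})"
      using V by (simp add: sets_restrict_space_iff)
  qed
qed

lemma upper_gradient_measurable_edge:
  assumes g: "upper_gradient E r \<epsilon> f g" and v: "v \<noteq> r"
  shows "(\<lambda>t. g (v, t) * indicator {0..<1} t) \<in> borel_measurable lborel"
proof -
  have "g \<in> borel_measurable (metric_borel T (d_X E r \<epsilon>))" using g by (simp add: upper_gradient_def)
  then have "(\<lambda>t. g (v, t)) \<in> borel_measurable (restrict_space borel {0..<1})"
    by (rule measurable_compose[OF edge_measurable[OF v]])
  then show ?thesis by (simp add: borel_measurable_restrict_space_iff_ennreal)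
qed

lemma measurable_edgewise:
  fixes g :: "'v point \<Rightarrow> ennreal"
  assumes g: "\<And>v. v \<noteq> r \<Longrightarrow> (\<lambda>t. g (v, t) * indicator {0..<1} t) \<in> borel_measurable lborel"
    and [measurable]: "\<phi> \<in> borel_measurable borel"
  shows "(\<lambda>z. epowr (g z) p * ennreal (\<phi> (lv z))) \<in> borel_measurable (length_measure r)"
proof (rule measurable_lengthI)
  fix v assume v: "v \<noteq> r"
  note [measurable] = g[OF v]
  have "(\<lambda>t. epowr (g (v, t)) p * ennreal (\<phi> (lv (v, t))) * indicator {0..<1} t) =
    (\<lambda>t. epowr (g (v, t) * indicator {0..<1} t) p * (ennreal (\<phi> (real (depth v) - t)) * indicator {0..<1} t))"
    by (auto simp: indicator_def lv_def)
  then show "(\<lambda>t. epowr (g (v, t)) p * ennreal (\<phi> (lv (v, t))) * indicator {0..<1} t) \<in> borel_measurable lborel"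
    by simp
qed

definition edge_int :: "('v point \<Rightarrow> ennreal) \<Rightarrow> 'v \<Rightarrow> ennreal" where
  "edge_int g v = (\<integral>\<^sup>+ t. g (v, t) * ennreal (exp (- \<epsilon> * (real (depth v) - t))) * indicator {0..<1} t \<partial>lborel)"

text \<open>Apart from its upper end, the geodesic stays on the edge.\<close>

lemma AE_geodesic_edge:
  assumes v: "v \<noteq> r" and t: "0 \<le> t" "t < 1"
  shows "AE z in length_measure r. z \<in> geodesic E r (v, t) (par v, 0) \<longrightarrow> fst z = v"
  using AE_lv_neq[of "real (depth v) - 1"] AE_space
proof eventually_elim
  case (elim z)
  have x: "(v, t) \<in> T" using v t by (simp add: edge_in_T)
  have dp: "real (depth (par v)) = real (depth v) - 1" using depth_pos[OF v] by (simp add: depth_par of_nat_diff)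
  have m: "meet v (par v) = depth v - 1" using meet_par[of v v] meet_sym[of v "par v"] by simp
  have gp: "gp (v, t) (par v, 0) = real (depth v) - 1"
    using t depth_pos[OF v] by (simp add: gp_def lv_def dp m of_nat_diff)
  have "fst z = v" if z: "z \<in> geodesic E r (v, t) (par v, 0)"
  proof -
    have ge: "real (depth v) - 1 < lv z" and or: "gp (v, t) z = lv z \<or> gp (par v, 0) z = lv z"
      using z elim unfolding geodesic_eq[OF x vertex_in_T] gp by (auto simp: seg_def)
    have "gp (v, t) z = lv z" using or ge gp_le(1)[of "(par v, 0)" z] dp by auto
    then have l: "lv z \<le> real (meet v (fst z))" by (auto simp: gp_def)
    have "lv z \<le> real (depth (fst z))" using elim lv_bounds[of z] by simp
    then have "depth v \<le> meet v (fst z)" using ge l by linarith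
    moreover have "depth (fst z) \<le> meet v (fst z)"
      using l elim lv_bounds[of z] by simp
    ultimately have "meet v (fst z) = depth v" "depth (fst z) = depth v"
      using meet_le[of v "fst z"] by linarith+
    then show ?thesis by (rule meet_depth_eq[symmetric])
  qed
  then show ?case by blast
qed

lemma upper_gradient_edge:
  assumes g: "upper_gradient E r \<epsilon> f g" and v: "v \<noteq> r" and t: "0 \<le> t" "t < 1"
  shows "ennreal \<bar>f (v, t) - f (par v, 0)\<bar> \<le> edge_int g v"
proof -
  let ?e = "\<lambda>z. g z * ennreal (exp (- \<epsilon> * lv z)) * indicator {z. fst z = v} z"
  have x: "(v, t) \<in> T" using v t by (simp add: edge_in_T)
  have meas: "?e \<in> borel_measurable (length_measure r)"
  proof (rule measurable_lengthI)
    fix w assume w: "w \<noteq> r"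
    note [measurable] = upper_gradient_measurable_edge[OF g w]
    have "(\<lambda>t. ?e (w, t) * indicator {0..<1} t) =
      (\<lambda>t. g (w, t) * indicator {0..<1} t * (ennreal (exp (- \<epsilon> * (real (depth w) - t))) * of_bool (w = v)))"
      by (auto simp: indicator_def lv_def)
    moreover have "\<dots> \<in> borel_measurable lborel" by measurable
    ultimately show "(\<lambda>t. ?e (w, t) * indicator {0..<1} t) \<in> borel_measurable lborel" by (simp only:)
  qed
  have "ennreal \<bar>f (v, t) - f (par v, 0)\<bar> \<le>
    (\<integral>\<^sup>+ z\<in>geodesic E r (v, t) (par v, 0). g z * ennreal (exp (- \<epsilon> * level E r z)) \<partial>length_measure r)"
    using g x unfolding upper_gradient_def by simp
  also have "\<dots> \<le> (\<integral>\<^sup>+ z. ?e z \<partial>length_measure r)"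
  proof (rule nn_integral_mono_AE)
    show "AE z in length_measure r. g z * ennreal (exp (- \<epsilon> * level E r z)) * indicator (geodesic E r (v, t) (par v, 0)) z \<le> ?e z"
      using AE_geodesic_edge[OF v t] AE_space
    proof eventually_elim
      case (elim z)
      then show ?case by (cases "z \<in> geodesic E r (v, t) (par v, 0)") (simp_all add: level_eq)
    qed
  qed
  also have "\<dots> = (\<integral>\<^sup>+ w. (if w = r then 0 else \<integral>\<^sup>+ t. ?e (w, t) * indicator {0..<1} t \<partial>lborel) \<partial>count_space UNIV)"
    by (rule nn_integral_length[OF meas])
  also have "\<dots> = (\<integral>\<^sup>+ w. edge_int g v * indicator {v} w \<partial>count_space UNIV)"
    using v by (intro nn_integral_cong) (auto simp: edge_int_def lv_def indicator_def)
  also have "\<dots> = edge_int g v" by (simp add: nn_integral_cmult)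
  finally show ?thesis .
qed

end

section \<open>The trace and the geometric ratio\<close>

definition trace :: "('v point \<Rightarrow> real) \<Rightarrow> (nat \<Rightarrow> 'v) \<Rightarrow> real" where
  "trace f \<zeta> = lim (\<lambda>n. f (\<zeta> n, 0))"

text \<open>Tonelli's theorem for two counting measures.\<close>

lemma suminf_swap_ennreal:
  fixes f :: "nat \<Rightarrow> nat \<Rightarrow> ennreal"
  shows "(\<Sum>n. \<Sum>j. f n j) = (\<Sum>j. \<Sum>n. f n j)"
proof -
  have "(\<integral>\<^sup>+ n. (\<Sum>j. f n j) \<partial>count_space UNIV) = (\<Sum>j. \<integral>\<^sup>+ n. f n j \<partial>count_space UNIV)"
    by (rule nn_integral_suminf) simp
  then show ?thesis by (simp add: nn_integral_count_space_nat)
qed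

text \<open>
  Used to pass from a bound for every upper gradient to the infimum in the Newtonian norm.
\<close>

lemma le_INF_affine:
  fixes X J :: ennreal and I :: "'a \<Rightarrow> ennreal"
  assumes c: "0 < c" and le: "\<And>g. g \<in> A \<Longrightarrow> X \<le> ennreal c * (J + I g)"
  shows "X \<le> ennreal c * (J + (INF g\<in>A. I g))"
proof (cases "(INF g\<in>A. I g) = \<infinity>")
  case True
  then show ?thesis using c by (simp add: ennreal_mult_top)
next
  case False
  show ?thesis
  proof (rule ennreal_le_epsilon)
    fix e :: real assume e: "0 < e"
    then obtain g where g: "g \<in> A" "I g < (INF g\<in>A. I g) + ennreal (e / c)"
      using INF_approx_ennreal[OF _ refl False, of "e / c"] c by auto
    have "X \<le> ennreal c * (J + I g)" using le[OF g(1)] .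
    also have "\<dots> \<le> ennreal c * (J + ((INF g\<in>A. I g) + ennreal (e / c)))"
      using g(2) by (intro mult_left_mono add_left_mono) auto
    also have "\<dots> = ennreal c * (J + (INF g\<in>A. I g)) + ennreal c * ennreal (e / c)"
      by (simp add: distrib_left add.assoc)
    also have "ennreal c * ennreal (e / c) = ennreal e"
      using c e by (simp flip: ennreal_mult)
    finally show "X \<le> ennreal c * (J + (INF g\<in>A. I g)) + ennreal e" .
  qed
qed

locale trace_setting = uniformized_tree K E r \<epsilon>
  for K :: nat and E :: "'v \<Rightarrow> 'v \<Rightarrow> bool" and r :: 'v and \<epsilon> :: real +
  fixes \<beta> p \<theta> :: real
  assumes p1: "1 \<le> p" and th0: "0 < \<theta>" and th1: "\<theta> \<le> 1 - (\<beta> - ln (real K)) / (p * \<epsilon>)"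
begin

lemma p_pos: "0 < p" using p1 by simp

text \<open>
  The hypothesis on \<open>\<theta>\<close> in the form in which it enters: it compares the growth
  \<open>exp ((\<beta> - p * \<epsilon>) * k) / K ^ k\<close> with
  \<open>exp (- \<theta> * p * \<epsilon> * k)\<close>.
\<close>

lemma exponent: "\<theta> * p * \<epsilon> \<le> p * \<epsilon> - \<beta> + ln (real K)"
proof -
  have "\<theta> * (p * \<epsilon>) \<le> (1 - (\<beta> - ln (real K)) / (p * \<epsilon>)) * (p * \<epsilon>)"
    using th1 p_pos eps by (intro mult_right_mono) auto
  also have "\<dots> = p * \<epsilon> - (\<beta> - ln (real K))" using p_pos eps by (simp add: field_simps)
  finally show ?thesis by (simp add: mult.assoc)
qed

text \<open>
  The ratio of all geometric series below. In the exponents it appears as \<open>\<rho> powr (p * k)\<close>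
  from the measures of cylinders and as \<open>\<rho> ^ j\<close> in the weights of Jensen's inequality.
\<close>

definition \<rho> :: real where "\<rho> = exp (- \<theta> * \<epsilon>)"

lemma \<rho>: "0 < \<rho>" "\<rho> < 1" using th0 eps by (auto simp: \<rho>_def)

lemma \<rho>_powr: "\<rho> powr x = exp (- \<theta> * \<epsilon> * x)" by (simp add: \<rho>_def powr_def)

section \<open>Energy of an upper gradient\<close>

text \<open>The consequence of Borel measurability that suffices for integration.\<close>

definition edgewise_measurable :: "('v point \<Rightarrow> ennreal) \<Rightarrow> bool" where
  "edgewise_measurable g \<longleftrightarrow> (\<forall>v. v \<noteq> r \<longrightarrow> (\<lambda>t. g (v, t) * indicator {0..<1} t) \<in> borel_measurable lborel)"

definition edge_energy :: "('v point \<Rightarrow> ennreal) \<Rightarrow> 'v \<Rightarrow> ennreal" where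
  "edge_energy g v = (\<integral>\<^sup>+ t. epowr (g (v, t)) p * ennreal (exp (- \<beta> * (real (depth v) - t))) * indicator {0..<1} t \<partial>lborel)"

definition level_energy :: "('v point \<Rightarrow> ennreal) \<Rightarrow> nat \<Rightarrow> ennreal" where
  "level_energy g k = (\<Sum>v\<in>{v. depth v = k}. edge_energy g v)"

definition energy :: "('v point \<Rightarrow> ennreal) \<Rightarrow> ennreal" where
  "energy g = (\<integral>\<^sup>+ x. epowr (g x) p \<partial>\<mu>_X E r \<beta>)"

lemma nn_integral_\<mu>:
  assumes h: "(\<lambda>z. h z) \<in> borel_measurable (length_measure r)"
  shows "(\<integral>\<^sup>+ x. h x \<partial>\<mu>_X E r \<beta>) = (\<integral>\<^sup>+ x. h x * ennreal (exp (- \<beta> * lv x)) \<partial>length_measure r)"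
proof -
  have "(\<lambda>z. ennreal (exp (- \<beta> * level E r z))) \<in> borel_measurable (length_measure r)
    \<longleftrightarrow> (\<lambda>z. ennreal (exp (- \<beta> * lv z))) \<in> borel_measurable (length_measure r)"
    by (intro measurable_cong) (simp add: level_eq)
  moreover have "(\<lambda>z. ennreal (exp (- \<beta> * lv z))) \<in> borel_measurable (length_measure r)"
    by (rule lv_measurable_length) simp
  ultimately have m: "(\<lambda>z. ennreal (exp (- \<beta> * level E r z))) \<in> borel_measurable (length_measure r)" by blast
  have "(\<integral>\<^sup>+ x. h x \<partial>\<mu>_X E r \<beta>) = (\<integral>\<^sup>+ x. ennreal (exp (- \<beta> * level E r x)) * h x \<partial>length_measure r)"
    unfolding \<mu>_X_def by (rule nn_integral_density[OF m h])
  also have "\<dots> = (\<integral>\<^sup>+ x. h x * ennreal (exp (- \<beta> * lv x)) \<partial>length_measure r)"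
    by (intro nn_integral_cong) (simp add: level_eq mult.commute)
  finally show ?thesis .
qed

lemma energy_eq:
  assumes g: "edgewise_measurable g"
  shows "energy g = (\<integral>\<^sup>+ v. (if v = r then 0 else edge_energy g v) \<partial>count_space UNIV)"
proof -
  have g': "\<And>v. v \<noteq> r \<Longrightarrow> (\<lambda>t. g (v, t) * indicator {0..<1} t) \<in> borel_measurable lborel"
    using g by (simp add: edgewise_measurable_def)
  have m1: "(\<lambda>z. epowr (g z) p) \<in> borel_measurable (length_measure r)"
    using measurable_edgewise[OF g', of "\<lambda>_. 1" p] by simp
  have m2: "(\<lambda>z. epowr (g z) p * ennreal (exp (- \<beta> * lv z))) \<in> borel_measurable (length_measure r)"
    by (rule measurable_edgewise[OF g']) auto
  show ?thesis
    unfolding energy_def nn_integral_\<mu>[OF m1] nn_integral_length[OF m2]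
    by (simp only: edge_energy_def lv_def fst_conv snd_conv)
qed

lemma edge_energy_le:
  assumes g: "edgewise_measurable g" and v: "v \<noteq> r"
  shows "edge_energy g v \<le> energy g"
proof -
  have "edge_energy g v = (\<integral>\<^sup>+ w. edge_energy g v * indicator {v} w \<partial>count_space UNIV)"
    by (simp add: nn_integral_cmult)
  also have "\<dots> \<le> energy g"
    unfolding energy_eq[OF g] using v by (intro nn_integral_mono) (auto simp: indicator_def)
  finally show ?thesis .
qed

text \<open>Each edge is counted for at most one \<open>n\<close>.\<close>

lemma suminf_level_energy_le:
  assumes g: "edgewise_measurable g"
  shows "(\<Sum>n. level_energy g (Suc (n + j))) \<le> energy g"
proof -
  let ?F = "\<lambda>v. if v = r then 0 else edge_energy g v"
  have "level_energy g (Suc m) = (\<integral>\<^sup>+ v. ?F v * indicator {v. depth v = Suc m} v \<partial>count_space UNIV)" for m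
  proof -
    have "(\<integral>\<^sup>+ v. ?F v * indicator {v. depth v = Suc m} v \<partial>count_space UNIV) =
      (\<Sum>v\<in>{v. depth v = Suc m}. ?F v * indicator {v. depth v = Suc m} v)"
      by (rule nn_integral_count_space'[OF finite_level]) auto
    also have "\<dots> = level_energy g (Suc m)"
      unfolding level_energy_def by (intro sum.cong) auto
    finally show ?thesis ..
  qed
  then have "(\<Sum>n. level_energy g (Suc (n + j))) =
    (\<integral>\<^sup>+ v. (\<Sum>n. ?F v * indicator {v. depth v = Suc (n + j)} v) \<partial>count_space UNIV)"
    by (simp only:) (rule nn_integral_suminf[symmetric], simp)
  also have "\<dots> \<le> (\<integral>\<^sup>+ v. ?F v \<partial>count_space UNIV)"
  proof (rule nn_integral_mono)
    fix v
    have "(\<Sum>n. ?F v * indicator {v. depth v = Suc (n + j)} v) =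
      (\<Sum>n\<in>{depth v - Suc j}. ?F v * indicator {v. depth v = Suc (n + j)} v)"
      by (rule suminf_finite) (auto simp: indicator_def)
    also have "\<dots> \<le> (\<Sum>n\<in>{depth v - Suc j}. ?F v)"
      by (intro sum_mono) (simp split: split_indicator)
    also have "\<dots> = ?F v" by simp
    finally show "(\<Sum>n. ?F v * indicator {v. depth v = Suc (n + j)} v) \<le> ?F v" .
  qed
  also have "\<dots> = energy g" by (rule energy_eq[OF g, symmetric])
  finally show ?thesis .
qed

text \<open>
  The largest ratio of two values of \<open>exp ((\<beta> - p * \<epsilon>) * s)\<close> on an interval of
  length \<open>1\<close>.
\<close>

definition edge_bound :: real where "edge_bound = exp \<bar>\<beta> - p * \<epsilon>\<bar>"

text \<open>
  Jensen's inequality on the unit interval, followed by replacing the level along the edge by the level of its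
  vertex in the quotient of the two densities.
\<close>

lemma edge_int_powr_le:
  assumes g: "edgewise_measurable g" and v: "v \<noteq> r"
  shows "epowr (edge_int g v) p \<le> ennreal (edge_bound * exp ((\<beta> - p * \<epsilon>) * real (depth v))) * edge_energy g v"
proof -
  define n where "n = real (depth v)"
  let ?h = "\<lambda>t. g (v, t) * indicator {0..<1} t * ennreal (exp (- \<epsilon> * (n - t)))"
  have gm [measurable]: "(\<lambda>t. g (v, t) * indicator {0..<1} t) \<in> borel_measurable lborel"
    using g v by (simp add: edgewise_measurable_def)
  have 1: "edge_int g v = (\<integral>\<^sup>+ t. indicator {0..<1} t * ?h t \<partial>lborel)"
    unfolding edge_int_def n_def by (intro nn_integral_cong) (auto simp: indicator_def)
  have "epowr (edge_int g v) p \<le> (\<integral>\<^sup>+ t. indicator {0..<1} t * epowr (?h t) p \<partial>lborel)"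
    unfolding 1 using p1 by (intro jensen_epowr) auto
  also have "\<dots> \<le> (\<integral>\<^sup>+ t. ennreal (edge_bound * exp ((\<beta> - p * \<epsilon>) * n)) *
      (epowr (g (v, t) * indicator {0..<1} t) p * ennreal (exp (- \<beta> * (n - t)))) \<partial>lborel)"
  proof (rule nn_integral_mono)
    fix t :: real
    show "indicator {0..<1} t * epowr (?h t) p \<le> ennreal (edge_bound * exp ((\<beta> - p * \<epsilon>) * n)) *
      (epowr (g (v, t) * indicator {0..<1} t) p * ennreal (exp (- \<beta> * (n - t))))"
    proof (cases "t \<in> {0..<1}")
      case True
      have "exp (- \<epsilon> * (n - t)) powr p = exp (- p * \<epsilon> * (n - t))" by (simp add: powr_def ac_simps)
      also have "- p * \<epsilon> * (n - t) = - (\<beta> - p * \<epsilon>) * t + (\<beta> - p * \<epsilon>) * n + - \<beta> * (n - t)"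
        by (simp add: algebra_simps)
      also have "exp \<dots> \<le> exp (\<bar>\<beta> - p * \<epsilon>\<bar> + (\<beta> - p * \<epsilon>) * n + - \<beta> * (n - t))"
      proof -
        have "- (\<beta> - p * \<epsilon>) * t \<le> \<bar>\<beta> - p * \<epsilon>\<bar> * t" using True by (intro mult_right_mono) auto
        also have "\<dots> \<le> \<bar>\<beta> - p * \<epsilon>\<bar> * 1" using True by (intro mult_left_mono) auto
        finally show ?thesis by simp
      qed
      also have "\<dots> = edge_bound * exp ((\<beta> - p * \<epsilon>) * n) * exp (- \<beta> * (n - t))"
        by (simp only: exp_add edge_bound_def)
      finally have "ennreal (exp (- \<epsilon> * (n - t)) powr p) \<le> ennreal (edge_bound * exp ((\<beta> - p * \<epsilon>) * n) * exp (- \<beta> * (n - t)))"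
        by (rule ennreal_leI)
      also have "\<dots> = ennreal (edge_bound * exp ((\<beta> - p * \<epsilon>) * n)) * ennreal (exp (- \<beta> * (n - t)))"
        by (rule ennreal_mult) (auto simp: edge_bound_def)
      finally have "epowr (g (v, t)) p * ennreal (exp (- \<epsilon> * (n - t)) powr p) \<le>
        epowr (g (v, t)) p * (ennreal (edge_bound * exp ((\<beta> - p * \<epsilon>) * n)) * ennreal (exp (- \<beta> * (n - t))))"
        by (rule mult_left_mono) simp
      then show ?thesis using True p_pos by (simp add: epowr_mult epowr_ennreal ac_simps)
    qed simp
  qed
  also have "\<dots> = ennreal (edge_bound * exp ((\<beta> - p * \<epsilon>) * n)) *
     (\<integral>\<^sup>+ t. epowr (g (v, t) * indicator {0..<1} t) p * ennreal (exp (- \<beta> * (n - t))) \<partial>lborel)"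
    by (rule nn_integral_cmult) simp
  also have "(\<integral>\<^sup>+ t. epowr (g (v, t) * indicator {0..<1} t) p * ennreal (exp (- \<beta> * (n - t))) \<partial>lborel) = edge_energy g v"
    unfolding edge_energy_def n_def by (intro nn_integral_cong) (auto simp: indicator_def)
  finally show ?thesis unfolding n_def .
qed

section \<open>Edge integrals along a boundary geodesic\<close>

text \<open>
  A bound for the variation of the function along \<open>\<zeta>\<close> beyond level \<open>n\<close>.
\<close>

definition tail :: "nat \<Rightarrow> ('v point \<Rightarrow> ennreal) \<Rightarrow> (nat \<Rightarrow> 'v) \<Rightarrow> ennreal" where
  "tail n g \<zeta> = (\<Sum>j. edge_int g (\<zeta> (Suc (n + j))))"

definition tail_bound :: real where "tail_bound = (1 - \<rho>) powr (1 - p) * edge_bound"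

lemma tail_bound_pos: "0 < tail_bound" using \<rho> by (simp add: tail_bound_def edge_bound_def)

lemma tail_measurable [measurable]: "tail n g \<in> borel_measurable \<nu>"
  unfolding tail_def[abs_def] by measurable

text \<open>
  The integral over the boundary is the average over the vertices of one level, each of mass
  \<open>1 / K ^ k\<close>. Here the condition on \<open>\<theta>\<close> enters.
\<close>

lemma edge_int_integral_le:
  assumes g: "edgewise_measurable g"
  shows "(\<integral>\<^sup>+ \<zeta>. epowr (edge_int g (\<zeta> (Suc k))) p \<partial>\<nu>) \<le> ennreal (edge_bound * \<rho> powr (p * real (Suc k))) * level_energy g (Suc k)"
proof -
  let ?a = "edge_bound * exp ((\<beta> - p * \<epsilon>) * real (Suc k))"
  have a0: "0 \<le> ?a" by (simp add: edge_bound_def)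
  have "(\<Sum>v\<in>{v. depth v = Suc k}. epowr (edge_int g v) p) \<le> (\<Sum>v\<in>{v. depth v = Suc k}. ennreal ?a * edge_energy g v)"
  proof (rule sum_mono)
    fix v assume "v \<in> {v. depth v = Suc k}"
    then have v: "depth v = Suc k" "v \<noteq> r" by auto
    then show "epowr (edge_int g v) p \<le> ennreal ?a * edge_energy g v"
      using edge_int_powr_le[OF g v(2)] by simp
  qed
  also have "\<dots> = ennreal ?a * level_energy g (Suc k)" by (simp add: level_energy_def sum_distrib_left)
  finally have "(\<integral>\<^sup>+ \<zeta>. epowr (edge_int g (\<zeta> (Suc k))) p \<partial>\<nu>) \<le>
    ennreal ?a * level_energy g (Suc k) * ennreal (1 / real K ^ Suc k)"
    unfolding nn_integral_step[of "\<lambda>v. epowr (edge_int g v) p" "Suc k"] by (rule mult_right_mono) simp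
  also have "\<dots> = ennreal (?a * (1 / real K ^ Suc k)) * level_energy g (Suc k)"
    using a0 by (simp only: ennreal_mult'[OF a0]) (simp add: ac_simps)
  also have "\<dots> \<le> ennreal (edge_bound * \<rho> powr (p * real (Suc k))) * level_energy g (Suc k)"
  proof (intro mult_right_mono ennreal_leI)
    have "1 / real K ^ Suc k = exp (- (real (Suc k) * ln (real K)))"
      using K_pos by (simp only: exp_minus exp_of_nat_mult exp_ln) (simp add: field_simps)
    then have "exp ((\<beta> - p * \<epsilon>) * real (Suc k)) * (1 / real K ^ Suc k) =
      exp ((\<beta> - p * \<epsilon>) * real (Suc k) + - (real (Suc k) * ln (real K)))"
      by (simp only: exp_add)
    also have "\<dots> = exp (- (p * \<epsilon> - \<beta> + ln (real K)) * real (Suc k))"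
      by (rule arg_cong[where f = exp]) (simp add: algebra_simps)
    also have "\<dots> \<le> exp (- (\<theta> * p * \<epsilon>) * real (Suc k))"
      using exponent by (intro exp_mono mult_right_mono) auto
    also have "\<dots> = \<rho> powr (p * real (Suc k))" by (simp add: \<rho>_powr ac_simps)
    finally have "edge_bound * (exp ((\<beta> - p * \<epsilon>) * real (Suc k)) * (1 / real K ^ Suc k)) \<le> edge_bound * \<rho> powr (p * real (Suc k))"
      by (rule mult_left_mono) (simp add: edge_bound_def)
    then show "?a * (1 / real K ^ Suc k) \<le> edge_bound * \<rho> powr (p * real (Suc k))" by (simp only: mult.assoc)
  qed simp
  finally show ?thesis .
qed

text \<open>
  Of the decay \<open>\<rho> powr (p * (n + 1 + j))\<close> of the \<open>j\<close>-th term, Jensen's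
  inequality for the weights \<open>\<rho> ^ j\<close> consumes \<open>\<rho> powr ((p - 1) * j)\<close>,
  and a factor \<open>\<rho> ^ j\<close> is left.
\<close>

lemma tail_integral_le:
  assumes g: "edgewise_measurable g"
  shows "(\<integral>\<^sup>+ \<zeta>. epowr (tail n g \<zeta>) p \<partial>\<nu>) \<le>
    ennreal (tail_bound * \<rho> powr (p * real (Suc n))) * (\<Sum>j. ennreal (\<rho> ^ j) * level_energy g (Suc (n + j)))"
proof -
  let ?c = "(1 - \<rho>) powr (1 - p)"
  have "(\<integral>\<^sup>+ \<zeta>. epowr (tail n g \<zeta>) p \<partial>\<nu>) \<le>
    (\<integral>\<^sup>+ \<zeta>. ennreal ?c * (\<Sum>j. ennreal ((\<rho> ^ j) powr (1 - p)) * epowr (edge_int g (\<zeta> (Suc (n + j)))) p) \<partial>\<nu>)"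
    unfolding tail_def using \<rho> p1 by (intro nn_integral_mono sum_powr_le)
  also have "\<dots> = ennreal ?c * (\<Sum>j. ennreal ((\<rho> ^ j) powr (1 - p)) * (\<integral>\<^sup>+ \<zeta>. epowr (edge_int g (\<zeta> (Suc (n + j)))) p \<partial>\<nu>))"
    by (simp add: nn_integral_cmult nn_integral_suminf)
  also have "\<dots> \<le> ennreal ?c * (\<Sum>j. ennreal ((\<rho> ^ j) powr (1 - p)) *
      (ennreal (edge_bound * \<rho> powr (p * real (Suc (n + j)))) * level_energy g (Suc (n + j))))"
    by (intro mult_left_mono suminf_le summableI edge_int_integral_le g) auto
  also have "(\<lambda>j. ennreal ((\<rho> ^ j) powr (1 - p)) *
      (ennreal (edge_bound * \<rho> powr (p * real (Suc (n + j)))) * level_energy g (Suc (n + j)))) =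
    (\<lambda>j. ennreal (edge_bound * \<rho> powr (p * real (Suc n))) * (ennreal (\<rho> ^ j) * level_energy g (Suc (n + j))))"
  proof
    fix j
    have "(\<rho> ^ j) powr (1 - p) * \<rho> powr (p * real (Suc (n + j))) = \<rho> powr (real j * (1 - p) + p * real (Suc (n + j)))"
      using \<rho> by (simp only: powr_add powr_powr powr_realpow[symmetric])
    also have "real j * (1 - p) + p * real (Suc (n + j)) = p * real (Suc n) + real j" by (simp add: algebra_simps)
    also have "\<rho> powr \<dots> = \<rho> powr (p * real (Suc n)) * \<rho> ^ j"
      using \<rho> by (simp only: powr_add powr_realpow)
    finally have "(\<rho> ^ j) powr (1 - p) * (edge_bound * \<rho> powr (p * real (Suc (n + j)))) = edge_bound * \<rho> powr (p * real (Suc n)) * \<rho> ^ j"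
      by (simp only: mult.left_commute[of _ edge_bound] mult.assoc)
    then have "ennreal ((\<rho> ^ j) powr (1 - p)) * ennreal (edge_bound * \<rho> powr (p * real (Suc (n + j)))) =
      ennreal (edge_bound * \<rho> powr (p * real (Suc n))) * ennreal (\<rho> ^ j)"
      using \<rho> by (simp only: ennreal_mult[symmetric] powr_ge_zero zero_le_power less_imp_le mult_nonneg_nonneg edge_bound_def exp_ge_zero)
    then show "ennreal ((\<rho> ^ j) powr (1 - p)) *
      (ennreal (edge_bound * \<rho> powr (p * real (Suc (n + j)))) * level_energy g (Suc (n + j))) =
      ennreal (edge_bound * \<rho> powr (p * real (Suc n))) * (ennreal (\<rho> ^ j) * level_energy g (Suc (n + j)))"
      by (simp only: mult.assoc[symmetric])
  qed
  also have "ennreal ?c * (\<Sum>j. ennreal (edge_bound * \<rho> powr (p * real (Suc n))) * (ennreal (\<rho> ^ j) * level_energy g (Suc (n + j)))) =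
    ennreal (tail_bound * \<rho> powr (p * real (Suc n))) * (\<Sum>j. ennreal (\<rho> ^ j) * level_energy g (Suc (n + j)))"
  proof -
    have "ennreal (tail_bound * \<rho> powr (p * real (Suc n))) = ennreal ?c * ennreal (edge_bound * \<rho> powr (p * real (Suc n)))"
      unfolding tail_bound_def by (subst ennreal_mult[symmetric]) (auto simp: edge_bound_def mult.assoc)
    then show ?thesis by (simp only: ennreal_suminf_cmult mult.assoc)
  qed
  finally show ?thesis .
qed

lemma tail_0_integral_le:
  assumes g: "edgewise_measurable g"
  shows "(\<integral>\<^sup>+ \<zeta>. epowr (tail 0 g \<zeta>) p \<partial>\<nu>) \<le> ennreal tail_bound * energy g"
proof -
  have "(\<integral>\<^sup>+ \<zeta>. epowr (tail 0 g \<zeta>) p \<partial>\<nu>) \<le>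
    ennreal (tail_bound * \<rho> powr (p * real (Suc 0))) * (\<Sum>j. ennreal (\<rho> ^ j) * level_energy g (Suc (0 + j)))"
    by (rule tail_integral_le[OF g])
  also have "\<dots> \<le> ennreal tail_bound * energy g"
  proof (rule mult_mono)
    show "ennreal (tail_bound * \<rho> powr (p * real (Suc 0))) \<le> ennreal tail_bound"
      using tail_bound_pos \<rho> p_pos by (intro ennreal_leI mult_left_le) (auto simp: powr_le1)
    have "(\<Sum>j. ennreal (\<rho> ^ j) * level_energy g (Suc (0 + j))) \<le> (\<Sum>j. level_energy g (Suc (j + 0)))"
    proof (intro suminf_le summableI)
      fix j
      have "ennreal (\<rho> ^ j) \<le> ennreal 1" using \<rho> by (intro ennreal_leI power_le_one) auto
      then show "ennreal (\<rho> ^ j) * level_energy g (Suc (0 + j)) \<le> level_energy g (Suc (j + 0))"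
        using mult_right_mono[of "ennreal (\<rho> ^ j)" 1 "level_energy g (Suc j)"] by simp
    qed
    also have "\<dots> \<le> energy g" by (rule suminf_level_energy_le[OF g])
    finally show "(\<Sum>j. ennreal (\<rho> ^ j) * level_energy g (Suc (0 + j))) \<le> energy g" .
  qed auto
  finally show ?thesis .
qed

text \<open>
  The factor \<open>\<rho> powr (- p * n)\<close> cancels the one in \<open>tail_integral_le\<close>. What
  remains is a convolution with the summable sequence \<open>\<rho> ^ j\<close>.
\<close>

lemma weighted_tail_integral_le:
  assumes g: "edgewise_measurable g"
  shows "(\<Sum>n. ennreal (\<rho> powr (- p * real n)) * (\<integral>\<^sup>+ \<zeta>. epowr (tail n g \<zeta>) p \<partial>\<nu>)) \<le>
    ennreal (tail_bound / (1 - \<rho>)) * energy g"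
proof -
  have "(\<Sum>n. ennreal (\<rho> powr (- p * real n)) * (\<integral>\<^sup>+ \<zeta>. epowr (tail n g \<zeta>) p \<partial>\<nu>)) \<le>
    (\<Sum>n. ennreal tail_bound * (\<Sum>j. ennreal (\<rho> ^ j) * level_energy g (Suc (n + j))))"
  proof (intro suminf_le summableI)
    fix n
    let ?S = "\<Sum>j. ennreal (\<rho> ^ j) * level_energy g (Suc (n + j))"
    have "ennreal (\<rho> powr (- p * real n)) * (\<integral>\<^sup>+ \<zeta>. epowr (tail n g \<zeta>) p \<partial>\<nu>) \<le>
      ennreal (\<rho> powr (- p * real n)) * (ennreal (tail_bound * \<rho> powr (p * real (Suc n))) * ?S)"
      by (intro mult_left_mono tail_integral_le g) simp
    also have "\<dots> = ennreal (\<rho> powr (- p * real n) * (tail_bound * \<rho> powr (p * real (Suc n)))) * ?S"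
      by (simp only: ennreal_mult'[OF powr_ge_zero, of \<rho> "- p * real n" "tail_bound * \<rho> powr (p * real (Suc n))"] mult.assoc)
    also have "\<rho> powr (- p * real n) * (tail_bound * \<rho> powr (p * real (Suc n))) = tail_bound * \<rho> powr p"
    proof -
      have "\<rho> powr (- p * real n) * \<rho> powr (p * real (Suc n)) = \<rho> powr p"
        by (simp add: powr_add[symmetric] algebra_simps)
      then show ?thesis by (simp only: mult.left_commute[of _ tail_bound])
    qed
    also have "ennreal (tail_bound * \<rho> powr p) * ?S \<le> ennreal tail_bound * ?S"
      using tail_bound_pos \<rho> p_pos by (intro mult_right_mono ennreal_leI mult_left_le) (auto simp: powr_le1)
    finally show "ennreal (\<rho> powr (- p * real n)) * (\<integral>\<^sup>+ \<zeta>. epowr (tail n g \<zeta>) p \<partial>\<nu>) \<le> ennreal tail_bound * ?S" .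
  qed
  also have "\<dots> = ennreal tail_bound * (\<Sum>j. ennreal (\<rho> ^ j) * (\<Sum>n. level_energy g (Suc (n + j))))"
    by (simp add: suminf_swap_ennreal[of "\<lambda>n j. ennreal (\<rho> ^ j) * level_energy g (Suc (n + j))"])
  also have "\<dots> \<le> ennreal tail_bound * (\<Sum>j. ennreal (\<rho> ^ j) * energy g)"
    by (intro mult_left_mono suminf_le summableI suminf_level_energy_le g) auto
  also have "\<dots> = ennreal tail_bound * (ennreal (1 / (1 - \<rho>)) * energy g)"
  proof -
    have "(\<Sum>j. ennreal (\<rho> ^ j)) = ennreal (1 / (1 - \<rho>))"
      by (rule suminf_ennreal_eq) (use \<rho> geometric_sums[of \<rho>] in auto)
    then show ?thesis by (simp only: ennreal_suminf_multc)
  qed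
  also have "\<dots> = ennreal (tail_bound / (1 - \<rho>)) * energy g"
    using tail_bound_pos \<rho> by (simp add: mult.assoc[symmetric] ennreal_mult[symmetric])
  finally show ?thesis .
qed

section \<open>The trace\<close>

lemma upper_gradient_edgewise: "upper_gradient E r \<epsilon> f g \<Longrightarrow> edgewise_measurable g"
  using upper_gradient_measurable_edge by (simp add: edgewise_measurable_def)

text \<open>
  The increments of \<open>f\<close> along \<open>\<zeta>\<close> are dominated by a convergent series.
\<close>

lemma trace_tail:
  assumes g: "upper_gradient E r \<epsilon> f g" and z: "\<zeta> \<in> B" and fin: "tail n g \<zeta> \<noteq> top"
  shows "(\<lambda>k. f (\<zeta> k, 0)) \<longlonglongrightarrow> trace f \<zeta>"
    and "ennreal \<bar>trace f \<zeta> - f (\<zeta> n, 0)\<bar> \<le> tail n g \<zeta>"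
proof -
  define x where "x j = f (\<zeta> (n + j), 0)" for j
  define a where "a j = enn2real (edge_int g (\<zeta> (Suc (n + j))))" for j
  have lt: "edge_int g (\<zeta> (Suc (n + j))) < top" for j
    using fin unfolding tail_def less_top by (rule ennreal_suminf_lessD)
  then have aj: "ennreal (a j) = edge_int g (\<zeta> (Suc (n + j)))" for j
    unfolding a_def by (simp add: less_top)
  have step: "\<bar>x (Suc j) - x j\<bar> \<le> a j" for j
  proof -
    have "ennreal \<bar>f (\<zeta> (Suc (n + j)), 0) - f (par (\<zeta> (Suc (n + j))), 0)\<bar> \<le> edge_int g (\<zeta> (Suc (n + j)))"
      using boundary_neq_root[OF z] by (intro upper_gradient_edge[OF g]) auto
    then have "ennreal \<bar>x (Suc j) - x j\<bar> \<le> ennreal (a j)"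
      by (simp add: x_def aj boundary_par[OF z])
    then show ?thesis by (simp add: a_def ennreal_le_iff)
  qed
  have "(\<Sum>j. ennreal (a j)) \<noteq> top" using fin by (simp add: tail_def aj)
  then have sa: "summable a" by (rule summable_suminf_not_top[rotated]) (simp add: a_def)
  then have sx: "summable (\<lambda>j. x (Suc j) - x j)"
    by (rule summable_comparison_test') (use step in simp)
  then have "(\<lambda>m. x 0 + (\<Sum>j<m. x (Suc j) - x j)) \<longlonglongrightarrow> x 0 + (\<Sum>j. x (Suc j) - x j)"
    by (intro tendsto_add tendsto_const summable_LIMSEQ)
  then have "x \<longlonglongrightarrow> x 0 + (\<Sum>j. x (Suc j) - x j)" by (simp add: sum_lessThan_telescope)
  then have "(\<lambda>k. f (\<zeta> (k + n), 0)) \<longlonglongrightarrow> x 0 + (\<Sum>j. x (Suc j) - x j)"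
    by (simp add: x_def[abs_def] add.commute)
  then have lim: "(\<lambda>k. f (\<zeta> k, 0)) \<longlonglongrightarrow> x 0 + (\<Sum>j. x (Suc j) - x j)"
    by (rule LIMSEQ_offset)
  then have tr: "trace f \<zeta> = x 0 + (\<Sum>j. x (Suc j) - x j)" unfolding trace_def by (rule limI)
  show "(\<lambda>k. f (\<zeta> k, 0)) \<longlonglongrightarrow> trace f \<zeta>" using lim unfolding tr .
  have "\<bar>\<Sum>j. x (Suc j) - x j\<bar> \<le> (\<Sum>j. \<bar>x (Suc j) - x j\<bar>)"
    by (rule summable_rabs) (rule summable_comparison_test'[OF sa], use step in simp)
  also have "\<dots> \<le> (\<Sum>j. a j)"
    by (intro suminf_le step sa) (rule summable_comparison_test'[OF sa], use step in simp)
  finally have "\<bar>trace f \<zeta> - f (\<zeta> n, 0)\<bar> \<le> (\<Sum>j. a j)" by (simp add: tr x_def)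
  then have "ennreal \<bar>trace f \<zeta> - f (\<zeta> n, 0)\<bar> \<le> ennreal (\<Sum>j. a j)" by (rule ennreal_leI)
  also have "\<dots> = (\<Sum>j. ennreal (a j))" by (rule suminf_ennreal2[symmetric, OF _ sa]) (simp add: a_def)
  also have "\<dots> = tail n g \<zeta>" by (simp add: tail_def aj)
  finally show "ennreal \<bar>trace f \<zeta> - f (\<zeta> n, 0)\<bar> \<le> tail n g \<zeta>" .
qed

lemma trace_le_tail:
  assumes "upper_gradient E r \<epsilon> f g" "\<zeta> \<in> B"
  shows "ennreal \<bar>trace f \<zeta> - f (\<zeta> n, 0)\<bar> \<le> tail n g \<zeta>"
  using trace_tail(2)[OF assms, of n] by (cases "tail n g \<zeta> = top") auto

lemma trace_measurable [measurable]: "trace f \<in> borel_measurable \<nu>"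
  unfolding trace_def by (intro borel_measurable_lim_metric step_measurable)

lemma Lp_norm_\<mu>: "Lp_norm (\<mu>_X E r \<beta>) p g = epowr (energy g) (1 / p)"
  by (simp add: Lp_norm_def energy_def)

lemma epowr_const: "0 \<le> b \<Longrightarrow> epowr (ennreal b * x) (1 / p) = ennreal (b powr (1 / p)) * epowr x (1 / p)"
  using p_pos by (simp add: epowr_mult epowr_ennreal)

text \<open>
  Minkowski's inequality for the constant \<open>\<bar>f (r, 0)\<bar>\<close>, whose norm is its value since
  \<open>\<nu>\<close> is a probability measure, and \<open>tail 0 g\<close>.
\<close>

lemma boundary_norm_le:
  assumes g: "upper_gradient E r \<epsilon> f g"
  shows "boundary_Lp_norm K E r \<epsilon> p (trace f) \<le> ennreal \<bar>f (r, 0)\<bar> + ennreal (tail_bound powr (1 / p)) * Lp_norm (\<mu>_X E r \<beta>) p g"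
proof -
  have "boundary_Lp_norm K E r \<epsilon> p (trace f) \<le> Lp_norm \<nu> p (\<lambda>\<zeta>. ennreal \<bar>f (r, 0)\<bar> + tail 0 g \<zeta>)"
    unfolding boundary_Lp_norm_def Lp_norm_def
  proof (intro epowr_mono nn_integral_mono)
    fix \<zeta> assume "\<zeta> \<in> space \<nu>"
    then have z: "\<zeta> \<in> B" by simp
    have "ennreal \<bar>trace f \<zeta>\<bar> \<le> ennreal (\<bar>f (r, 0)\<bar> + \<bar>trace f \<zeta> - f (\<zeta> 0, 0)\<bar>)"
      using boundary_0[OF z] by (intro ennreal_leI) simp
    also have "\<dots> = ennreal \<bar>f (r, 0)\<bar> + ennreal \<bar>trace f \<zeta> - f (\<zeta> 0, 0)\<bar>" by (rule ennreal_plus) auto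
    also have "\<dots> \<le> ennreal \<bar>f (r, 0)\<bar> + tail 0 g \<zeta>"
      by (intro add_left_mono trace_le_tail[OF g z])
    finally show "ennreal \<bar>trace f \<zeta>\<bar> \<le> ennreal \<bar>f (r, 0)\<bar> + tail 0 g \<zeta>" .
  qed (use p_pos in auto)
  also have "\<dots> \<le> Lp_norm \<nu> p (\<lambda>_. ennreal \<bar>f (r, 0)\<bar>) + Lp_norm \<nu> p (tail 0 g)"
    using p1 by (intro minkowski_Lp_norm) auto
  also have "Lp_norm \<nu> p (\<lambda>_. ennreal \<bar>f (r, 0)\<bar>) = ennreal \<bar>f (r, 0)\<bar>"
    using p_pos by (simp add: Lp_norm_def emeasure_B epowr_epowr)
  also have "Lp_norm \<nu> p (tail 0 g) \<le> ennreal (tail_bound powr (1 / p)) * Lp_norm (\<mu>_X E r \<beta>) p g"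
    unfolding Lp_norm_\<mu> epowr_const[OF less_imp_le[OF tail_bound_pos], symmetric]
    unfolding Lp_norm_def
    by (rule epowr_mono[OF tail_0_integral_le[OF upper_gradient_edgewise[OF g]]]) (use p_pos in simp)
  finally show ?thesis by (simp add: add_left_mono)
qed

text \<open>
  Two points of the same ball pass through the same vertex of level \<open>n\<close>, so both traces are compared
  with the value of \<open>f\<close> there. The averages over the cylinders then recombine to the integral over
  the boundary.
\<close>

lemma besov_E_le:
  assumes g: "upper_gradient E r \<epsilon> f g"
    and ball: "\<And>\<zeta>. \<zeta> \<in> B \<Longrightarrow> Metric_space.mball B d \<zeta> t = cyl n (\<zeta> n)"
  shows "epowr (besov_E K E r \<epsilon> p (trace f) t) p \<le> ennreal (2 * 2 powr p) * (\<integral>\<^sup>+ \<zeta>. epowr (tail n g \<zeta>) p \<partial>\<nu>)"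
proof -
  let ?R = "\<lambda>\<zeta>. epowr (tail n g \<zeta>) p" and ?c = "ennreal (2 powr p)"
  define h where "h v = (\<integral>\<^sup>+ \<xi>. ?R \<xi> * indicator (cyl n v) \<xi> \<partial>\<nu>)" for v
  have diff: "epowr (ennreal \<bar>trace f \<zeta> - trace f \<xi>\<bar>) p \<le> ?c * (?R \<zeta> + ?R \<xi>)"
    if z: "\<zeta> \<in> B" and x: "\<xi> \<in> cyl n (\<zeta> n)" for \<zeta> \<xi>
  proof -
    have xB: "\<xi> \<in> B" and xn: "\<xi> n = \<zeta> n" using x by (auto simp: cyl_def)
    have "ennreal \<bar>trace f \<zeta> - trace f \<xi>\<bar> \<le> ennreal (\<bar>trace f \<zeta> - f (\<zeta> n, 0)\<bar> + \<bar>trace f \<xi> - f (\<xi> n, 0)\<bar>)"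
      unfolding xn by (intro ennreal_leI) linarith
    also have "\<dots> = ennreal \<bar>trace f \<zeta> - f (\<zeta> n, 0)\<bar> + ennreal \<bar>trace f \<xi> - f (\<xi> n, 0)\<bar>" by (rule ennreal_plus) auto
    also have "\<dots> \<le> tail n g \<zeta> + tail n g \<xi>" by (intro add_mono trace_le_tail[OF g] z xB)
    finally have "epowr (ennreal \<bar>trace f \<zeta> - trace f \<xi>\<bar>) p \<le> epowr (tail n g \<zeta> + tail n g \<xi>) p"
      using p_pos by (intro epowr_mono) auto
    also have "\<dots> \<le> ?c * (?R \<zeta> + ?R \<xi>)" using p1 by (rule epowr_add_le)
    finally show ?thesis .
  qed
  have Kn: "ennreal (1 / real K ^ n) * ennreal (real K ^ n) = 1" "ennreal (1 / real K ^ n) \<noteq> 0"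
    using K_pos by (simp_all flip: ennreal_mult)
  have inner: "(\<integral>\<^sup>+ \<xi>\<in>Metric_space.mball B d \<zeta> t. epowr (ennreal \<bar>trace f \<zeta> - trace f \<xi>\<bar>) p \<partial>\<nu>) / emeasure \<nu> (Metric_space.mball B d \<zeta> t)
    \<le> ?c * (?R \<zeta> + ennreal (real K ^ n) * h (\<zeta> n))" if z: "\<zeta> \<in> B" for \<zeta>
  proof -
    have dz: "depth (\<zeta> n) = n" using z by (rule boundary_depth)
    have "(\<integral>\<^sup>+ \<xi>\<in>cyl n (\<zeta> n). epowr (ennreal \<bar>trace f \<zeta> - trace f \<xi>\<bar>) p \<partial>\<nu>) \<le>
      (\<integral>\<^sup>+ \<xi>. ?c * (?R \<zeta> * indicator (cyl n (\<zeta> n)) \<xi> + ?R \<xi> * indicator (cyl n (\<zeta> n)) \<xi>) \<partial>\<nu>)"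
      using diff[OF z] by (intro nn_integral_mono) (auto simp: indicator_def)
    also have "\<dots> = ?c * (?R \<zeta> * ennreal (1 / real K ^ n) + h (\<zeta> n))"
      by (simp add: nn_integral_cmult nn_integral_add emeasure_cyl[OF dz] h_def)
    finally have "(\<integral>\<^sup>+ \<xi>\<in>cyl n (\<zeta> n). epowr (ennreal \<bar>trace f \<zeta> - trace f \<xi>\<bar>) p \<partial>\<nu>) / ennreal (1 / real K ^ n)
      \<le> ?c * (?R \<zeta> * ennreal (1 / real K ^ n) + h (\<zeta> n)) / ennreal (1 / real K ^ n)"
      by (rule divide_right_mono_ennreal)
    also have "\<dots> = ?c * (?R \<zeta> * ennreal (1 / real K ^ n) + h (\<zeta> n)) * ennreal (real K ^ n)"
      using K_pos by (simp add: divide_ennreal_def inverse_ennreal)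
    also have "\<dots> = ?c * (?R \<zeta> * (ennreal (1 / real K ^ n) * ennreal (real K ^ n)) + ennreal (real K ^ n) * h (\<zeta> n))"
      by (simp only: distrib_left distrib_right ac_simps)
    also have "\<dots> = ?c * (?R \<zeta> + ennreal (real K ^ n) * h (\<zeta> n))" by (simp only: Kn mult_1_right)
    finally show ?thesis by (simp only: ball[OF z] emeasure_cyl[OF dz])
  qed
  have "epowr (besov_E K E r \<epsilon> p (trace f) t) p =
    (\<integral>\<^sup>+ \<zeta>. (\<integral>\<^sup>+ \<xi>\<in>Metric_space.mball B d \<zeta> t. epowr (ennreal \<bar>trace f \<zeta> - trace f \<xi>\<bar>) p \<partial>\<nu>) / emeasure \<nu> (Metric_space.mball B d \<zeta> t) \<partial>\<nu>)"
    using p_pos by (simp add: besov_E_def Let_def epowr_epowr)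
  also have "\<dots> \<le> (\<integral>\<^sup>+ \<zeta>. ?c * (?R \<zeta> + ennreal (real K ^ n) * h (\<zeta> n)) \<partial>\<nu>)"
    by (intro nn_integral_mono inner) simp
  also have "\<dots> = ?c * ((\<integral>\<^sup>+ \<zeta>. ?R \<zeta> \<partial>\<nu>) + ennreal (real K ^ n) * (\<integral>\<^sup>+ \<zeta>. h (\<zeta> n) \<partial>\<nu>))"
    by (simp add: nn_integral_cmult nn_integral_add)
  also have "ennreal (real K ^ n) * (\<integral>\<^sup>+ \<zeta>. h (\<zeta> n) \<partial>\<nu>) = (\<Sum>v\<in>{v. depth v = n}. h v)"
  proof -
    have "ennreal (real K ^ n) * (S * ennreal (1 / real K ^ n)) = S * (ennreal (1 / real K ^ n) * ennreal (real K ^ n))" for S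
      by (simp only: ac_simps)
    then show ?thesis unfolding nn_integral_step by (simp only: Kn mult_1_right)
  qed
  also have "(\<Sum>v\<in>{v. depth v = n}. h v) = (\<integral>\<^sup>+ \<zeta>. ?R \<zeta> \<partial>\<nu>)"
    unfolding h_def using nn_integral_cylinder[of ?R "\<lambda>_. 1" n] by simp
  also have "?c * ((\<integral>\<^sup>+ \<zeta>. ?R \<zeta> \<partial>\<nu>) + (\<integral>\<^sup>+ \<zeta>. ?R \<zeta> \<partial>\<nu>)) = ennreal (2 * 2 powr p) * (\<integral>\<^sup>+ \<zeta>. ?R \<zeta> \<partial>\<nu>)"
    by (simp add: ennreal_mult mult_2[symmetric] ac_simps)
  finally show ?thesis .
qed

lemma powr_tail_integral:
  assumes a: "0 < a"
  shows "(\<integral>\<^sup>+ t. ennreal (t powr (- \<theta> * p - 1)) * indicator {a..} t \<partial>lborel) = ennreal (a powr (- \<theta> * p) / (\<theta> * p))"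
proof -
  let ?s = "\<theta> * p"
  have s: "0 < ?s" using th0 p_pos by simp
  have "(\<integral>\<^sup>+ t. ennreal (t powr (- \<theta> * p - 1)) * indicator {a..} t \<partial>lborel) = ennreal (0 - - (a powr (- \<theta> * p) / ?s))"
  proof (rule nn_integral_FTC_atLeast)
    fix t assume "a \<le> t"
    then have t: "0 < t" using a by simp
    show "((\<lambda>t. - (t powr (- \<theta> * p) / ?s)) has_real_derivative t powr (- \<theta> * p - 1)) (at t)"
      using t s by (auto intro!: derivative_eq_intros simp: field_simps)
  next
    have "((\<lambda>t. - (t powr (- \<theta> * p) / ?s)) \<longlongrightarrow> - (0 / ?s)) at_top"
      using s by (intro tendsto_minus tendsto_divide tendsto_const tendsto_neg_powr filterlim_ident) auto
    then show "((\<lambda>t. - (t powr (- \<theta> * p) / ?s)) \<longlongrightarrow> 0) at_top" by simp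
  qed auto
  then show ?thesis by simp
qed

text \<open>
  The factors come, in this order, from \<open>besov_E_le\<close>, \<open>powr_tail_integral\<close> and
  \<open>weighted_tail_integral_le\<close>.
\<close>

definition besov_bound :: real where
  "besov_bound = 2 * 2 powr p * ((2 / \<epsilon>) powr (- \<theta> * p) / (\<theta> * p)) * (tail_bound / (1 - \<rho>))"

lemma besov_bound_pos: "0 < besov_bound"
  using tail_bound_pos \<rho> th0 p_pos eps by (simp add: besov_bound_def)

text \<open>
  It suffices to bound the contribution of a scale \<open>t\<close> by the sum over all levels with
  \<open>\<tau> n \<le> t\<close>, because already the integral over \<open>t \<ge> \<tau> n\<close> has the
  order \<open>\<tau> n powr (- \<theta> * p)\<close>, that is, \<open>\<rho> powr (- p * n)\<close>.
\<close>

lemma seminorm_le: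
  assumes g: "upper_gradient E r \<epsilon> f g"
  shows "besov_seminorm K E r \<epsilon> \<theta> p (trace f) \<le> ennreal (besov_bound powr (1 / p)) * Lp_norm (\<mu>_X E r \<beta>) p g"
proof -
  let ?\<Psi> = "\<lambda>n. \<integral>\<^sup>+ \<zeta>. epowr (tail n g \<zeta>) p \<partial>\<nu>"
  let ?c = "2 * 2 powr p"
  let ?F = "\<lambda>n t. ennreal (t powr (- \<theta> * p - 1)) * indicator {\<tau> n..} t * (ennreal ?c * ?\<Psi> n)"
  have pw: "epowr (besov_E K E r \<epsilon> p (trace f) t / ennreal (t powr \<theta>)) p / ennreal t * indicator {0<..} t \<le> (\<Sum>n. ?F n t)" for t
  proof (cases "0 < t")
    case t: True
    obtain n where n: "\<tau> n < t" "\<forall>\<zeta>\<in>B. Metric_space.mball B d \<zeta> t = cyl n (\<zeta> n)"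
      using ball_eq_cyl[OF t] by blast
    have "epowr (besov_E K E r \<epsilon> p (trace f) t / ennreal (t powr \<theta>)) p / ennreal t =
      ennreal (t powr (- \<theta> * p - 1)) * epowr (besov_E K E r \<epsilon> p (trace f) t) p"
    proof -
      have "epowr (besov_E K E r \<epsilon> p (trace f) t / ennreal (t powr \<theta>)) p / ennreal t =
        epowr (besov_E K E r \<epsilon> p (trace f) t) p * ennreal ((inverse (t powr \<theta>)) powr p) * ennreal (inverse t)"
        using t p_pos by (simp add: divide_ennreal_def inverse_ennreal epowr_mult epowr_ennreal)
      also have "\<dots> = epowr (besov_E K E r \<epsilon> p (trace f) t) p * ennreal ((inverse (t powr \<theta>)) powr p * inverse t)"
        using t by (simp add: ennreal_mult mult.assoc)
      also have "(inverse (t powr \<theta>)) powr p * inverse t = t powr (- \<theta> * p - 1)"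
        using t by (simp add: powr_minus[symmetric] powr_powr powr_diff divide_inverse)
      finally show ?thesis by (simp add: mult.commute)
    qed
    also have "\<dots> \<le> ennreal (t powr (- \<theta> * p - 1)) * (ennreal ?c * ?\<Psi> n)"
      using n(2) by (intro mult_left_mono besov_E_le[OF g]) auto
    also have "\<dots> = ?F n t" using n(1) by simp
    also have "\<dots> \<le> (\<Sum>n. ?F n t)"
      using sum_le_suminf[of "\<lambda>n. ?F n t" "{n}"] by simp
    finally show ?thesis using t by simp
  qed simp
  have "(\<integral>\<^sup>+ t\<in>{0<..}. epowr (besov_E K E r \<epsilon> p (trace f) t / ennreal (t powr \<theta>)) p / ennreal t \<partial>lborel) \<le>
    (\<integral>\<^sup>+ t. (\<Sum>n. ?F n t) \<partial>lborel)"
    using pw by (intro nn_integral_mono)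
  also have "\<dots> = (\<Sum>n. (\<integral>\<^sup>+ t. ennreal (t powr (- \<theta> * p - 1)) * indicator {\<tau> n..} t \<partial>lborel) * (ennreal ?c * ?\<Psi> n))"
    by (subst nn_integral_suminf) (simp_all add: nn_integral_multc)
  also have "\<dots> = (\<Sum>n. ennreal (?c * ((2 / \<epsilon>) powr (- \<theta> * p) / (\<theta> * p))) * (ennreal (\<rho> powr (- p * real n)) * ?\<Psi> n))"
  proof (intro suminf_cong)
    fix n
    have "\<tau> n powr (- \<theta> * p) = (2 / \<epsilon>) powr (- \<theta> * p) * \<rho> powr (- p * real n)"
    proof -
      have "exp (- \<epsilon> * real n) powr (- \<theta> * p) = \<rho> powr (- p * real n)"
        by (simp add: \<rho>_powr) (simp add: powr_def ac_simps)
      then show ?thesis unfolding \<tau>_def using eps by (subst powr_mult) auto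
    qed
    then have "ennreal (\<tau> n powr (- \<theta> * p) / (\<theta> * p)) * ennreal ?c =
      ennreal (?c * ((2 / \<epsilon>) powr (- \<theta> * p) / (\<theta> * p))) * ennreal (\<rho> powr (- p * real n))"
      using th0 p_pos by (simp add: ennreal_mult[symmetric] ac_simps)
    then show "(\<integral>\<^sup>+ t. ennreal (t powr (- \<theta> * p - 1)) * indicator {\<tau> n..} t \<partial>lborel) * (ennreal ?c * ?\<Psi> n) =
      ennreal (?c * ((2 / \<epsilon>) powr (- \<theta> * p) / (\<theta> * p))) * (ennreal (\<rho> powr (- p * real n)) * ?\<Psi> n)"
      by (simp only: powr_tail_integral[OF \<tau>_pos] mult.assoc[symmetric])
  qed
  also have "\<dots> \<le> ennreal (?c * ((2 / \<epsilon>) powr (- \<theta> * p) / (\<theta> * p))) * (ennreal (tail_bound / (1 - \<rho>)) * energy g)"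
    unfolding ennreal_suminf_cmult
    by (intro mult_left_mono weighted_tail_integral_le upper_gradient_edgewise[OF g]) simp
  also have "\<dots> = ennreal besov_bound * energy g"
    unfolding besov_bound_def using th0 p_pos tail_bound_pos \<rho> by (subst ennreal_mult) (auto simp: mult.assoc)
  finally have "besov_seminorm K E r \<epsilon> \<theta> p (trace f) \<le> epowr (ennreal besov_bound * energy g) (1 / p)"
    unfolding besov_seminorm_def using p_pos by (intro epowr_mono) auto
  then show ?thesis unfolding Lp_norm_\<mu> epowr_const[OF less_imp_le[OF besov_bound_pos]] .
qed

section \<open>The value at the root\<close>

lemma ex_child_root: "\<exists>v. v \<noteq> r \<and> par v = r"
proof -
  have "{w. w \<noteq> r \<and> par w = r} \<noteq> {}" using card_children[of r] K2 by (metis card.empty not_numeral_le_zero)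
  then show ?thesis by blast
qed

text \<open>
  On an edge at the root, \<open>f\<close> differs from \<open>f (r, 0)\<close> by at most
  \<open>edge_int g v\<close>. Hence \<open>\<bar>f\<bar>\<close> is there at least a constant
  \<open>c0\<close>, and the integral of this constant is compared with that of \<open>f\<close>.
\<close>

lemma root_value_le:
  assumes g: "upper_gradient E r \<epsilon> f g"
  shows "ennreal \<bar>f (r, 0)\<bar> \<le> epowr (ennreal (exp \<bar>\<beta>\<bar>) * (\<integral>\<^sup>+ x. epowr (ennreal \<bar>f x\<bar>) p \<partial>\<mu>_X E r \<beta>)) (1 / p)
     + epowr (ennreal (edge_bound * exp (\<beta> - p * \<epsilon>)) * energy g) (1 / p)"
proof -
  obtain v where v: "v \<noteq> r" "par v = r" using ex_child_root by blast
  have dv: "depth v = 1" using depth_par[of v] depth_pos[OF v(1)] v by simp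
  let ?J = "\<integral>\<^sup>+ x. epowr (ennreal \<bar>f x\<bar>) p \<partial>\<mu>_X E r \<beta>"
  have em: "edgewise_measurable g" by (rule upper_gradient_edgewise[OF g])
  have "epowr (edge_int g v) p \<le> ennreal (edge_bound * exp (\<beta> - p * \<epsilon>)) * edge_energy g v"
    using edge_int_powr_le[OF em v(1)] by (simp add: dv)
  also have "\<dots> \<le> ennreal (edge_bound * exp (\<beta> - p * \<epsilon>)) * energy g"
    by (intro mult_left_mono edge_energy_le em v) simp
  finally have "epowr (epowr (edge_int g v) p) (1 / p) \<le> epowr (ennreal (edge_bound * exp (\<beta> - p * \<epsilon>)) * energy g) (1 / p)"
    using p_pos by (intro epowr_mono) auto
  then have a: "edge_int g v \<le> epowr (ennreal (edge_bound * exp (\<beta> - p * \<epsilon>)) * energy g) (1 / p)"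
    using p_pos by (simp add: epowr_epowr)
  show ?thesis
  proof (cases "edge_int g v" rule: ennreal_cases)
    case (real a')
    define c0 where "c0 = max 0 (\<bar>f (r, 0)\<bar> - a')"
    have c0: "c0 \<le> \<bar>f (v, t)\<bar>" if "0 \<le> t" "t < 1" for t
    proof -
      have "ennreal \<bar>f (v, t) - f (r, 0)\<bar> \<le> ennreal a'"
        using upper_gradient_edge[OF g v(1) that] v real by simp
      then have "\<bar>f (v, t) - f (r, 0)\<bar> \<le> a'" using real by (simp add: ennreal_le_iff)
      then show ?thesis by (simp add: c0_def)
    qed
    let ?h = "\<lambda>z :: 'v point. if fst z = v then ennreal (c0 powr p) else 0"
    have hm: "?h \<in> borel_measurable (length_measure r)"
    proof (rule measurable_lengthI)
      fix w
      show "(\<lambda>t. ?h (w, t) * indicator {0..<1} t) \<in> borel_measurable lborel"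
        unfolding fst_conv
        by (rule borel_measurable_times_ennreal[OF borel_measurable_const borel_measurable_indicator]) simp
    qed
    have hm2: "(\<lambda>z. ?h z * ennreal (exp (- \<beta> * lv z))) \<in> borel_measurable (length_measure r)"
      by (intro borel_measurable_times_ennreal hm lv_measurable_length[of "\<lambda>s. ennreal (exp (- \<beta> * s))"]) measurable
    have "ennreal (exp (- \<bar>\<beta>\<bar>)) * ennreal (c0 powr p) =
       (\<integral>\<^sup>+ t. ennreal (exp (- \<bar>\<beta>\<bar>)) * ennreal (c0 powr p) * indicator {0..<1::real} t \<partial>lborel)"
      by (simp add: nn_integral_cmult)
    also have "\<dots> \<le> (\<integral>\<^sup>+ t. ?h (v, t) * ennreal (exp (- \<beta> * lv (v, t))) * indicator {0..<1} t \<partial>lborel)"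
    proof (rule nn_integral_mono)
      fix t :: real
      have "exp (- \<bar>\<beta>\<bar>) \<le> exp (- \<beta> * (1 - t))" if "0 \<le> t" "t < 1"
      proof -
        have "\<beta> * (1 - t) \<le> \<bar>\<beta>\<bar> * (1 - t)" using that by (intro mult_right_mono) auto
        also have "\<dots> \<le> \<bar>\<beta>\<bar> * 1" using that by (intro mult_left_mono) auto
        finally show ?thesis by simp
      qed
      then have "ennreal (c0 powr p) * ennreal (exp (- \<bar>\<beta>\<bar>)) \<le> ennreal (c0 powr p) * ennreal (exp (- \<beta> * (1 - t)))" if "0 \<le> t" "t < 1"
        using that by (intro mult_left_mono ennreal_leI) auto
      then show "ennreal (exp (- \<bar>\<beta>\<bar>)) * ennreal (c0 powr p) * indicator {0..<1} t \<le>
        ?h (v, t) * ennreal (exp (- \<beta> * lv (v, t))) * indicator {0..<1} t"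
        by (cases "t \<in> {0..<1}") (simp_all add: lv_def dv mult.commute)
    qed
    also have "\<dots> = (\<integral>\<^sup>+ w. (\<integral>\<^sup>+ t. ?h (v, t) * ennreal (exp (- \<beta> * lv (v, t))) * indicator {0..<1} t \<partial>lborel) * indicator {v} w \<partial>count_space UNIV)"
      by (simp add: nn_integral_cmult)
    also have "\<dots> = (\<integral>\<^sup>+ x. ?h x \<partial>\<mu>_X E r \<beta>)"
      unfolding nn_integral_\<mu>[OF hm] nn_integral_length[OF hm2]
      using v(1) by (intro nn_integral_cong) (auto simp: indicator_def)
    also have "\<dots> \<le> ?J"
    proof (rule nn_integral_mono)
      fix z assume "z \<in> space (\<mu>_X E r \<beta>)"
      then have z: "z \<in> T" by (simp add: \<mu>_X_def)
      have "ennreal (c0 powr p) \<le> epowr (ennreal \<bar>f z\<bar>) p" if "fst z = v"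
      proof -
        have "c0 \<le> \<bar>f z\<bar>" using c0[of "snd z"] T_cases[OF z] that by (metis prod.collapse)
        then show ?thesis using p_pos by (simp add: epowr_ennreal c0_def powr_mono2)
      qed
      then show "?h z \<le> epowr (ennreal \<bar>f z\<bar>) p" by simp
    qed
    finally have "ennreal (exp \<bar>\<beta>\<bar>) * (ennreal (exp (- \<bar>\<beta>\<bar>)) * ennreal (c0 powr p)) \<le> ennreal (exp \<bar>\<beta>\<bar>) * ?J"
      by (rule mult_left_mono) simp
    then have "ennreal (c0 powr p) \<le> ennreal (exp \<bar>\<beta>\<bar>) * ?J"
    proof -
      have "ennreal (exp \<bar>\<beta>\<bar>) * ennreal (exp (- \<bar>\<beta>\<bar>)) = ennreal (exp \<bar>\<beta>\<bar> * exp (- \<bar>\<beta>\<bar>))"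
        by (rule ennreal_mult[symmetric]) auto
      also have "exp \<bar>\<beta>\<bar> * exp (- \<bar>\<beta>\<bar>) = 1" by (simp only: exp_add[symmetric]) simp
      finally show ?thesis using \<open>_ \<le> ennreal (exp \<bar>\<beta>\<bar>) * ?J\<close>
        by (simp only: mult.assoc[symmetric] ennreal_1 mult_1_left)
    qed
    then have "epowr (ennreal (c0 powr p)) (1 / p) \<le> epowr (ennreal (exp \<bar>\<beta>\<bar>) * ?J) (1 / p)"
      using p_pos by (intro epowr_mono) auto
    then have c0J: "ennreal c0 \<le> epowr (ennreal (exp \<bar>\<beta>\<bar>) * ?J) (1 / p)"
      using p_pos by (simp add: epowr_ennreal powr_powr c0_def)
    have "ennreal \<bar>f (r, 0)\<bar> \<le> ennreal (c0 + a')" by (intro ennreal_leI) (simp add: c0_def)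
    also have "\<dots> = ennreal c0 + edge_int g v" using real by (simp add: c0_def)
    also have "\<dots> \<le> epowr (ennreal (exp \<bar>\<beta>\<bar>) * ?J) (1 / p) + epowr (ennreal (edge_bound * exp (\<beta> - p * \<epsilon>)) * energy g) (1 / p)"
      by (intro add_mono c0J a)
    finally show ?thesis .
  next
    case top
    then show ?thesis using a by (simp add: top_unique)
  qed
qed

section \<open>Boundedness and linearity\<close>

definition norm_bound :: real where "norm_bound = exp \<bar>\<beta>\<bar> + edge_bound * exp (\<beta> - p * \<epsilon>) + tail_bound + besov_bound"

lemma norm_bound: "0 < norm_bound" "exp \<bar>\<beta>\<bar> \<le> norm_bound" "edge_bound * exp (\<beta> - p * \<epsilon>) \<le> norm_bound" "tail_bound \<le> norm_bound" "besov_bound \<le> norm_bound"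
proof -
  have "0 \<le> edge_bound * exp (\<beta> - p * \<epsilon>)" "0 < exp \<bar>\<beta>\<bar>" by (auto simp: edge_bound_def)
  then show "0 < norm_bound" "exp \<bar>\<beta>\<bar> \<le> norm_bound" "edge_bound * exp (\<beta> - p * \<epsilon>) \<le> norm_bound" "tail_bound \<le> norm_bound" "besov_bound \<le> norm_bound"
    using tail_bound_pos besov_bound_pos unfolding norm_bound_def by linarith+
qed

text \<open>
  Four terms, each bounded by \<open>?M\<close>: two from the value at the root, one from the tail and one from
  the seminorm. After taking \<open>p\<close>-th powers the bound is affine in the energy, so the infimum over the
  upper gradients can be taken.
\<close>

lemma besov_norm_le:
  "besov_norm K E r \<epsilon> \<theta> p (trace f) \<le> ennreal (4 * norm_bound powr (1 / p)) * newton_norm E r \<epsilon> \<beta> p f"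
proof -
  let ?J = "\<integral>\<^sup>+ x. epowr (ennreal \<bar>f x\<bar>) p \<partial>\<mu>_X E r \<beta>"
  let ?N = "besov_norm K E r \<epsilon> \<theta> p (trace f)"
  have "epowr ?N p \<le> ennreal (4 powr p * norm_bound) * (?J + energy g)" if "g \<in> {g. upper_gradient E r \<epsilon> f g}" for g
  proof -
    have g: "upper_gradient E r \<epsilon> f g" using that by simp
    let ?M = "epowr (ennreal norm_bound * (?J + energy g)) (1 / p)"
    have M: "epowr (ennreal c * x) (1 / p) \<le> ?M" if "c \<le> norm_bound" "x \<le> ?J + energy g" for c x
      using that p_pos by (intro epowr_mono mult_mono ennreal_leI) auto
    have M': "ennreal (c powr (1 / p)) * Lp_norm (\<mu>_X E r \<beta>) p g \<le> ?M" if "0 < c" "c \<le> norm_bound" for c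
      using M[of c "energy g"] that by (simp add: Lp_norm_\<mu> epowr_const)
    have root: "ennreal \<bar>f (r, 0)\<bar> \<le> ?M + ?M"
      by (rule order_trans[OF root_value_le[OF g] add_mono[OF M M]]) (use norm_bound in auto)
    have "boundary_Lp_norm K E r \<epsilon> p (trace f) \<le> (?M + ?M) + ?M"
      using tail_bound_pos norm_bound by (intro order_trans[OF boundary_norm_le[OF g]] add_mono root M') auto
    moreover have "besov_seminorm K E r \<epsilon> \<theta> p (trace f) \<le> ?M"
      using besov_bound_pos norm_bound by (intro order_trans[OF seminorm_le[OF g]] M') auto
    ultimately have "?N \<le> ((?M + ?M) + ?M) + ?M" unfolding besov_norm_def by (rule add_mono)
    also have "\<dots> = ennreal 4 * ?M"
    proof -
      have "ennreal 4 = 1 + 1 + 1 + 1" by simp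
      then show ?thesis by (simp only: distrib_right mult_1)
    qed
    finally have "epowr ?N p \<le> epowr (ennreal 4 * ?M) p" using p_pos by (intro epowr_mono) auto
    also have "\<dots> = ennreal (4 powr p) * epowr ?M p"
      using p_pos by (simp only: epowr_mult epowr_ennreal)
    also have "epowr ?M p = ennreal norm_bound * (?J + energy g)" using p_pos by (simp add: epowr_epowr)
    also have "ennreal (4 powr p) * (ennreal norm_bound * (?J + energy g)) = ennreal (4 powr p * norm_bound) * (?J + energy g)"
      using norm_bound(1) by (simp add: ennreal_mult mult.assoc)
    finally show ?thesis .
  qed
  then have "epowr ?N p \<le> ennreal (4 powr p * norm_bound) * (?J + (INF g\<in>{g. upper_gradient E r \<epsilon> f g}. energy g))"
    using norm_bound(1) by (intro le_INF_affine) auto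
  then have "epowr (epowr ?N p) (1 / p) \<le> epowr (ennreal (4 powr p * norm_bound) * (?J + (INF g\<in>{g. upper_gradient E r \<epsilon> f g}. energy g))) (1 / p)"
    using p_pos by (intro epowr_mono) auto
  also have "\<dots> = ennreal ((4 powr p * norm_bound) powr (1 / p)) * newton_norm E r \<epsilon> \<beta> p f"
    using norm_bound(1) by (subst epowr_const) (auto simp: newton_norm_def energy_def)
  also have "(4 powr p * norm_bound) powr (1 / p) = 4 * norm_bound powr (1 / p)"
    using norm_bound(1) p_pos by (simp add: powr_mult powr_powr)
  finally show ?thesis using p_pos by (simp add: epowr_epowr)
qed

lemma newton_space_finite_energy:
  assumes "f \<in> newton_space E r \<epsilon> \<beta> p"
  obtains g where "upper_gradient E r \<epsilon> f g" "energy g < top"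
proof -
  have "epowr ((\<integral>\<^sup>+ x. epowr (ennreal \<bar>f x\<bar>) p \<partial>\<mu>_X E r \<beta>) + (INF g\<in>{g. upper_gradient E r \<epsilon> f g}. energy g)) (1 / p) \<noteq> top"
    using assms by (auto simp: newton_space_def newton_norm_def energy_def)
  then have "(INF g\<in>{g. upper_gradient E r \<epsilon> f g}. energy g) \<noteq> top"
    unfolding epowr_eq_top by (metis ennreal_add_eq_top)
  then have "(INF g\<in>{g. upper_gradient E r \<epsilon> f g}. energy g) < top" by (simp only: less_top)
  then show ?thesis using that unfolding INF_less_iff by blast
qed

text \<open>The tail is integrable to the power \<open>p\<close>, hence finite almost everywhere.\<close>

lemma trace_AE_limit:
  assumes "f \<in> newton_space E r \<epsilon> \<beta> p"
  shows "AE \<zeta> in \<nu>. (\<lambda>k. f (\<zeta> k, 0)) \<longlonglongrightarrow> trace f \<zeta>"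
proof -
  obtain g where g: "upper_gradient E r \<epsilon> f g" "energy g < top"
    using newton_space_finite_energy[OF assms] .
  have "(\<integral>\<^sup>+ \<zeta>. epowr (tail 0 g \<zeta>) p \<partial>\<nu>) \<le> ennreal tail_bound * energy g"
    by (rule tail_0_integral_le[OF upper_gradient_edgewise[OF g(1)]])
  also have "\<dots> < top" using g(2) by (simp add: ennreal_mult_less_top)
  finally have "AE \<zeta> in \<nu>. epowr (tail 0 g \<zeta>) p \<noteq> \<infinity>"
    by (intro nn_integral_PInf_AE) auto
  then show ?thesis using AE_space
  proof eventually_elim
    case (elim \<zeta>)
    then show ?case using trace_tail(1)[OF g(1), of \<zeta> 0] by (simp add: epowr_eq_top)
  qed
qed

lemma trace_linear: "linear_operator (newton_space E r \<epsilon> \<beta> p) \<nu> trace"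
  unfolding linear_operator_def
proof (intro ballI allI)
  fix f g :: "'v point \<Rightarrow> real" and a b :: real
  assume "f \<in> newton_space E r \<epsilon> \<beta> p" "g \<in> newton_space E r \<epsilon> \<beta> p"
  then have "AE \<zeta> in \<nu>. (\<lambda>k. f (\<zeta> k, 0)) \<longlonglongrightarrow> trace f \<zeta>" "AE \<zeta> in \<nu>. (\<lambda>k. g (\<zeta> k, 0)) \<longlonglongrightarrow> trace g \<zeta>"
    by (auto intro: trace_AE_limit)
  then show "AE \<zeta> in \<nu>. trace (\<lambda>x. a * f x + b * g x) \<zeta> = a * trace f \<zeta> + b * trace g \<zeta>"
  proof eventually_elim
    case (elim \<zeta>)
    then have "(\<lambda>k. a * f (\<zeta> k, 0) + b * g (\<zeta> k, 0)) \<longlonglongrightarrow> a * trace f \<zeta> + b * trace g \<zeta>"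
      by (intro tendsto_intros)
    then show ?case unfolding trace_def[of "\<lambda>x. a * f x + b * g x"] by (rule limI)
  qed
qed

lemma trace_in_besov_space:
  assumes "f \<in> newton_space E r \<epsilon> \<beta> p"
  shows "trace f \<in> besov_space K E r \<epsilon> \<theta> p"
proof -
  have "newton_norm E r \<epsilon> \<beta> p f < top" using assms by (simp add: newton_space_def)
  then have "besov_norm K E r \<epsilon> \<theta> p (trace f) < top"
    using besov_norm_le[of f] by (auto intro: le_less_trans simp: ennreal_mult_less_top)
  then show ?thesis unfolding besov_norm_def besov_space_def by (simp add: trace_measurable)
qed

end

theorem proposition6p1:
  fixes K :: nat and E :: "'v \<Rightarrow> 'v \<Rightarrow> bool" and r :: 'v
    and \<epsilon> \<beta> p \<theta> :: real
  assumes "2 \<le> K" and "0 < \<epsilon>" and "ln (real K) < \<beta>" and "1 \<le> p"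
    and "regular_rooted_tree K E r"
    and "0 < \<theta>" and "\<theta> \<le> 1 - (\<beta> - ln (real K)) / (p * \<epsilon>)"
  shows "\<exists>(C::real) (Tr :: ('v point \<Rightarrow> real) \<Rightarrow> (nat \<Rightarrow> 'v) \<Rightarrow> real). 0 < C \<and>
    (\<forall>f\<in>newton_space E r \<epsilon> \<beta> p. Tr f \<in> besov_space K E r \<epsilon> \<theta> p) \<and>
    linear_operator (newton_space E r \<epsilon> \<beta> p) (\<nu>_boundary K E r \<epsilon>) Tr \<and>
    (\<forall>f\<in>newton_space E r \<epsilon> \<beta> p. \<forall>g. minimal_upper_gradient E r \<epsilon> \<beta> p f g \<longrightarrow>
       boundary_Lp_norm K E r \<epsilon> p (Tr f)
         \<le> ennreal \<bar>f (r, 0)\<bar> + ennreal C * Lp_norm (\<mu>_X E r \<beta>) p g \<and>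
       besov_seminorm K E r \<epsilon> \<theta> p (Tr f) \<le> ennreal C * Lp_norm (\<mu>_X E r \<beta>) p g) \<and>
    (\<exists>C'::real. 0 < C' \<and> (\<forall>f\<in>newton_space E r \<epsilon> \<beta> p.
       besov_norm K E r \<epsilon> \<theta> p (Tr f) \<le> ennreal C' * newton_norm E r \<epsilon> \<beta> p f)) \<and>
    (\<forall>f. lipschitz_tree E r \<epsilon> f \<longrightarrow>
       (\<exists>F. continuous_extension E r \<epsilon> f F \<and>
            (\<forall>\<zeta>\<in>tree_boundary E r. Tr f \<zeta> = F (Inr \<zeta>))))"
proof -
  interpret trace_setting K E r \<epsilon> \<beta> p \<theta>
    using assms by unfold_locales auto
  define C where "C = norm_bound powr (1 / p)"
  have C: "0 < C" "tail_bound powr (1 / p) \<le> C" "besov_bound powr (1 / p) \<le> C"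
    using norm_bound tail_bound_pos besov_bound_pos p_pos by (auto simp: C_def powr_mono2)
  have "boundary_Lp_norm K E r \<epsilon> p (trace f) \<le> ennreal \<bar>f (r, 0)\<bar> + ennreal C * Lp_norm (\<mu>_X E r \<beta>) p g \<and>
       besov_seminorm K E r \<epsilon> \<theta> p (trace f) \<le> ennreal C * Lp_norm (\<mu>_X E r \<beta>) p g"
    if "minimal_upper_gradient E r \<epsilon> \<beta> p f g" for f g
  proof -
    have g: "upper_gradient E r \<epsilon> f g" using that by (simp add: minimal_upper_gradient_def)
    show ?thesis using C
      by (intro conjI order_trans[OF boundary_norm_le[OF g]] order_trans[OF seminorm_le[OF g]]
          add_left_mono mult_right_mono ennreal_leI) auto
  qed
  moreover have "0 < 4 * norm_bound powr (1 / p)" using norm_bound by simp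
  moreover have "\<exists>F. continuous_extension E r \<epsilon> f F \<and> (\<forall>\<zeta>\<in>tree_boundary E r. trace f \<zeta> = F (Inr \<zeta>))"
    if "lipschitz_tree E r \<epsilon> f" for f
    using lipschitz_extension[OF that] by (simp add: trace_def)
  ultimately show ?thesis
    using C(1) trace_in_besov_space trace_linear besov_norm_le
    by (intro exI[of _ C] exI[of _ trace]) blast
qed

end
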